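(* Let $N\ge 1$ and $K_1,\dots,K_N\ge 2$ be integers and $K=K_1\cdots K_N$. Consider games of size $(N,(K_i)_{i=1}^N)$, and let $\mathcal W,\mathcal P\subset\mathbb R^{NK}$ and $\mathcal I=\mathbb R^K$ be the sets of weighted potential games, exact potential games and identical-payoffs games of this size, with $K_w=\dim\mathcal W$ and $K_p=\dim\mathcal P$. Then: (i) Almost all weighted potential games are regular: the set of irregular (i.e. not regular) games in $\mathcal W$ is closed relative to $\mathcal W$ and has $K_w$-dimensional measure zero. (ii) Almost all exact potential games are regular: the set of irregular games in $\mathcal P$ is closed in $\mathcal P$ and has $K_p$-dimensional Lebesgue measure zero in the linear space $\mathcal P$. (iii) Almost all games with identical payoffs are regular: the set of irregular games in $\mathcal I=\mathbb R^K$ is closed and has $K$-dimensional Lebesgue measure zero.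
   Context: Games. A game of size $(N,(K_i)_{i=1}^N)$ has players $1,\dots,N$; player $i$ has pure strategy set $Y_i=\{y_i^1,\dots,y_i^{K_i}\}$; $Y=\prod_i Y_i$, so $|Y|=K$; player $i$ has utility $u_i:Y\to\mathbb R$. The game is identified with the vector $(u_i(y))_{i,\,y\in Y}\in\mathbb R^{NK}$. Classes. A game is a weighted potential game if there are $u:Y\to\mathbb R$ (the pure form of the potential) and weights $w_i>0$ with $u_i(y_i',y_{-i})-u_i(y_i'',y_{-i})=w_i\,(u(y_i',y_{-i})-u(y_i'',y_{-i}))$ for all $i$, $y_i',y_i''\in Y_i$, $y_{-i}\in\prod_{j\ne i}Y_j$; it is an exact potential game if this holds with all $w_i=1$; it is an identical-payoffs game if there is $u:Y\to\mathbb R$ with $u_i=u$ for all $i$. Identical-payoffs games are represented by the single vector $u\in\mathbb R^K=\mathcal I$. $\mathcal P$ is a linear subspace of $\mathbb R^{NK}$. $\mathcal W$ is a semialgebraic subset of $\mathbb R^{NK}$ of dimension $K_w$; "$K_w$-dimensional measure" on $\mathcal W$ means $K_w$-dimensional Hausdorff measure. Mixed strategies. $X_i=\{x_i=(x_i^1,\dots,x_i^{K_i-1})\in\mathbb R^{K_i-1}: 0\le x_i^k\le 1,\ \sum_k x_i^k\le 1\}$, $X=\prod_i X_i$. The weight $x_i$ puts on $y_i^k$ is $T_i^1(x_i)=1-\sum_{k=1}^{K_i-1}x_i^k$ for $k=1$ and $T_i^k(x_i)=x_i^{k-1}$ for $2\le k\le K_i$. Expected utility: $U_i(x)=\sum_{(y_1^{k_1},\dots,y_N^{k_N})\in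 Y}u_i(y_1^{k_1},\dots,y_N^{k_N})\prod_{j=1}^N T_j^{k_j}(x_j)$, a polynomial in $x$ (derivatives are taken of this polynomial). $U_i(y_i^k,x_{-i})$ is the value when player $i$ puts all weight on $y_i^k$ and the others use $x_{-i}=(x_j)_{j\ne i}$. A strategy $x\in X$ is a (Nash) equilibrium if $U_i(x_i,x_{-i})\ge U_i(x_i',x_{-i})$ for all $i$ and $x_i'\in X_i$. The carrier of $x_i$ is $\mathrm{carr}_i(x_i)=\{y_i^k\in Y_i:T_i^k(x_i)>0\}$. Regularity. Let $x^*$ be an equilibrium, and reorder each $Y_i$ so that $y_i^1\in\mathrm{carr}_i(x_i^* )$. Set $\tilde F_i^k(x)=T_i^1(x_i)\,x_i^k\,[U_i(y_i^{k+1},x_{-i})-U_i(y_i^1,x_{-i})]$ for $i=1,\dots,N$, $k=1,\dots,K_i-1$, and $\tilde F=(\tilde F_i^k)_{i,k}$. The equilibrium $x^*$ is regular if the Jacobian $D_x\tilde F(x^* )$ is non-singular (this does not depend on which actions in the carriers are chosen as the reference actions $y_i^1$). A game is regular if all of its equilibria are regular. *)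

theory Defs
  imports "HOL-Analysis.Analysis"
begin

text \<open>
  Players are the elements of a finite type \<open>'n\<close>, so \<open>N = CARD('n)\<close>; the actions of player \<open>i\<close>
  are the numbers \<open>1, \<dots>, K i\<close>. Two further finite types index coordinates:

  \<^item> \<open>'y\<close> is the set of pure strategy profiles, where \<open>act y i\<close> is the action of player \<open>i\<close> in the
    profile \<open>y\<close>. The assumption \<open>profile_labelling K act\<close> makes it the product of the action sets,
    so \<open>CARD('y)\<close> is the product of the \<open>K i\<close>.
  \<^item> \<open>'s\<close> is the set of pairs \<open>(i, k)\<close> with \<open>1 \<le> k \<le> K i - 1\<close>, via \<open>idx\<close>. It indexes the
    coordinates of mixed strategies.

  For every choice of \<open>N\<close> and of the \<open>K i\<close> there are types of these cardinalities. Games are the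
  vectors \<open>g :: real^'y^'n\<close>, with \<open>g $ i $ y\<close> the utility of player \<open>i\<close> at the profile \<open>y\<close>.
\<close>

definition profile_labelling :: "('n \<Rightarrow> nat) \<Rightarrow> ('y \<Rightarrow> 'n \<Rightarrow> nat) \<Rightarrow> bool" where
  "profile_labelling K act \<longleftrightarrow> bij_betw act UNIV {a. \<forall>i. a i \<in> {1..K i}}"

definition coordinate_labelling :: "('n \<Rightarrow> nat) \<Rightarrow> ('s \<Rightarrow> 'n \<times> nat) \<Rightarrow> bool" where
  "coordinate_labelling K idx \<longleftrightarrow> bij_betw idx UNIV (SIGMA i:UNIV. {1..K i - 1})"


subsection \<open>Classes of games\<close>

definition has_potential ::
  "('y::finite \<Rightarrow> 'n::finite \<Rightarrow> nat) \<Rightarrow> real^'y^'n \<Rightarrow> ('n \<Rightarrow> real) \<Rightarrow> ('y \<Rightarrow> real) \<Rightarrow> bool" where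
  "has_potential act g w u \<longleftrightarrow>
     (\<forall>i y y'. (\<forall>j. j \<noteq> i \<longrightarrow> act y j = act y' j) \<longrightarrow>
        g $ i $ y - g $ i $ y' = w i * (u y - u y'))"

definition weighted_potential_games ::
  "('y::finite \<Rightarrow> 'n::finite \<Rightarrow> nat) \<Rightarrow> (real^'y^'n) set" where
  "weighted_potential_games act = {g. \<exists>w u. (\<forall>i. w i > 0) \<and> has_potential act g w u}"

definition exact_potential_games ::
  "('y::finite \<Rightarrow> 'n::finite \<Rightarrow> nat) \<Rightarrow> (real^'y^'n) set" where
  "exact_potential_games act = {g. \<exists>u. has_potential act g (\<lambda>_. 1) u}"

definition identical_payoffs_game :: "real^'y \<Rightarrow> real^'y^'n" where
  "identical_payoffs_game u = (\<chi> i. u)"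

lemma subspace_exact_potential_games: "subspace (exact_potential_games act)"
  unfolding subspace_def
proof (intro conjI ballI allI)
  show "0 \<in> exact_potential_games act"
    by (auto simp: exact_potential_games_def has_potential_def intro!: exI[of _ "\<lambda>_. 0"])
next
  fix g h assume "g \<in> exact_potential_games act" "h \<in> exact_potential_games act"
  then obtain u v where "has_potential act g (\<lambda>_. 1) u" "has_potential act h (\<lambda>_. 1) v"
    by (auto simp: exact_potential_games_def)
  then have "has_potential act (g + h) (\<lambda>_. 1) (\<lambda>y. u y + v y)"
    by (fastforce simp: has_potential_def algebra_simps)
  then show "g + h \<in> exact_potential_games act"
    by (auto simp: exact_potential_games_def)
next
  fix c g assume "g \<in> exact_potential_games act"
  then obtain u where "has_potential act g (\<lambda>_. 1) u"
    by (auto simp: exact_potential_games_def)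
  then have "has_potential act (c *\<^sub>R g) (\<lambda>_. 1) (\<lambda>y. c * u y)"
    by (simp add: has_potential_def flip: right_diff_distrib)
  then show "c *\<^sub>R g \<in> exact_potential_games act"
    by (auto simp: exact_potential_games_def)
qed


subsection \<open>Mixed strategies and equilibria\<close>

definition mixed_strategies ::
  "('n::finite \<Rightarrow> nat) \<Rightarrow> ('s::finite \<Rightarrow> 'n \<times> nat) \<Rightarrow> (real^'s) set" where
  "mixed_strategies K idx =
     {x. \<forall>i. (\<forall>k\<in>{1..K i - 1}. 0 \<le> x $ inv idx (i, k) \<and> x $ inv idx (i, k) \<le> 1) \<and>
             (\<Sum>k=1..K i - 1. x $ inv idx (i, k)) \<le> 1}"

text \<open>The weight that \<open>x\<close> puts on action \<open>k\<close> of player \<open>i\<close>.\<close>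

definition weight ::
  "('n::finite \<Rightarrow> nat) \<Rightarrow> ('s::finite \<Rightarrow> 'n \<times> nat) \<Rightarrow> real^'s \<Rightarrow> 'n \<Rightarrow> nat \<Rightarrow> real" where
  "weight K idx x i k =
     (if k = 1 then 1 - (\<Sum>l=1..K i - 1. x $ inv idx (i, l)) else x $ inv idx (i, k - 1))"

text \<open>The utility of player \<open>i\<close> when every player \<open>j\<close> puts weight \<open>t j k\<close> on action \<open>k\<close>.\<close>

definition expected_payoff ::
  "('y::finite \<Rightarrow> 'n::finite \<Rightarrow> nat) \<Rightarrow> real^'y^'n \<Rightarrow> 'n \<Rightarrow> ('n \<Rightarrow> nat \<Rightarrow> real) \<Rightarrow> real" where
  "expected_payoff act g i t = (\<Sum>y\<in>UNIV. g $ i $ y * (\<Prod>j\<in>UNIV. t j (act y j)))"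

definition utility ::
  "('n::finite \<Rightarrow> nat) \<Rightarrow> ('y::finite \<Rightarrow> 'n \<Rightarrow> nat) \<Rightarrow> ('s::finite \<Rightarrow> 'n \<times> nat) \<Rightarrow>
   real^'y^'n \<Rightarrow> 'n \<Rightarrow> real^'s \<Rightarrow> real" where
  "utility K act idx g i x = expected_payoff act g i (weight K idx x)"

text \<open>The utility of player \<open>i\<close> when \<open>i\<close> plays action \<open>k\<close> and the others play according to \<open>x\<close>.\<close>

definition pure_utility ::
  "('n::finite \<Rightarrow> nat) \<Rightarrow> ('y::finite \<Rightarrow> 'n \<Rightarrow> nat) \<Rightarrow> ('s::finite \<Rightarrow> 'n \<times> nat) \<Rightarrow>
   real^'y^'n \<Rightarrow> 'n \<Rightarrow> nat \<Rightarrow> real^'s \<Rightarrow> real" where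
  "pure_utility K act idx g i k x =
     expected_payoff act g i ((weight K idx x)(i := (\<lambda>l. if l = k then 1 else 0)))"

definition equilibrium ::
  "('n::finite \<Rightarrow> nat) \<Rightarrow> ('y::finite \<Rightarrow> 'n \<Rightarrow> nat) \<Rightarrow> ('s::finite \<Rightarrow> 'n \<times> nat) \<Rightarrow>
   real^'y^'n \<Rightarrow> real^'s \<Rightarrow> bool" where
  "equilibrium K act idx g x \<longleftrightarrow>
     x \<in> mixed_strategies K idx \<and>
     (\<forall>i. \<forall>x'\<in>mixed_strategies K idx.
        (\<forall>s. fst (idx s) \<noteq> i \<longrightarrow> x' $ s = x $ s) \<longrightarrow>
        utility K act idx g i x \<ge> utility K act idx g i x')"

definition carr ::
  "('n::finite \<Rightarrow> nat) \<Rightarrow> ('s::finite \<Rightarrow> 'n \<times> nat) \<Rightarrow> 'n \<Rightarrow> real^'s \<Rightarrow> nat set" where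
  "carr K idx i x = {k \<in> {1..K i}. weight K idx x i k > 0}"


subsection \<open>Regularity\<close>

definition Ftilde ::
  "('n::finite \<Rightarrow> nat) \<Rightarrow> ('y::finite \<Rightarrow> 'n \<Rightarrow> nat) \<Rightarrow> ('s::finite \<Rightarrow> 'n \<times> nat) \<Rightarrow>
   real^'y^'n \<Rightarrow> real^'s \<Rightarrow> real^'s" where
  "Ftilde K act idx g x =
     (\<chi> s. case idx s of (i, k) \<Rightarrow>
        weight K idx x i 1 * x $ s *
        (pure_utility K act idx g i (k + 1) x - pure_utility K act idx g i 1 x))"

text \<open>
  Reordering the actions of every player \<open>i\<close> by a permutation \<open>\<sigma> i\<close> (old number \<open>k\<close> becomes
  \<open>\<sigma> i k\<close>) leaves the game vector as it is and only renumbers the actions, replacing \<open>act\<close> by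
  \<open>\<lambda>y i. \<sigma> i (act y i)\<close>; the coordinates of the strategy change from \<open>x\<close> to \<open>x'\<close>. Regularity asks
  for a reordering that puts an action of the carrier first and makes the Jacobian invertible.
  Which such reordering is used does not matter.
\<close>

definition regular_equilibrium ::
  "('n::finite \<Rightarrow> nat) \<Rightarrow> ('y::finite \<Rightarrow> 'n \<Rightarrow> nat) \<Rightarrow> ('s::finite \<Rightarrow> 'n \<times> nat) \<Rightarrow>
   real^'y^'n \<Rightarrow> real^'s \<Rightarrow> bool" where
  "regular_equilibrium K act idx g x \<longleftrightarrow>
     equilibrium K act idx g x \<and>
     (\<exists>\<sigma> x'. (\<forall>i. \<sigma> i permutes {1..K i}) \<and>
             (\<forall>i. \<forall>k\<in>{1..K i}. weight K idx x' i (\<sigma> i k) = weight K idx x i k) \<and>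
             (\<forall>i. 1 \<in> carr K idx i x') \<and>
             invertible (jacobian (Ftilde K (\<lambda>y i. \<sigma> i (act y i)) idx g) (at x')))"

definition regular_game ::
  "('n::finite \<Rightarrow> nat) \<Rightarrow> ('y::finite \<Rightarrow> 'n \<Rightarrow> nat) \<Rightarrow> ('s::finite \<Rightarrow> 'n \<times> nat) \<Rightarrow>
   real^'y^'n \<Rightarrow> bool" where
  "regular_game K act idx g \<longleftrightarrow>
     (\<forall>x. equilibrium K act idx g x \<longrightarrow> regular_equilibrium K act idx g x)"


subsection \<open>Dimension of a semialgebraic set\<close>

inductive semialgebraic :: "'a::euclidean_space set \<Rightarrow> bool" where
  pos: "real_polynomial_function p \<Longrightarrow> semialgebraic {x. p x > 0}"
| Un: "semialgebraic A \<Longrightarrow> semialgebraic B \<Longrightarrow> semialgebraic (A \<union> B)"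
| Compl: "semialgebraic A \<Longrightarrow> semialgebraic (- A)"

text \<open>The open unit cube in the coordinates \<open>D\<close>, a copy of \<open>(0,1)\<^sup>d\<close> with \<open>d = card D\<close>.\<close>

definition open_cube :: "'a::euclidean_space set \<Rightarrow> 'a set" where
  "open_cube D = {x. (\<forall>b\<in>D. 0 < x \<bullet> b \<and> x \<bullet> b < 1) \<and> (\<forall>b\<in>Basis - D. x \<bullet> b = 0)}"

text \<open>
  The dimension of a nonempty semialgebraic set is the largest \<open>d\<close> such that the set contains a
  subset semialgebraically homeomorphic to \<open>(0,1)\<^sup>d\<close>. The cubes are taken inside the ambient space,
  whose dimension bounds \<open>d\<close>.
\<close>

definition semialgebraic_dim :: "'a::euclidean_space set \<Rightarrow> nat" where
  "semialgebraic_dim A =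
     Max {card D |D :: 'a set. D \<subseteq> Basis \<and>
       (\<exists>C f h. C \<subseteq> A \<and> homeomorphism (open_cube D) C f h \<and>
                semialgebraic ((\<lambda>x. (x, f x)) ` open_cube D))}"


subsection \<open>Measures\<close>

text \<open>
  The \<open>m\<close>-dimensional Hausdorff (outer) measure, without the normalising constant that makes it
  agree with Lebesgue measure. The library's \<open>diameter\<close> is meaningful for bounded sets only.
\<close>

definition hausdorff_pre_measure :: "nat \<Rightarrow> real \<Rightarrow> 'a::metric_space set \<Rightarrow> ennreal" where
  "hausdorff_pre_measure m \<delta> A =
     (INF C \<in> {C :: nat \<Rightarrow> 'a set. (\<forall>n. bounded (C n) \<and> diameter (C n) \<le> \<delta>) \<and> A \<subseteq> (\<Union>n. C n)}.
        \<Sum>n. if C n = {} then 0 else ennreal (diameter (C n) ^ m))"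

definition hausdorff_measure :: "nat \<Rightarrow> 'a::metric_space set \<Rightarrow> ennreal" where
  "hausdorff_measure m A = (SUP \<delta>\<in>{0<..}. hausdorff_pre_measure m \<delta> A)"

text \<open>
  The Borel-Lebesgue measure of a linear subspace \<open>S\<close>, of dimension \<open>dim S\<close>: as \<open>lborel\<close>, with
  \<open>Basis\<close> replaced by an orthonormal basis of \<open>S\<close>. It does not depend on the basis. It is a measure
  on the ambient space which is concentrated on \<open>S\<close>.
\<close>

definition subspace_lborel :: "'a::euclidean_space set \<Rightarrow> 'a measure" where
  "subspace_lborel S =
     (let B = (SOME B. B \<subseteq> S \<and> pairwise orthogonal B \<and> (\<forall>b\<in>B. norm b = 1) \<and> span B = S)
      in distr (\<Pi>\<^sub>M b\<in>B. lborel) borel (\<lambda>f. \<Sum>b\<in>B. f b *\<^sub>R b))"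

abbreviation subspace_lebesgue :: "'a::euclidean_space set \<Rightarrow> 'a measure" where
  "subspace_lebesgue S \<equiv> completion (subspace_lborel S)"

end

theory Submission
  imports Defs
begin

text \<open>
  The common payoff \<open>u\<close> of a game can be perturbed by additively separable payoffs, which translate
  the gradient of expected utility by an arbitrary constant. So the payoffs \<open>u\<close> with a critical
  point \<open>x\<close> are the image of a polynomial map, between spaces of equal dimension, that trades the
  separable part of \<open>u\<close> for \<open>x\<close>. If the second derivative is singular at \<open>x\<close>, so is the derivative
  of this map, and Sard's theorem applies; if a best reply lies outside the carrier, a coordinate of
  the argument vanishes. Hence irregular payoffs are negligible.

  A potential game with weights \<open>w\<close> and potential \<open>u\<close> differs from \<open>w i * u\<close> by payoffs that do not
  depend on the own action, so \<open>Ftilde\<close> is the one of \<open>u\<close> with rows scaled by \<open>w\<close>. The irregular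
  potential games are therefore a locally Lipschitz image of a null set in a parameter space. Its
  dimension is no larger than that of the class, because after normalization the parameters can be
  recovered from the game.

  The irregular games are closed because the pairs of a game and an irregular equilibrium are, and
  the strategies range over a compact set.
\<close>


section \<open>Hausdorff null sets\<close>

text \<open>A set with cheap covers in dimension \<open>d\<close> is null for every exponent
  \<open>m \<ge> d\<close>, so lower bounds for the dimensions of the classes suffice: an injective
  linear parametrization for exact potential games, and a single cube with injective parametrization
  for weighted ones. Two obstacles shape the construction. The parameters that count form a subset
  \<open>params J\<close> of the coordinates of a larger space; null sets there are cylinders, and
  their covers must be measured in the coordinates of \<open>params J\<close> alone, which is the
  purpose of \<open>cube_null\<close>. Moreover, a game does not determine its weights when the
  potential is additively separable, since each weight can be absorbed into the summand of its
  player. The cube is therefore placed at potentials with one dominating entry, whose mixed second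
  differences there are nonzero. Exact potential games pass through the same Hausdorff estimate,
  with all weights 1, before it is converted to Lebesgue measure on the subspace.\<close>

lemma ennreal_eq_0_iff_less: "(x :: ennreal) = 0 \<longleftrightarrow> (\<forall>e>0. x < ennreal e)"
proof
  assume R: "\<forall>e>0. x < ennreal e"
  show "x = 0"
  proof (rule ccontr)
    assume "x \<noteq> 0"
    moreover have "x \<noteq> top" using R[rule_format, of 1] by auto
    ultimately obtain r where "x = ennreal r" "r > 0"
      by (metis ennreal_cases ennreal_0 ennreal_neg less_eq_real_def linorder_not_le)
    with R show False by blast
  qed
qed auto

lemma hausdorff_measure_eq_0_iff:
  "hausdorff_measure m A = 0 \<longleftrightarrow>
     (\<forall>\<delta>>0. \<forall>e>0. \<exists>C :: nat \<Rightarrow> 'a::metric_space set.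
        (\<forall>n. bounded (C n) \<and> diameter (C n) \<le> \<delta>) \<and> A \<subseteq> (\<Union>n. C n) \<and>
        (\<Sum>n. if C n = {} then 0 else ennreal (diameter (C n) ^ m)) < ennreal e)"
  (is "?l \<longleftrightarrow> (\<forall>\<delta>>0. \<forall>e>0. \<exists>C. ?Q \<delta> C \<and> ?R C \<and> ?S C < ennreal e)")
proof -
  have "?l \<longleftrightarrow> (\<forall>\<delta>>0. hausdorff_pre_measure m \<delta> A = 0)"
    unfolding hausdorff_measure_def by (auto simp: SUP_bot_conv simp flip: bot_ennreal)
  also have "\<dots> \<longleftrightarrow> (\<forall>\<delta>>0. \<forall>e>0. hausdorff_pre_measure m \<delta> A < ennreal e)"
  proof (intro all_cong imp_cong refl)
    fix \<delta>
    show "(hausdorff_pre_measure m \<delta> A = 0) = (\<forall>e>0. hausdorff_pre_measure m \<delta> A < ennreal e)"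
      by (rule ennreal_eq_0_iff_less)
  qed
  also have "\<dots> \<longleftrightarrow> (\<forall>\<delta>>0. \<forall>e>0. \<exists>C. ?Q \<delta> C \<and> ?R C \<and> ?S C < ennreal e)"
    unfolding hausdorff_pre_measure_def INF_less_iff by auto
  finally show ?thesis .
qed

lemma hausdorff_measure_subset_0:
  assumes "hausdorff_measure m B = 0" "A \<subseteq> B"
  shows "hausdorff_measure m A = 0"
  unfolding hausdorff_measure_eq_0_iff
proof (intro allI impI)
  fix \<delta> e :: real assume "\<delta> > 0" "e > 0"
  from assms(1)[unfolded hausdorff_measure_eq_0_iff, rule_format, OF this]
  obtain C where C: "\<forall>n. bounded (C n) \<and> diameter (C n) \<le> \<delta>" "B \<subseteq> (\<Union>n. C n)"
      "(\<Sum>n. if C n = {} then 0 else ennreal (diameter (C n) ^ m)) < ennreal e" by blast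
  have "A \<subseteq> (\<Union>n. C n)" using C(2) assms(2) by (rule order_trans[rotated])
  then show "\<exists>C. (\<forall>n. bounded (C n) \<and> diameter (C n) \<le> \<delta>) \<and> A \<subseteq> (\<Union>n. C n) \<and>
      (\<Sum>n. if C n = {} then 0 else ennreal (diameter (C n) ^ m)) < ennreal e"
    using C(1,3) by (intro exI[of _ C] conjI)
qed

lemma hausdorff_measure_UN_0:
  fixes A :: "nat \<Rightarrow> 'a::metric_space set"
  assumes "\<And>k. hausdorff_measure m (A k) = 0"
  shows "hausdorff_measure m (\<Union>k. A k) = 0"
  unfolding hausdorff_measure_eq_0_iff
proof (intro allI impI)
  fix \<delta> e :: real assume "\<delta> > 0" "e > 0"
  \<comment> \<open>The budgets add up to \<open>e / 2\<close> rather than \<open>e\<close>, because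
    the total has to stay strictly below \<open>e\<close>.\<close>
  have "\<exists>C. (\<forall>n. bounded (C n) \<and> diameter (C n) \<le> \<delta>) \<and> A k \<subseteq> (\<Union>n. C n) \<and>
      (\<Sum>n. if C n = {} then 0 else ennreal (diameter (C n) ^ m)) < ennreal (e / 2 * (1/2)^Suc k)" for k
    using assms[of k, unfolded hausdorff_measure_eq_0_iff] \<open>\<delta> > 0\<close> \<open>e > 0\<close> by auto
  then have "\<forall>k. \<exists>C. (\<forall>n. bounded (C n) \<and> diameter (C n) \<le> \<delta>) \<and> A k \<subseteq> (\<Union>n. C n) \<and>
      (\<Sum>n. if C n = {} then 0 else ennreal (diameter (C n) ^ m)) < ennreal (e / 2 * (1/2)^Suc k)" by blast
  from choice[OF this] obtain C where
    C0: "\<forall>k. (\<forall>n. bounded (C k n) \<and> diameter (C k n) \<le> \<delta>) \<and> A k \<subseteq> (\<Union>n. C k n) \<and>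
      (\<Sum>n. if C k n = {} then 0 else ennreal (diameter (C k n) ^ m)) < ennreal (e / 2 * (1/2)^Suc k)" ..
  have C: "bounded (C k n)" "diameter (C k n) \<le> \<delta>" "A k \<subseteq> (\<Union>n. C k n)"
    "(\<Sum>n. if C k n = {} then 0 else ennreal (diameter (C k n) ^ m)) < ennreal (e / 2 * (1/2)^Suc k)" for k n
    using C0[rule_format, of k] by simp_all
  define E where "E = (\<lambda>n. case prod_decode n of (k, l) \<Rightarrow> C k l)"
  define F where "F = (\<lambda>k n. if C k n = {} then 0 else ennreal (diameter (C k n) ^ m))"
  have "(\<Sum>n. if E n = {} then 0 else ennreal (diameter (E n) ^ m)) =
      (\<Sum>i. (\<lambda>(k, n). F k n) (prod_decode i))"
    by (intro suminf_cong) (simp add: E_def F_def split: prod.split)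
  also have "\<dots> = (\<Sum>k. \<Sum>n. F k n)" by (rule suminf_ennreal_2dimen) simp
  also have "\<dots> \<le> (\<Sum>k. ennreal (e / 2 * (1/2)^Suc k))"
    unfolding F_def by (intro suminf_le less_imp_le C) auto
  also have "\<dots> = ennreal (e / 2)"
  proof (subst suminf_ennreal2)
    have s: "(\<lambda>k. e / 2 * (1/2)^Suc k) sums (e / 2 * 1)"
      by (intro sums_mult power_half_series)
    show "summable (\<lambda>k. e / 2 * (1/2)^Suc k)" using s by (rule sums_summable)
    show "ennreal (\<Sum>k. e / 2 * (1/2)^Suc k) = ennreal (e / 2)" by (simp only: sums_unique[OF s, symmetric] mult_1_right)
  qed (use \<open>e > 0\<close> in auto)
  also have "\<dots> < ennreal e" using \<open>e > 0\<close> by (simp add: ennreal_less_iff)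
  finally have "(\<Sum>n. if E n = {} then 0 else ennreal (diameter (E n) ^ m)) < ennreal e" .
  moreover have "(\<Union>k. A k) \<subseteq> (\<Union>n. E n)"
  proof
    fix x assume "x \<in> (\<Union>k. A k)"
    then obtain k n where "x \<in> C k n" using C(3) by blast
    then have "x \<in> E (prod_encode (k, n))" by (simp add: E_def)
    then show "x \<in> (\<Union>n. E n)" by blast
  qed
  ultimately show "\<exists>C. (\<forall>n. bounded (C n) \<and> diameter (C n) \<le> \<delta>) \<and> (\<Union>k. A k) \<subseteq> (\<Union>n. C n) \<and>
      (\<Sum>n. if C n = {} then 0 else ennreal (diameter (C n) ^ m)) < ennreal e"
    using C(1,2) by (intro exI[of _ E]) (auto simp: E_def split: prod.split)
qed

section \<open>Covers by cubes in selected coordinates\<close>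

text \<open>Lebesgue nullity of the projection to the coordinates in \<open>D\<close>, expressed by
  covers because the sets \<open>D\<close> that occur have no type of their own. For empty
  \<open>D\<close> every cube would cost 1, hence the later restriction to nonempty
  \<open>D\<close>.\<close>

definition cube_null :: "'p set \<Rightarrow> (real^'p) set \<Rightarrow> bool" where
  "cube_null D A \<longleftrightarrow>
     (\<forall>e>0. \<forall>\<delta>>0. \<exists>c r. (\<forall>n::nat. 0 \<le> r n \<and> r n \<le> \<delta>) \<and>
        A \<subseteq> (\<Union>n. {x. \<forall>p\<in>D. \<bar>x $ p - c n $ p\<bar> \<le> r n}) \<and>
        (\<Sum>n. ennreal (r n ^ card D)) < ennreal e)"

text \<open>An open superset of measure below \<open>e\<close> contains nonoverlapping dyadic cubes
  that cover \<open>N\<close>, so their total volume is below \<open>e\<close> too.\<close>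

lemma negligible_imp_cube_null:
  fixes N :: "(real^'p::finite) set"
  assumes N: "negligible N" and R: "N \<subseteq> cbox (\<chi> p. -R) (\<chi> p. R)" "R > 0"
  shows "cube_null UNIV N"
  unfolding cube_null_def
proof (intro allI impI)
  fix e \<delta> :: real assume "e > 0" "\<delta> > 0"
  have sN: "N \<in> sets lebesgue" "emeasure lebesgue N = 0"
    using N by (auto simp: negligible_iff_null_sets)
  obtain T where T: "open T" "N \<subseteq> T" "emeasure lebesgue (T - N) < ennreal e"
    using sets_lebesgue_outer_open[OF sN(1) \<open>e > 0\<close>] by metis
  have "emeasure lebesgue T = emeasure lebesgue (N \<union> (T - N))"
    using T(2) by (simp add: Un_absorb1)
  also have "\<dots> = emeasure lebesgue ((T - N) \<union> N)" by (simp add: Un_commute)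
  also have "\<dots> = emeasure lebesgue (T - N)"
    using N T(1) sN(1) by (intro emeasure_Un_null_set) (auto simp: negligible_iff_null_sets)
  finally have eT: "emeasure lborel T < ennreal e" using T by simp
  \<comment> \<open>The tags lie in \<open>N\<close>, hence in \<open>T\<close>; there the gauge
    forces a cube into \<open>T\<close> and puts both of its corners within
    \<open>\<delta>/2\<close> of the tag, so its side is less than \<open>\<delta>\<close>.\<close>
  define g where "g = (\<lambda>x. if x \<in> T then T \<inter> ball x (\<delta>/2) else ball x 1)"
  have "gauge g" using \<open>open T\<close> \<open>\<delta> > 0\<close> by (auto simp: gauge_def g_def)
  have "box (\<chi> p. -R) (\<chi> p. R) \<noteq> ({} :: (real^'p) set)"
    using \<open>R > 0\<close> by (auto simp: box_ne_empty Basis_vec_def inner_axis)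
  from covering_lemma[OF R(1) this \<open>gauge g\<close>] obtain \<D> where D: "countable \<D>"
    "\<And>K. K \<in> \<D> \<Longrightarrow> interior K \<noteq> {} \<and> (\<exists>c d. K = cbox c d)"
    "pairwise (\<lambda>A B. interior A \<inter> interior B = {}) \<D>"
    "\<And>K. K \<in> \<D> \<Longrightarrow> \<exists>x \<in> N \<inter> K. K \<subseteq> g x"
    "\<And>u v. cbox u v \<in> \<D> \<Longrightarrow> \<exists>n. \<forall>i \<in> Basis. v \<bullet> i - u \<bullet> i = ((\<chi> p. R) \<bullet> i - (\<chi> p. -R) \<bullet> i) / 2^n"
    "N \<subseteq> \<Union>\<D>"
    by metis
  \<comment> \<open>The lower corner serves as centre and the whole side as radius. This covers more
    than the dyadic cube, but makes \<open>s ^ CARD('p)\<close> exactly its volume.\<close>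
  have "\<exists>u s. s \<ge> 0 \<and> s \<le> \<delta> \<and> K \<subseteq> {x. \<forall>p\<in>UNIV. \<bar>x $ p - u $ p\<bar> \<le> s} \<and> interior K \<subseteq> T \<and>
      ennreal (s ^ CARD('p)) = emeasure lborel (interior K)" if KD: "K \<in> \<D>" for K
  proof -
    obtain u v where uv: "K = cbox u v" using D(2)[OF KD] by blast
    obtain n where n: "\<And>i. i \<in> Basis \<Longrightarrow> v \<bullet> i - u \<bullet> i = ((\<chi> p. R) \<bullet> i - (\<chi> p. -R) \<bullet> i) / 2^n"
      using D(5) KD uv by blast
    define s where "s = 2 * R / 2^n"
    have vs: "v $ p = u $ p + s" for p
    proof -
      have "axis p (1::real) \<in> Basis" by (auto simp: Basis_vec_def)
      from n[OF this] show ?thesis by (simp add: inner_axis s_def)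
    qed
    obtain x where x: "x \<in> N \<inter> K" "K \<subseteq> g x" using D(4) KD by blast
    then have K: "K \<subseteq> T \<inter> ball x (\<delta>/2)" using T(2) by (auto simp: g_def split: if_splits)
    have "s > 0" using \<open>R > 0\<close> by (simp add: s_def)
    then have "u \<in> K" "v \<in> K" unfolding uv by (auto simp: mem_box_cart vs)
    then have "dist x u < \<delta> / 2" "dist x v < \<delta> / 2" using K by (auto simp: mem_ball)
    then have "dist u v < \<delta>" by (rule dist_triangle_half_r)
    moreover have "s \<le> dist u v"
    proof -
      obtain p :: 'p where True by blast
      have "s = \<bar>u $ p - v $ p\<bar>" using \<open>s > 0\<close> by (simp add: vs)
      also have "\<dots> \<le> dist u v" unfolding dist_norm by (metis component_le_norm_cart vector_minus_component)
      finally show ?thesis .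
    qed
    moreover have "K \<subseteq> {x. \<forall>p\<in>UNIV. \<bar>x $ p - u $ p\<bar> \<le> s}"
      unfolding uv by (auto simp: mem_box_cart vs abs_le_iff algebra_simps) (smt (verit) \<open>s > 0\<close>)
    moreover have "interior K \<subseteq> T" using K interior_subset by blast
    moreover have "ennreal (s ^ CARD('p)) = emeasure lborel (interior K)"
    proof -
      have "(v - u) \<bullet> b = s" if "b \<in> Basis" for b :: "real^'p"
        using that vs by (auto simp: Basis_vec_def inner_axis)
      then have "(\<Prod>b\<in>Basis. (v - u) \<bullet> b) = s ^ CARD('p)" by simp
      moreover have "u \<bullet> b \<le> v \<bullet> b" if "b \<in> Basis" for b :: "real^'p"
        using that vs \<open>s > 0\<close> by (auto simp: Basis_vec_def inner_axis)
      ultimately show ?thesis unfolding uv interior_cbox by (subst emeasure_lborel_box) auto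
    qed
    ultimately show ?thesis using \<open>s > 0\<close> by (intro exI[of _ u] exI[of _ s]) auto
  qed
  then have "\<forall>K\<in>\<D>. \<exists>u s. s \<ge> 0 \<and> s \<le> \<delta> \<and> K \<subseteq> {x. \<forall>p\<in>UNIV. \<bar>x $ p - u $ p\<bar> \<le> s} \<and>
      interior K \<subseteq> T \<and> ennreal (s ^ CARD('p)) = emeasure lborel (interior K)" by blast
  from bchoice[OF this] obtain cc where
    "\<forall>K\<in>\<D>. \<exists>s. s \<ge> 0 \<and> s \<le> \<delta> \<and> K \<subseteq> {x. \<forall>p\<in>UNIV. \<bar>x $ p - cc K $ p\<bar> \<le> s} \<and>
      interior K \<subseteq> T \<and> ennreal (s ^ CARD('p)) = emeasure lborel (interior K)" ..
  from bchoice[OF this] obtain rr where cr0: "\<forall>K\<in>\<D>. rr K \<ge> 0 \<and> rr K \<le> \<delta> \<and>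
     K \<subseteq> {x. \<forall>p\<in>UNIV. \<bar>x $ p - cc K $ p\<bar> \<le> rr K} \<and> interior K \<subseteq> T \<and>
      ennreal (rr K ^ CARD('p)) = emeasure lborel (interior K)" ..
  have cr: "rr K \<ge> 0" "rr K \<le> \<delta>" "K \<subseteq> {x. \<forall>p\<in>UNIV. \<bar>x $ p - cc K $ p\<bar> \<le> rr K}"
      "interior K \<subseteq> T" "ennreal (rr K ^ CARD('p)) = emeasure lborel (interior K)" if "K \<in> \<D>" for K
    using bspec[OF cr0 that] by auto
  define J where "J = to_nat_on \<D> ` \<D>"
  define \<phi> where "\<phi> = from_nat_into \<D>"
  have \<phi>: "\<phi> n \<in> \<D>" if "n \<in> J" for n
    using that D(1) by (auto simp: J_def \<phi>_def)
  have inj: "inj_on \<phi> J"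
    using D(1) by (auto simp: J_def \<phi>_def inj_on_def)
  have surj: "\<exists>n\<in>J. \<phi> n = K" if "K \<in> \<D>" for K
    using that D(1) by (auto simp: J_def \<phi>_def)
  \<comment> \<open>If \<open>\<D>\<close> is finite, the surplus indices get radius 0 and cost
    nothing.\<close>
  define r where "r = (\<lambda>n. if n \<in> J then rr (\<phi> n) else 0)"
  define Q where "Q = (\<lambda>n. if n \<in> J then interior (\<phi> n) else {})"
  have "(\<Sum>n. ennreal (r n ^ CARD('p))) = (\<Sum>n. emeasure lborel (Q n))"
    by (intro suminf_cong) (use cr \<phi> in \<open>auto simp: r_def Q_def\<close>)
  also have "\<dots> = emeasure lborel (\<Union>n. Q n)"
  proof (rule suminf_emeasure)
    show "range Q \<subseteq> sets lborel" by (auto simp: Q_def)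
    show "disjoint_family Q"
      unfolding disjoint_family_on_def
    proof (intro ballI impI)
      fix m n :: nat assume "m \<noteq> n"
      show "Q m \<inter> Q n = {}"
      proof (cases "m \<in> J \<and> n \<in> J")
        case True
        then have "\<phi> m \<noteq> \<phi> n" using inj \<open>m \<noteq> n\<close> by (auto simp: inj_on_def)
        then show ?thesis using D(3) \<phi> True by (auto simp: Q_def pairwise_def)
      qed (auto simp: Q_def)
    qed
  qed
  also have "\<dots> \<le> emeasure lborel T"
    using cr(4) \<phi> T(1) by (intro emeasure_mono) (fastforce simp: Q_def split: if_splits)+
  also note eT
  finally have "(\<Sum>n. ennreal (r n ^ card (UNIV::'p set))) < ennreal e" .
  moreover have "N \<subseteq> (\<Union>n. {x. \<forall>p\<in>UNIV. \<bar>x $ p - cc (\<phi> n) $ p\<bar> \<le> r n})"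
  proof
    fix x assume "x \<in> N"
    then obtain K where "K \<in> \<D>" "x \<in> K" using D(6) by auto
    then obtain n where n: "n \<in> J" "\<phi> n = K" using surj by blast
    have "\<forall>p\<in>UNIV. \<bar>x $ p - cc (\<phi> n) $ p\<bar> \<le> r n"
      using cr[OF \<open>K \<in> \<D>\<close>] \<open>x \<in> K\<close> n by (auto simp: r_def)
    then show "x \<in> (\<Union>n. {x. \<forall>p\<in>UNIV. \<bar>x $ p - cc (\<phi> n) $ p\<bar> \<le> r n})" by blast
  qed
  moreover have "\<forall>n. 0 \<le> r n \<and> r n \<le> \<delta>" using cr \<phi> \<open>\<delta> > 0\<close> by (auto simp: r_def)
  ultimately show "\<exists>c r. (\<forall>n. 0 \<le> r n \<and> r n \<le> \<delta>) \<and>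
        N \<subseteq> (\<Union>n. {x. \<forall>p\<in>UNIV. \<bar>x $ p - c n $ p\<bar> \<le> r n}) \<and>
        (\<Sum>n. ennreal (r n ^ card (UNIV::'p set))) < ennreal e"
    by (intro exI[of _ "\<lambda>n. cc (\<phi> n)"] exI[of _ r]) auto
qed

text \<open>
  The average over \<open>t \<in> [0,1]\<close> of the sum of \<open>r\<^sup>d\<close> over the cubes meeting the slice \<open>x $ b = t\<close> is
  at most twice the sum of \<open>r\<^sup>d\<^sup>+\<^sup>1\<close> over all cubes, so that some slice has a cheap cover.
\<close>

lemma cube_null_drop_coordinate:
  fixes N :: "(real^'p::finite) set"
  assumes null: "cube_null (insert b D) {x \<in> N. \<forall>p\<in>insert b D. \<bar>x $ p\<bar> \<le> R}"
    and cyl: "\<And>x t. x \<in> N \<Longrightarrow> (\<chi> p. if p = b then t else x $ p) \<in> N"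
    and b: "b \<notin> D" and D: "D \<noteq> {}" and R: "R \<ge> 1"
  shows "cube_null D {x \<in> N. \<forall>p\<in>D. \<bar>x $ p\<bar> \<le> R}"
  unfolding cube_null_def
proof (intro allI impI)
  fix e \<delta> :: real assume "e > 0" "\<delta> > 0"
  define d where "d = card D"
  have d: "d > 0" "card (insert b D) = Suc d"
    using D b by (auto simp: d_def card_gt_0_iff)
  \<comment> \<open>A cube of radius \<open>r n\<close> meets slices over an interval of length
    \<open>2 * r n\<close>; the bound \<open>e/3\<close> leaves room for this factor 2.\<close>
  obtain c r where cr: "\<And>n::nat. 0 \<le> r n" "\<And>n. r n \<le> \<delta>"
    "{x \<in> N. \<forall>p\<in>insert b D. \<bar>x $ p\<bar> \<le> R} \<subseteq> (\<Union>n. {x. \<forall>p\<in>insert b D. \<bar>x $ p - c n $ p\<bar> \<le> r n})"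
    "(\<Sum>n. ennreal (r n ^ Suc d)) < ennreal (e/3)"
  proof -
    have "e / 3 > 0" using \<open>e > 0\<close> by simp
    from null[unfolded cube_null_def d, rule_format, OF this \<open>\<delta> > 0\<close>] show ?thesis
      by (elim exE conjE) (rule that, auto)
  qed
  define \<phi> where "\<phi> = (\<lambda>t. \<Sum>n. ennreal (r n ^ d) * indicator {c n $ b - r n..c n $ b + r n} t)"
  have "\<exists>t\<in>{0..1}. \<phi> t < ennreal e"
  proof (rule ccontr)
    assume "\<not> ?thesis"
    then have le: "ennreal e * indicator {0..1} t \<le> \<phi> t" for t
      by (auto simp: indicator_def linorder_not_less)
    have "(\<integral>\<^sup>+t. ennreal e * indicator {0..1::real} t \<partial>lborel) \<le> (\<integral>\<^sup>+t. \<phi> t \<partial>lborel)"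
      by (rule nn_integral_mono) (rule le)
    also have "\<dots> = (\<Sum>n. \<integral>\<^sup>+t. ennreal (r n ^ d) * indicator {c n $ b - r n..c n $ b + r n} t \<partial>lborel)"
      unfolding \<phi>_def by (subst nn_integral_suminf) auto
    also have "\<dots> = (\<Sum>n. 2 * ennreal (r n ^ Suc d))"
    proof (intro suminf_cong)
      fix n
      have "(\<integral>\<^sup>+t. ennreal (r n ^ d) * indicator {c n $ b - r n..c n $ b + r n} t \<partial>lborel)
         = ennreal (r n ^ d) * ennreal (2 * r n)"
        using cr(1)[of n] by (subst nn_integral_cmult_indicator) auto
      also have "\<dots> = 2 * ennreal (r n ^ Suc d)"
        using cr(1)[of n] by (simp add: ennreal_mult' mult_ac)
      finally show "(\<integral>\<^sup>+t. ennreal (r n ^ d) * indicator {c n $ b - r n..c n $ b + r n} t \<partial>lborel)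
         = 2 * ennreal (r n ^ Suc d)" .
    qed
    also have "\<dots> = 2 * (\<Sum>n. ennreal (r n ^ Suc d))" by (rule ennreal_suminf_cmult)
    also have "\<dots> \<le> 2 * ennreal (e/3)" by (intro mult_left_mono less_imp_le cr) auto
    also have "\<dots> = ennreal 2 * ennreal (e/3)" by simp
    also have "\<dots> = ennreal (2 * (e/3))" by (rule ennreal_mult'[symmetric]) simp
    also have "\<dots> < ennreal e" using \<open>e > 0\<close> by (simp add: ennreal_less_iff)
    also have "ennreal e = (\<integral>\<^sup>+t. ennreal e * indicator {0..1::real} t \<partial>lborel)"
      by (subst nn_integral_cmult_indicator) auto
    finally show False by simp
  qed
  then obtain t where t: "t \<in> {0..1}" "\<phi> t < ennreal e" by blast
  \<comment> \<open>Cubes that miss the slice keep their index with radius 0, which costs nothing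
    because \<open>d > 0\<close>.\<close>
  define r' where "r' = (\<lambda>n. if t \<in> {c n $ b - r n..c n $ b + r n} then r n else 0)"
  have "(\<Sum>n. ennreal (r' n ^ d)) = \<phi> t"
    unfolding \<phi>_def r'_def using d by (intro suminf_cong) (auto simp: zero_power)
  moreover have "{x \<in> N. \<forall>p\<in>D. \<bar>x $ p\<bar> \<le> R} \<subseteq> (\<Union>n. {x. \<forall>p\<in>D. \<bar>x $ p - c n $ p\<bar> \<le> r' n})"
  proof clarify
    fix x assume x: "x \<in> N" "\<forall>p\<in>D. \<bar>x $ p\<bar> \<le> R"
    define x' where "x' = (\<chi> p. if p = b then t else x $ p)"
    have "x' \<in> N" unfolding x'_def by (intro cyl x)
    \<comment> \<open>The truncation at \<open>R \<ge> 1\<close> admits the new entry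
      \<open>t\<close> from \<open>{0..1}\<close>.\<close>
    moreover have "\<forall>p\<in>insert b D. \<bar>x' $ p\<bar> \<le> R" using x t R by (auto simp: x'_def)
    ultimately have "x' \<in> {x \<in> N. \<forall>p\<in>insert b D. \<bar>x $ p\<bar> \<le> R}" by blast
    then obtain n where n: "\<forall>p\<in>insert b D. \<bar>x' $ p - c n $ p\<bar> \<le> r n" using cr(3) by blast
    then have "\<bar>t - c n $ b\<bar> \<le> r n" by (simp add: x'_def)
    then have "r' n = r n" by (auto simp: r'_def abs_le_iff)
    moreover have "x' $ p = x $ p" if "p \<in> D" for p using that b by (auto simp: x'_def)
    ultimately have "\<forall>p\<in>D. \<bar>x $ p - c n $ p\<bar> \<le> r' n" using n by auto
    then show "x \<in> (\<Union>n. {x. \<forall>p\<in>D. \<bar>x $ p - c n $ p\<bar> \<le> r' n})" by blast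
  qed
  ultimately show "\<exists>c r. (\<forall>n. 0 \<le> r n \<and> r n \<le> \<delta>) \<and>
        {x \<in> N. \<forall>p\<in>D. \<bar>x $ p\<bar> \<le> R} \<subseteq> (\<Union>n. {x. \<forall>p\<in>D. \<bar>x $ p - c n $ p\<bar> \<le> r n}) \<and>
        (\<Sum>n. ennreal (r n ^ card D)) < ennreal e"
    using t cr(1,2) \<open>\<delta> > 0\<close> unfolding d_def
    by (intro exI[of _ c] exI[of _ r']) (auto simp: r'_def less_imp_le)
qed

text \<open>Induction on the number of coordinates outside \<open>D\<close>. As \<open>N\<close>
  does not restrict them, they can be sliced away one at a time; when there are none, the dyadic
  cover applies.\<close>

lemma negligible_cylinder_imp_cube_null:
  fixes N :: "(real^'p::finite) set"
  assumes N: "negligible N"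
    and cyl: "\<And>x y. x \<in> N \<Longrightarrow> (\<forall>p\<in>D. y $ p = x $ p) \<Longrightarrow> y \<in> N"
    and D: "D \<noteq> {}" and R: "R \<ge> 1"
  shows "cube_null D {x \<in> N. \<forall>p\<in>D. \<bar>x $ p\<bar> \<le> R}"
  using cyl D
proof (induction "card (- D)" arbitrary: D)
  case 0
  then have "D = UNIV" by auto
  moreover have "cube_null UNIV {x \<in> N. \<forall>p\<in>UNIV. \<bar>x $ p\<bar> \<le> R}"
    using R by (intro negligible_imp_cube_null[of _ R] negligible_subset[OF N])
      (auto simp: mem_box_cart abs_le_iff minus_le_iff)
  ultimately show ?case by simp
next
  case (Suc k)
  then obtain b where b: "b \<notin> D"
    by (metis Compl_iff card.empty equals0I nat.distinct(1))
  have "- insert b D = - D - {b}" by auto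
  then have "k = card (- insert b D)" using Suc(2) b by simp
  then have "cube_null (insert b D) {x \<in> N. \<forall>p\<in>insert b D. \<bar>x $ p\<bar> \<le> R}"
  proof (rule Suc.hyps(1))
    fix x y assume "x \<in> N" "\<forall>p\<in>insert b D. y $ p = x $ p"
    then show "y \<in> N" using Suc.prems(1)[of x y] by blast
  qed auto
  then show ?case
  proof (rule cube_null_drop_coordinate)
    fix x t assume "x \<in> N"
    then show "(\<chi> p. if p = b then t else x $ p) \<in> N"
      by (rule Suc.prems(1)) (use b in auto)
  qed (use b Suc.prems(2) R in auto)
qed

lemma hausdorff_measure_image_cube_null:
  fixes f :: "real^'p::finite \<Rightarrow> 'b::metric_space"
  assumes null: "cube_null D A"
    and lip: "\<And>x y r. x \<in> A \<Longrightarrow> y \<in> A \<Longrightarrow> (\<forall>p\<in>D. \<bar>x $ p - y $ p\<bar> \<le> r) \<Longrightarrow> dist (f x) (f y) \<le> L * r"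
    and m: "card D \<le> m"
  shows "hausdorff_measure m (f ` A) = 0"
  unfolding hausdorff_measure_eq_0_iff
proof (intro allI impI)
  fix \<delta> e :: real assume "\<delta> > 0" "e > 0"
  \<comment> \<open>Two points of a cube of radius \<open>r\<close> differ by at most
    \<open>2 * r\<close> in each coordinate of \<open>D\<close>; the maximum with 1 keeps
    \<open>M\<close> positive for every \<open>L\<close>.\<close>
  define M where "M = 2 * max L 1"
  have M: "M > 0" "2 * L \<le> M" by (auto simp: M_def)
  \<comment> \<open>Besides the bound \<open>\<delta>\<close>, diameters are kept at most 1, so that
    raising them to the power \<open>m \<ge> card D\<close> gives no more than the power
    \<open>card D\<close>.\<close>
  define \<rho> where "\<rho> = min \<delta> 1 / M"
  have \<rho>: "\<rho> > 0" "M * \<rho> \<le> \<delta>" "M * \<rho> \<le> 1" using \<open>\<delta> > 0\<close> M by (auto simp: \<rho>_def)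
  have "e / M ^ card D > 0" using M \<open>e > 0\<close> by simp
  from null[unfolded cube_null_def, rule_format, OF this \<rho>(1)]
  obtain c r where cr: "\<And>n::nat. 0 \<le> r n" "\<And>n. r n \<le> \<rho>"
    "A \<subseteq> (\<Union>n. {x. \<forall>p\<in>D. \<bar>x $ p - c n $ p\<bar> \<le> r n})"
    "(\<Sum>n. ennreal (r n ^ card D)) < ennreal (e / M ^ card D)"
    by (elim exE conjE) (rule that, auto)
  define C where "C = (\<lambda>n. f ` (A \<inter> {x. \<forall>p\<in>D. \<bar>x $ p - c n $ p\<bar> \<le> r n}))"
  have dist: "dist u v \<le> M * r n" if uv: "u \<in> C n" "v \<in> C n" for u v n
  proof -
    obtain x y where xy: "x \<in> A" "y \<in> A" "u = f x" "v = f y"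
      "\<forall>p\<in>D. \<bar>x $ p - c n $ p\<bar> \<le> r n" "\<forall>p\<in>D. \<bar>y $ p - c n $ p\<bar> \<le> r n"
      using uv by (auto simp: C_def)
    have "\<forall>p\<in>D. \<bar>x $ p - y $ p\<bar> \<le> 2 * r n"
    proof
      fix p assume "p \<in> D"
      then have "\<bar>x $ p - c n $ p\<bar> \<le> r n" "\<bar>y $ p - c n $ p\<bar> \<le> r n" using xy by auto
      then show "\<bar>x $ p - y $ p\<bar> \<le> 2 * r n" by linarith
    qed
    then have "dist u v \<le> L * (2 * r n)" unfolding xy using xy by (intro lip) auto
    also have "\<dots> = (2 * L) * r n" by simp
    also have "\<dots> \<le> M * r n" using M cr(1) by (intro mult_right_mono) auto
    finally show ?thesis .
  qed
  have bd: "bounded (C n)" for n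
  proof (cases "C n = {}")
    case False
    then obtain u where "u \<in> C n" by blast
    then show ?thesis unfolding bounded_def using dist by blast
  qed simp
  have diam: "diameter (C n) \<le> M * r n" for n
    using M cr(1)[of n] by (cases "C n = {}") (auto simp: diameter_def intro!: cSUP_least dist)
  have Mr: "M * r n \<le> M * \<rho>" for n using cr M by (intro mult_left_mono) auto
  have "(\<Sum>n. if C n = {} then 0 else ennreal (diameter (C n) ^ m))
      \<le> (\<Sum>n. ennreal (M ^ card D) * ennreal (r n ^ card D))"
  proof (intro suminf_le)
    fix n
    have "diameter (C n) ^ m \<le> (M * r n) ^ m"
      using diam diameter_ge_0[OF bd] by (intro power_mono)
    also have "\<dots> \<le> (M * r n) ^ card D"
      using M cr(1)[of n] order_trans[OF Mr[of n] \<rho>(3)] m by (intro power_decreasing) auto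
    also have "\<dots> = M ^ card D * r n ^ card D" by (rule power_mult_distrib)
    finally have "ennreal (diameter (C n) ^ m) \<le> ennreal (M ^ card D) * ennreal (r n ^ card D)"
      using M cr(1)[of n] by (simp add: ennreal_leI flip: ennreal_mult)
    then show "(if C n = {} then 0 else ennreal (diameter (C n) ^ m)) \<le> ennreal (M ^ card D) * ennreal (r n ^ card D)"
      by simp
  qed auto
  also have "\<dots> = ennreal (M ^ card D) * (\<Sum>n. ennreal (r n ^ card D))" by (rule ennreal_suminf_cmult)
  also have "\<dots> < ennreal (M ^ card D) * ennreal (e / M ^ card D)"
    using M cr(4) by (intro ennreal_mult_strict_left_mono) auto
  also have "\<dots> = ennreal e" using M \<open>e > 0\<close> by (simp flip: ennreal_mult)
  finally have "(\<Sum>n. if C n = {} then 0 else ennreal (diameter (C n) ^ m)) < ennreal e" .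
  moreover have "f ` A \<subseteq> (\<Union>n. C n)" using cr(3) by (fastforce simp: C_def)
  moreover have "diameter (C n) \<le> \<delta>" for n using diam[of n] Mr[of n] \<rho> by linarith
  ultimately show "\<exists>C. (\<forall>n. bounded (C n) \<and> diameter (C n) \<le> \<delta>) \<and> f ` A \<subseteq> (\<Union>n. C n) \<and>
      (\<Sum>n. if C n = {} then 0 else ennreal (diameter (C n) ^ m)) < ennreal e"
    using bd by blast
qed

text \<open>The Lipschitz constant depends on a bound for the entries in \<open>D\<close>, so
  \<open>N\<close> is exhausted by countably many truncations.\<close>

lemma hausdorff_measure_image_negligible_cylinder:
  fixes f :: "real^'p::finite \<Rightarrow> 'b::metric_space"
  assumes N: "negligible N"
    and cyl: "\<And>x y. x \<in> N \<Longrightarrow> (\<forall>p\<in>D. y $ p = x $ p) \<Longrightarrow> y \<in> N"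
    and D: "D \<noteq> {}" and m: "card D \<le> m"
    and lip: "\<And>R. \<exists>L. \<forall>x y r. (\<forall>p\<in>D. \<bar>x $ p\<bar> \<le> R) \<longrightarrow> (\<forall>p\<in>D. \<bar>y $ p\<bar> \<le> R) \<longrightarrow>
              (\<forall>p\<in>D. \<bar>x $ p - y $ p\<bar> \<le> r) \<longrightarrow> dist (f x) (f y) \<le> L * r"
  shows "hausdorff_measure m (f ` N) = 0"
proof -
  define A where "A = (\<lambda>k::nat. {x \<in> N. \<forall>p\<in>D. \<bar>x $ p\<bar> \<le> real (Suc k)})"
  have "hausdorff_measure m (f ` A k) = 0" for k
  proof -
    obtain L where L: "\<And>x y r. (\<forall>p\<in>D. \<bar>x $ p\<bar> \<le> real (Suc k)) \<Longrightarrow> (\<forall>p\<in>D. \<bar>y $ p\<bar> \<le> real (Suc k)) \<Longrightarrow>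
              (\<forall>p\<in>D. \<bar>x $ p - y $ p\<bar> \<le> r) \<Longrightarrow> dist (f x) (f y) \<le> L * r"
      using lip by metis
    show ?thesis
    proof (rule hausdorff_measure_image_cube_null)
      show "cube_null D (A k)" unfolding A_def
        using N cyl D by (intro negligible_cylinder_imp_cube_null) auto
      show "dist (f x) (f y) \<le> L * r"
        if "x \<in> A k" "y \<in> A k" "\<forall>p\<in>D. \<bar>x $ p - y $ p\<bar> \<le> r" for x y r
        using that by (intro L) (auto simp: A_def)
    qed (rule m)
  qed
  then have "hausdorff_measure m (\<Union>k. f ` A k) = 0" by (rule hausdorff_measure_UN_0)
  moreover have "f ` N \<subseteq> (\<Union>k. f ` A k)"
  proof clarify
    fix x assume x: "x \<in> N"
    obtain k :: nat where k: "norm x \<le> real k" using real_arch_simple by blast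
    have "\<bar>x $ p\<bar> \<le> real (Suc k)" for p using component_le_norm_cart[of x p] k by simp
    then have "x \<in> A k" using x by (auto simp: A_def)
    then show "f x \<in> (\<Union>k. f ` A k)" by blast
  qed
  ultimately show ?thesis by (rule hausdorff_measure_subset_0)
qed

text \<open>In orthonormal coordinates a set of diameter \<open>d\<close> lies in a box of side
  \<open>2 * d\<close> about any of its points. A Hausdorff cover thus bounds the product measure up
  to the factor \<open>2 ^ dim S\<close>.\<close>

lemma hausdorff_measure_0_imp_subspace_lborel_0:
  fixes S :: "'a::euclidean_space set"
  assumes S: "subspace S" and Z: "Z \<in> sets borel" "Z \<subseteq> S" and null: "hausdorff_measure (dim S) Z = 0"
  shows "Z \<in> null_sets (subspace_lborel S)"
proof -
  define P where "P = (\<lambda>B :: 'a set. B \<subseteq> S \<and> pairwise orthogonal B \<and> (\<forall>b\<in>B. norm b = 1) \<and> span B = S)"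
  define B where "B = (SOME B. P B)"
  have "\<exists>B. P B" unfolding P_def using orthonormal_basis_subspace[OF S] by metis
  then have "P B" unfolding B_def by (rule someI_ex)
  then have B: "B \<subseteq> S" "pairwise orthogonal B" "\<And>b. b \<in> B \<Longrightarrow> norm b = 1" "span B = S"
    by (auto simp: P_def)
  have ind: "independent B"
    using B by (intro pairwise_orthogonal_independent) fastforce+
  then have fin: "finite B" by (rule independent_imp_finite)
  have card: "card B = dim S" using ind B(4) dim_span_eq_card_independent by metis
  define M where "M = (\<Pi>\<^sub>M b\<in>B. lborel :: real measure)"
  define h where "h = (\<lambda>f :: 'a \<Rightarrow> real. \<Sum>b\<in>B. f b *\<^sub>R b)"
  have lb: "subspace_lborel S = distr M borel h"
    unfolding subspace_lborel_def Let_def M_def h_def B_def P_def by simp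
  have h: "h \<in> measurable M borel" unfolding h_def M_def by measurable
  have hb: "h f \<bullet> b = f b" if "b \<in> B" for f b
  proof -
    have "h f \<bullet> b = (\<Sum>a\<in>B. f a * (a \<bullet> b))" by (simp add: h_def inner_sum_left)
    also have "\<dots> = (\<Sum>a\<in>B. if a = b then f a else 0)"
    proof (intro sum.cong refl)
      fix a assume "a \<in> B"
      then show "f a * (a \<bullet> b) = (if a = b then f a else 0)"
        using B(2) B(3)[of b] that by (auto simp: pairwise_def orthogonal_def norm_eq_1)
    qed
    also have "\<dots> = f b" using that fin by simp
    finally show ?thesis .
  qed
  interpret product_sigma_finite "\<lambda>b::'a. lborel :: real measure" by standard
  have "emeasure M (h -` Z \<inter> space M) < ennreal e" if e: "e > 0" for e
  proof -
    define k where "k = dim S"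
    have "e / 2 ^ k > 0" using e by simp
    from null[unfolded hausdorff_measure_eq_0_iff, folded k_def, rule_format, OF zero_less_one this]
    obtain C :: "nat \<Rightarrow> 'a set" where C: "\<And>n. bounded (C n)" "Z \<subseteq> (\<Union>n. C n)"
      "(\<Sum>n. if C n = {} then 0 else ennreal (diameter (C n) ^ k)) < ennreal (e / 2 ^ k)"
      by (elim exE conjE) (rule that, auto)
    define z where "z = (\<lambda>n. SOME z. z \<in> C n)"
    have z: "z n \<in> C n" if "C n \<noteq> {}" for n
      unfolding z_def using that by (simp add: some_in_eq)
    define Q where "Q = (\<lambda>n. if C n = {} then {} else
       (\<Pi>\<^sub>E b\<in>B. {z n \<bullet> b - diameter (C n)..z n \<bullet> b + diameter (C n)}))"
    have Qs: "Q n \<in> sets M" for n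
      unfolding Q_def M_def using fin by (auto intro!: sets_PiM_I_finite)
    have eQ: "emeasure M (Q n) = (if C n = {} then 0 else 2 ^ k * ennreal (diameter (C n) ^ k))" for n
    proof (cases "C n = {}")
      case False
      have "emeasure M (Q n) = (\<Prod>b\<in>B. ennreal (2 * diameter (C n)))"
        using False fin diameter_ge_0[OF C(1)[of n]] unfolding Q_def M_def
        by (simp add: emeasure_PiM)
      also have "\<dots> = ennreal ((2 * diameter (C n)) ^ k)"
        using card diameter_ge_0[OF C(1)[of n]] by (simp add: k_def ennreal_power)
      also have "\<dots> = 2 ^ k * ennreal (diameter (C n) ^ k)"
        using diameter_ge_0[OF C(1)[of n]]
        by (simp add: power_mult_distrib ennreal_mult ennreal_power[symmetric])
      finally show ?thesis using False by simp
    qed (simp add: Q_def)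
    have "h -` Z \<inter> space M \<subseteq> (\<Union>n. Q n)"
    proof
      fix f assume f: "f \<in> h -` Z \<inter> space M"
      then obtain n where n: "h f \<in> C n" using C(2) by auto
      have "f b \<in> {z n \<bullet> b - diameter (C n)..z n \<bullet> b + diameter (C n)}" if "b \<in> B" for b
      proof -
        have "\<bar>(h f - z n) \<bullet> b\<bar> \<le> norm (h f - z n) * norm b" by (rule Cauchy_Schwarz_ineq2)
        also have "\<dots> = dist (h f) (z n)" using B(3)[OF that] by (simp add: dist_norm)
        also have "\<dots> \<le> diameter (C n)" using C(1) n z by (intro diameter_bounded_bound) auto
        finally show ?thesis using hb[OF that] by (auto simp: inner_diff_left abs_le_iff)
      qed
      moreover have "f \<in> extensional B" using f by (auto simp: M_def space_PiM PiE_def)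
      ultimately have "f \<in> Q n" using n by (auto simp: Q_def PiE_def Pi_def)
      then show "f \<in> (\<Union>n. Q n)" by blast
    qed
    then have "emeasure M (h -` Z \<inter> space M) \<le> emeasure M (\<Union>n. Q n)"
      using Qs by (intro emeasure_mono) auto
    also have "\<dots> \<le> (\<Sum>n. emeasure M (Q n))"
      using Qs by (intro emeasure_subadditive_countably) auto
    also have "\<dots> = (\<Sum>n. 2 ^ k * (if C n = {} then 0 else ennreal (diameter (C n) ^ k)))"
      by (intro suminf_cong) (simp add: eQ)
    also have "\<dots> = 2 ^ k * (\<Sum>n. if C n = {} then 0 else ennreal (diameter (C n) ^ k))"
      by (rule ennreal_suminf_cmult)
    also have "\<dots> = ennreal (2 ^ k) * (\<Sum>n. if C n = {} then 0 else ennreal (diameter (C n) ^ k))"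
      by (simp flip: ennreal_power)
    also have "\<dots> < ennreal (2 ^ k) * ennreal (e / 2 ^ k)"
      using C(3) by (intro ennreal_mult_strict_left_mono) auto
    also have "\<dots> = ennreal e" using e by (simp flip: ennreal_mult)
    finally show ?thesis .
  qed
  then have "emeasure M (h -` Z \<inter> space M) = 0"
    unfolding ennreal_eq_0_iff_less by blast
  then show ?thesis using Z(1) h by (auto simp: lb emeasure_distr)
qed


section \<open>Mixed strategies and equilibria\<close>

text \<open>That the derivative is again polynomial in the base point later makes the Jacobian
  determinant continuous in game and strategy together.\<close>

lemma real_polynomial_function_has_derivative:
  fixes p :: "'a::real_normed_vector \<Rightarrow> real"
  assumes "real_polynomial_function p"
  shows "\<exists>p'. \<forall>x. (p has_derivative p' x) (at x) \<and> (\<forall>v. real_polynomial_function (\<lambda>x. p' x v))"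
  using assms
proof (induction rule: real_polynomial_function.induct)
  case (linear f)
  then show ?case
    by (intro exI[of _ "\<lambda>x. f"]) (auto intro: bounded_linear_imp_has_derivative)
next
  case (const c)
  then show ?case by (intro exI[of _ "\<lambda>x v. 0"]) auto
next
  case (add f g)
  then obtain f' g' where "\<forall>x. (f has_derivative f' x) (at x) \<and> (\<forall>v. real_polynomial_function (\<lambda>x. f' x v))"
    "\<forall>x. (g has_derivative g' x) (at x) \<and> (\<forall>v. real_polynomial_function (\<lambda>x. g' x v))" by blast
  then show ?case
    by (intro exI[of _ "\<lambda>x v. f' x v + g' x v"]) (auto intro: has_derivative_add)
next
  case (mult f g)
  then obtain f' g' where "\<forall>x. (f has_derivative f' x) (at x) \<and> (\<forall>v. real_polynomial_function (\<lambda>x. f' x v))"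
    "\<forall>x. (g has_derivative g' x) (at x) \<and> (\<forall>v. real_polynomial_function (\<lambda>x. g' x v))" by blast
  then show ?case using mult.hyps
    by (intro exI[of _ "\<lambda>x v. f x * g' x v + f' x v * g x"] allI conjI
        has_derivative_mult real_polynomial_function.intros(3,4)) auto
qed

lemma real_polynomial_function_if:
  "(b \<Longrightarrow> real_polynomial_function f) \<Longrightarrow> (\<not> b \<Longrightarrow> real_polynomial_function g) \<Longrightarrow>
   real_polynomial_function (\<lambda>x. if b then f x else g x)"
  by (cases b) auto

lemma real_polynomial_function_vec_nth [intro]: "real_polynomial_function (\<lambda>x. x $ i)"
  by (intro real_polynomial_function.intros(1) bounded_linear_vec_nth)

lemma real_polynomial_function_continuous_on:
  fixes p :: "'a::real_normed_vector \<Rightarrow> real"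
  assumes "real_polynomial_function p" shows "continuous_on S p"
  using continuous_real_polymonial_function[OF assms] by (simp add: continuous_at_imp_continuous_on)

lemma invertible_jacobian_iff:
  fixes F :: "real^'s::finite \<Rightarrow> real^'s"
  assumes "(F has_derivative L) (at x)"
  shows "invertible (jacobian F (at x)) \<longleftrightarrow> (\<forall>v. L v = 0 \<longrightarrow> v = 0)"
proof -
  have "(F has_derivative (*v) (jacobian F (at x))) (at x)"
    using assms jacobian_works differentiableI by blast
  then have "L = (*v) (jacobian F (at x))" by (rule has_derivative_unique[OF assms])
  then show ?thesis
    unfolding invertible_left_inverse matrix_left_invertible_ker by simp
qed

text \<open>Action \<open>1\<close> occurs throughout as an argument of \<open>weight\<close> and
  \<open>pure_utility\<close> and is to keep this form.\<close>

declare One_nat_def [simp del]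

locale game_form =
  fixes K :: "'n::finite \<Rightarrow> nat"
    and act :: "'y::finite \<Rightarrow> 'n \<Rightarrow> nat"
    and idx :: "'s::finite \<Rightarrow> 'n \<times> nat"
  assumes K: "\<And>i. K i \<ge> 2"
    and act: "profile_labelling K act"
    and idx: "coordinate_labelling K idx"
begin

lemma act_range: "act y i \<in> {1..K i}"
  using act by (auto simp: profile_labelling_def bij_betw_def)

lemma act_inject: "act y = act z \<longleftrightarrow> y = z"
  using act by (auto simp: profile_labelling_def bij_betw_def inj_def)

lemma act_inv:
  assumes "\<And>i. a i \<in> {1..K i}" shows "act (inv act a) = a"
proof -
  have "a \<in> range act" using act assms unfolding profile_labelling_def bij_betw_def by auto
  then show ?thesis by (rule f_inv_into_f)
qed

lemma idx_range: "idx s = (i, k) \<Longrightarrow> k \<in> {1..K i - 1}"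
  using idx unfolding coordinate_labelling_def bij_betw_def by (metis mem_Sigma_iff rangeI)

lemma inv_idx [simp]: "inv idx (idx s) = s"
  using idx unfolding coordinate_labelling_def bij_betw_def by (simp add: inv_f_f)

lemma idx_inv: "k \<in> {1..K i - 1} \<Longrightarrow> idx (inv idx (i, k)) = (i, k)"
  using idx unfolding coordinate_labelling_def bij_betw_def
  by (metis f_inv_into_f mem_Sigma_iff UNIV_I)

lemma idx_inject: "idx s = idx s' \<longleftrightarrow> s = s'"
  by (metis inv_idx)

lemma weight_idx: "idx s = (i, k) \<Longrightarrow> weight K idx x i (k + 1) = x $ s"
  using idx_range[of s i k] by (auto simp: weight_def) (metis inv_idx)

lemma actions_split: "{1..K i} = insert 1 (Suc ` {1..K i - 1})"
proof -
  have "{1..K i} = insert 1 {Suc 1..Suc (K i - 1)}" using K[of i] by auto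
  then show ?thesis by (simp only: image_Suc_atLeastAtMost)
qed

lemma sum_actions: "(\<Sum>k=1..K i. f k) = f 1 + (\<Sum>k=1..K i - 1. f (k + 1))"
proof -
  have "(\<Sum>k=1..K i. f k) = f 1 + (\<Sum>k\<in>Suc ` {1..K i - 1}. f k)"
    unfolding actions_split by (subst sum.insert) auto
  also have "(\<Sum>k\<in>Suc ` {1..K i - 1}. f k) = (\<Sum>k=1..K i - 1. f (k + 1))"
    by (subst sum.reindex) (simp_all add: inj_on_def flip: Suc_eq_plus1)
  finally show ?thesis .
qed

lemma ball_actions: "(\<forall>k\<in>{1..K i}. P k) \<longleftrightarrow> P 1 \<and> (\<forall>k\<in>{1..K i - 1}. P (k + 1))"
  unfolding actions_split by (simp only: ball_simps Suc_eq_plus1)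

lemma sum_weight: "(\<Sum>k=1..K i. weight K idx x i k) = 1"
  unfolding sum_actions by (simp add: weight_def)

text \<open>A one-sided inverse of \<open>weight\<close>. The entry \<open>t i 1\<close> is dropped
  and can be recovered only from normalized weights, hence the hypothesis of
  \<open>weight_of_weights\<close>.\<close>

definition of_weights :: "('n \<Rightarrow> nat \<Rightarrow> real) \<Rightarrow> real^'s" where
  "of_weights t = (\<chi> s. case idx s of (i, k) \<Rightarrow> t i (k + 1))"

lemma weight_of_weights:
  assumes "(\<Sum>k=1..K i. t i k) = 1" "k \<in> {1..K i}"
  shows "weight K idx (of_weights t) i k = t i k"
proof (cases "k = 1")
  case True
  have "weight K idx (of_weights t) i 1 = 1 - (\<Sum>l=1..K i - 1. t i (l + 1))"
    by (simp add: weight_def of_weights_def idx_inv)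
  also have "\<dots> = t i 1" using assms(1) unfolding sum_actions by simp
  finally show ?thesis using True by simp
next
  case False
  then have "k - 1 \<in> {1..K i - 1}" "k - 1 + 1 = k" using assms by auto
  then show ?thesis using False by (simp add: weight_def of_weights_def idx_inv)
qed

lemma strategy_eqI:
  assumes "\<And>i k. k \<in> {1..K i} \<Longrightarrow> weight K idx x i k = weight K idx x' i k"
  shows "x = x'"
proof (rule vec_eq_iff[THEN iffD2], rule allI)
  fix s
  obtain i k where ik: "idx s = (i, k)" by force
  have "k + 1 \<in> {1..K i}" using idx_range[OF ik] by auto
  from assms[OF this] show "x $ s = x' $ s" by (simp only: weight_idx[OF ik])
qed

lemma weight_cong_other:
  assumes "\<And>s. fst (idx s) = j \<Longrightarrow> x $ s = x' $ s" "k \<in> {1..K j}"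
  shows "weight K idx x j k = weight K idx x' j k"
proof -
  have "x $ inv idx (j, l) = x' $ inv idx (j, l)" if "l \<in> {1..K j - 1}" for l
    by (intro assms(1)) (simp add: idx_inv[OF that])
  moreover have "k \<noteq> 1 \<Longrightarrow> k - 1 \<in> {1..K j - 1}" using assms(2) by auto
  ultimately show ?thesis unfolding weight_def by (auto intro!: sum.cong)
qed

lemma mixed_strategies_iff:
  "x \<in> mixed_strategies K idx \<longleftrightarrow> (\<forall>i. \<forall>k\<in>{1..K i}. weight K idx x i k \<ge> 0)"
proof -
  have "(\<forall>k\<in>{1..K i - 1}. 0 \<le> x $ inv idx (i, k) \<and> x $ inv idx (i, k) \<le> 1) \<and>
             (\<Sum>k=1..K i - 1. x $ inv idx (i, k)) \<le> 1
      \<longleftrightarrow> (\<forall>k\<in>{1..K i}. weight K idx x i k \<ge> 0)" (is "?a \<longleftrightarrow> ?b") for i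
  proof
    assume ?a
    then show ?b unfolding ball_actions by (simp add: weight_def)
  next
    assume ?b
    then have pos: "\<forall>k\<in>{1..K i - 1}. 0 \<le> x $ inv idx (i, k)"
      and s: "(\<Sum>k=1..K i - 1. x $ inv idx (i, k)) \<le> 1"
      unfolding ball_actions by (auto simp: weight_def)
    have "x $ inv idx (i, k) \<le> (\<Sum>k=1..K i - 1. x $ inv idx (i, k))" if "k \<in> {1..K i - 1}" for k
      using pos that by (intro member_le_sum) auto
    then show ?a using pos s by (meson order_trans)
  qed
  then show ?thesis by (simp add: mixed_strategies_def)
qed

lemma sum_prod_profiles:
  fixes t :: "'n \<Rightarrow> nat \<Rightarrow> real"
  shows "(\<Sum>y\<in>UNIV. \<Prod>j\<in>UNIV. t j (act y j)) = (\<Prod>j\<in>UNIV. \<Sum>k=1..K j. t j k)"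
proof -
  have "bij_betw act UNIV (PiE UNIV (\<lambda>i. {1..K i}))"
    using act by (simp add: profile_labelling_def PiE_UNIV_domain Pi_def)
  then have "(\<Sum>y\<in>UNIV. \<Prod>j\<in>UNIV. t j (act y j)) = (\<Sum>a\<in>PiE UNIV (\<lambda>i. {1..K i}). \<Prod>j\<in>UNIV. t j (a j))"
    by (rule sum.reindex_bij_betw)
  then show ?thesis by (simp add: prod_sum_PiE)
qed

text \<open>The indicator is absorbed into the factor of player \<open>i\<close>; the sum over
  profiles then factors, and the factors of the other players are 1.\<close>

lemma sum_prod_profiles_marginal:
  fixes t :: "'n \<Rightarrow> nat \<Rightarrow> real"
  assumes "\<And>j. (\<Sum>k=1..K j. t j k) = 1" "l \<in> {1..K i}"
  shows "(\<Sum>y\<in>UNIV. (if act y i = l then 1 else 0) * (\<Prod>j\<in>UNIV. t j (act y j))) = t i l"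
proof -
  define t' where "t' = t(i := (\<lambda>k. if k = l then t i k else 0))"
  have "(if act y i = l then 1 else 0) * (\<Prod>j\<in>UNIV. t j (act y j)) = (\<Prod>j\<in>UNIV. t' j (act y j))" for y
  proof (cases "act y i = l")
    case True
    then have "t' j (act y j) = t j (act y j)" for j by (simp add: t'_def)
    then show ?thesis using True by simp
  next
    case False
    then have "t' i (act y i) = 0" by (simp add: t'_def)
    then have "(\<Prod>j\<in>UNIV. t' j (act y j)) = 0" by (intro prod_zero) auto
    then show ?thesis using False by simp
  qed
  then have "(\<Sum>y\<in>UNIV. (if act y i = l then 1 else 0) * (\<Prod>j\<in>UNIV. t j (act y j))) =
      (\<Prod>j\<in>UNIV. \<Sum>k=1..K j. t' j k)" by (simp add: sum_prod_profiles)
  also have "\<dots> = (\<Prod>j\<in>UNIV. if j = i then t i l else 1)"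
  proof (intro prod.cong refl)
    fix j
    show "(\<Sum>k=1..K j. t' j k) = (if j = i then t i l else 1)"
      using assms by (cases "j = i") (auto simp: t'_def)
  qed
  also have "\<dots> = t i l" by simp
  finally show ?thesis .
qed

lemma expected_payoff_cong:
  assumes "\<And>j k. k \<in> {1..K j} \<Longrightarrow> t j k = t' j k"
  shows "expected_payoff act g i t = expected_payoff act g i t'"
  unfolding expected_payoff_def by (intro sum.cong prod.cong refl arg_cong2[of _ _ _ _ "(*)"] assms act_range)

lemma expected_payoff_split:
  "expected_payoff act g i t =
     (\<Sum>k=1..K j. t j k * expected_payoff act g i (t(j := (\<lambda>l. if l = k then 1 else 0))))"
proof -
  have "(\<Prod>m\<in>UNIV. t m (act y m)) =
      (\<Sum>k=1..K j. t j k * (\<Prod>m\<in>UNIV. (t(j := (\<lambda>l. if l = k then 1 else 0))) m (act y m)))" for y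
  proof -
    have "(\<Prod>m\<in>UNIV. (t(j := (\<lambda>l. if l = k then 1 else 0))) m (act y m)) =
        (if k = act y j then (\<Prod>m\<in>UNIV - {j}. t m (act y m)) else 0)" for k
      by (subst prod.remove[of _ j]) auto
    then have "(\<Sum>k=1..K j. t j k * (\<Prod>m\<in>UNIV. (t(j := (\<lambda>l. if l = k then 1 else 0))) m (act y m))) =
       (\<Sum>k=1..K j. if k = act y j then t j k * (\<Prod>m\<in>UNIV - {j}. t m (act y m)) else 0)"
      by (intro sum.cong) auto
    also have "\<dots> = t j (act y j) * (\<Prod>m\<in>UNIV - {j}. t m (act y m))"
      using act_range[of y j] by (subst sum.delta) auto
    also have "\<dots> = (\<Prod>m\<in>UNIV. t m (act y m))" by (subst (2) prod.remove[of _ j]) auto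
    finally show ?thesis ..
  qed
  then have "expected_payoff act g i t = (\<Sum>y\<in>UNIV. \<Sum>k=1..K j. t j k *
      (g $ i $ y * (\<Prod>m\<in>UNIV. (t(j := (\<lambda>l. if l = k then 1 else 0))) m (act y m))))"
    unfolding expected_payoff_def by (simp only: sum_distrib_left mult.left_commute)
  also have "\<dots> = (\<Sum>k=1..K j. \<Sum>y\<in>UNIV. t j k *
      (g $ i $ y * (\<Prod>m\<in>UNIV. (t(j := (\<lambda>l. if l = k then 1 else 0))) m (act y m))))"
    by (rule sum.swap)
  finally show ?thesis unfolding expected_payoff_def by (simp only: sum_distrib_left)
qed

lemma utility_eq_sum:
  "utility K act idx g i x = (\<Sum>k=1..K i. weight K idx x i k * pure_utility K act idx g i k x)"
  unfolding utility_def pure_utility_def by (rule expected_payoff_split)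

lemma pure_utility_cong:
  assumes "\<And>s. fst (idx s) \<noteq> i \<Longrightarrow> x $ s = x' $ s"
  shows "pure_utility K act idx g i k x = pure_utility K act idx g i k x'"
  unfolding pure_utility_def
  by (intro expected_payoff_cong) (auto intro!: weight_cong_other assms)

text \<open>Utility is linear in a player's own weights, so testing against pure actions is enough.
  This leaves finitely many polynomial inequalities, from which closedness can be read off.\<close>

lemma equilibrium_iff:
  "equilibrium K act idx g x \<longleftrightarrow> x \<in> mixed_strategies K idx \<and>
     (\<forall>i. \<forall>k\<in>{1..K i}. pure_utility K act idx g i k x \<le> utility K act idx g i x)"
proof (intro iffI conjI allI ballI)
  assume eq: "equilibrium K act idx g x"
  then show x: "x \<in> mixed_strategies K idx" by (simp add: equilibrium_def)
  fix i k assume k: "k \<in> {1..K i}"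
  define t where "t = (weight K idx x)(i := (\<lambda>l. if l = k then 1 else 0))"
  have t1: "(\<Sum>l=1..K j. t j l) = 1" for j
    using k by (cases "j = i") (auto simp: t_def sum_weight)
  have wt: "weight K idx (of_weights t) j l = t j l" if "l \<in> {1..K j}" for j l
    using t1 that by (rule weight_of_weights)
  have "of_weights t \<in> mixed_strategies K idx"
    using x wt by (auto simp: mixed_strategies_iff t_def)
  moreover have "of_weights t $ s = x $ s" if "fst (idx s) \<noteq> i" for s
  proof -
    obtain j l where jl: "idx s = (j, l)" by force
    then show ?thesis using that weight_idx[OF jl, of x] by (simp add: of_weights_def t_def)
  qed
  ultimately have "utility K act idx g i (of_weights t) \<le> utility K act idx g i x"
    using eq by (simp add: equilibrium_def)
  also have "utility K act idx g i (of_weights t) = pure_utility K act idx g i k x"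
    unfolding utility_def pure_utility_def by (intro expected_payoff_cong) (simp only: wt t_def[symmetric])
  finally show "pure_utility K act idx g i k x \<le> utility K act idx g i x" .
next
  assume R: "x \<in> mixed_strategies K idx \<and>
     (\<forall>i. \<forall>k\<in>{1..K i}. pure_utility K act idx g i k x \<le> utility K act idx g i x)"
  show "equilibrium K act idx g x" unfolding equilibrium_def
  proof (intro conjI allI ballI impI)
    fix i x' assume x': "x' \<in> mixed_strategies K idx" "\<forall>s. fst (idx s) \<noteq> i \<longrightarrow> x' $ s = x $ s"
    have "utility K act idx g i x' = (\<Sum>k=1..K i. weight K idx x' i k * pure_utility K act idx g i k x)"
      unfolding utility_eq_sum
      by (intro sum.cong refl arg_cong2[of _ _ _ _ "(*)"] pure_utility_cong) (use x'(2) in auto)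
    also have "\<dots> \<le> (\<Sum>k=1..K i. weight K idx x' i k * utility K act idx g i x)"
      using x'(1) R by (intro sum_mono mult_left_mono) (auto simp: mixed_strategies_iff)
    also have "\<dots> = utility K act idx g i x"
      by (simp add: sum_weight flip: sum_distrib_right)
    finally show "utility K act idx g i x \<ge> utility K act idx g i x'" .
  qed (use R in simp)
qed

text \<open>The weighted shortfalls \<open>?d\<close> are nonnegative and sum to zero, so each of
  them vanishes.\<close>

lemma carrier_indifferent:
  assumes eq: "equilibrium K act idx g x" and k: "k \<in> {1..K i}" "weight K idx x i k > 0"
  shows "pure_utility K act idx g i k x = utility K act idx g i x"
proof -
  let ?d = "\<lambda>k. weight K idx x i k * (utility K act idx g i x - pure_utility K act idx g i k x)"
  have "(\<Sum>k=1..K i. ?d k) = 0"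
    using utility_eq_sum[of g i x] sum_weight[of x i]
    by (simp add: right_diff_distrib sum_subtractf flip: sum_distrib_right)
  moreover have "?d k \<ge> 0" if "k \<in> {1..K i}" for k
    using eq that by (auto simp: equilibrium_iff mixed_strategies_iff)
  ultimately have "?d k = 0" using k(1) sum_nonneg_eq_0_iff[of "{1..K i}" ?d] by simp
  then show ?thesis using k(2) by simp
qed

text \<open>Here and in the next lemmas the arguments may depend on \<open>z\<close>, because
  polynomiality is used in the strategy alone, in the pair of game and strategy, and in the argument
  of \<open>critical_payoff\<close>.\<close>

lemma weight_polynomial:
  assumes "\<And>s. real_polynomial_function (\<lambda>z. x z $ s)"
  shows "real_polynomial_function (\<lambda>z. weight K idx (x z) i k)"
  unfolding weight_def
  by (intro real_polynomial_function_if real_polynomial_function_diff real_polynomial_function_sum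
      real_polynomial_function.intros(2) assms) auto

lemma expected_payoff_polynomial:
  assumes "\<And>j k. real_polynomial_function (\<lambda>z. t z j k)" "\<And>i y. real_polynomial_function (\<lambda>z. g z $ i $ y)"
  shows "real_polynomial_function (\<lambda>z. expected_payoff act (g z) i (t z))"
  unfolding expected_payoff_def
  by (intro real_polynomial_function_sum real_polynomial_function.intros(4) real_polynomial_function_prod assms) auto

lemma utility_polynomial:
  assumes "\<And>s. real_polynomial_function (\<lambda>z. x z $ s)" "\<And>i y. real_polynomial_function (\<lambda>z. g z $ i $ y)"
  shows "real_polynomial_function (\<lambda>z. utility K act idx (g z) i (x z))"
  unfolding utility_def by (intro expected_payoff_polynomial weight_polynomial assms)

lemma pure_utility_polynomial:
  assumes "\<And>s. real_polynomial_function (\<lambda>z. x z $ s)" "\<And>i y. real_polynomial_function (\<lambda>z. g z $ i $ y)"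
  shows "real_polynomial_function (\<lambda>z. pure_utility K act idx (g z) i k (x z))"
  unfolding pure_utility_def
proof (intro expected_payoff_polynomial assms)
  fix j l
  show "real_polynomial_function (\<lambda>z. ((weight K idx (x z))(i := \<lambda>l. if l = k then 1 else 0)) j l)"
    by (cases "j = i") (auto intro!: weight_polynomial assms)
qed

lemma Ftilde_polynomial:
  assumes "\<And>s. real_polynomial_function (\<lambda>z. x z $ s)" "\<And>i y. real_polynomial_function (\<lambda>z. g z $ i $ y)"
  shows "real_polynomial_function (\<lambda>z. Ftilde K act idx (g z) (x z) $ s)"
  unfolding Ftilde_def by (cases "idx s")
   (auto intro!: real_polynomial_function.intros(4) real_polynomial_function_diff weight_polynomial pure_utility_polynomial assms)

end


section \<open>Irregular games\<close>

text \<open>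
  What remains of irregularity once the inequalities in the equilibrium condition are dropped. This
  is enough for the measure estimates and is equivalent for a game and for its potential.
\<close>

definition singular_zero ::
  "('n::finite \<Rightarrow> nat) \<Rightarrow> ('y::finite \<Rightarrow> 'n \<Rightarrow> nat) \<Rightarrow> ('s::finite \<Rightarrow> 'n \<times> nat) \<Rightarrow> real^'y^'n \<Rightarrow> bool" where
  "singular_zero K act idx g \<longleftrightarrow>
     (\<exists>x. Ftilde K act idx g x = 0 \<and> (\<forall>i. weight K idx x i 1 \<noteq> 0) \<and>
          \<not> invertible (jacobian (Ftilde K act idx g) (at x)))"

text \<open>Transpositions suffice to bring one chosen carrier action of each player to the front.
  Indexing them by profiles keeps their number finite, as the union of null sets requires.\<close>

definition reference_act :: "('y \<Rightarrow> 'n \<Rightarrow> nat) \<Rightarrow> 'y \<Rightarrow> 'y \<Rightarrow> 'n \<Rightarrow> nat" where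
  "reference_act act r y i = Transposition.transpose 1 (act r i) (act y i)"

context game_form
begin

section \<open>Renumbering the actions\<close>

lemma bij_betw_relabel:
  assumes "\<And>i. \<sigma> i permutes {1..K i}"
  shows "bij_betw (\<lambda>a i. \<sigma> i (a i)) {a. \<forall>i. a i \<in> {1..K i}} {a. \<forall>i. a i \<in> {1..K i}}"
proof (rule bij_betw_byWitness[where f' = "\<lambda>a i. inv (\<sigma> i) (a i)"])
  note p = permutes_inverses[OF assms] permutes_in_image[OF assms] permutes_in_image[OF permutes_inv[OF assms]]
  show "\<forall>a\<in>{a. \<forall>i. a i \<in> {1..K i}}. (\<lambda>i. inv (\<sigma> i) (\<sigma> i (a i))) = a"
    "\<forall>a\<in>{a. \<forall>i. a i \<in> {1..K i}}. (\<lambda>i. \<sigma> i (inv (\<sigma> i) (a i))) = a"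
    by (simp_all add: p)
  show "(\<lambda>a i. \<sigma> i (a i)) ` {a. \<forall>i. a i \<in> {1..K i}} \<subseteq> {a. \<forall>i. a i \<in> {1..K i}}"
    "(\<lambda>a i. inv (\<sigma> i) (a i)) ` {a. \<forall>i. a i \<in> {1..K i}} \<subseteq> {a. \<forall>i. a i \<in> {1..K i}}"
    by (simp_all only: image_subset_iff mem_Collect_eq p) simp_all
qed

text \<open>Makes every result of the locale available for renumbered games by
  interpretation.\<close>

lemma game_form_relabel:
  assumes "\<And>i. \<sigma> i permutes {1..K i}"
  shows "game_form K (\<lambda>y i. \<sigma> i (act y i)) idx"
proof
  have "bij_betw ((\<lambda>a i. \<sigma> i (a i)) \<circ> act) UNIV {a. \<forall>i. a i \<in> {1..K i}}"
    using act bij_betw_relabel[OF assms] unfolding profile_labelling_def by (rule bij_betw_trans)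
  then show "profile_labelling K (\<lambda>y i. \<sigma> i (act y i))"
    by (simp add: profile_labelling_def comp_def)
qed (use K idx in auto)

lemma reference_permutes: "Transposition.transpose 1 (act r i) permutes {1..K i}"
  using act_range[of r i] K[of i] by (intro permutes_swap_id) auto

lemma game_form_reference: "game_form K (reference_act act r) idx"
  unfolding reference_act_def[abs_def] by (intro game_form_relabel reference_permutes)

definition relabel :: "('n \<Rightarrow> nat \<Rightarrow> nat) \<Rightarrow> real^'s \<Rightarrow> real^'s" where
  "relabel \<sigma> x = of_weights (\<lambda>i k. weight K idx x i (inv (\<sigma> i) k))"

lemma weight_relabel:
  assumes "\<And>i. \<sigma> i permutes {1..K i}" "k \<in> {1..K i}"
  shows "weight K idx (relabel \<sigma> x) i k = weight K idx x i (inv (\<sigma> i) k)"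
  unfolding relabel_def
proof (rule weight_of_weights)
  show "(\<Sum>k=1..K i. weight K idx x i (inv (\<sigma> i) k)) = 1"
    using sum.permute[OF permutes_inv[OF assms(1)[of i]], of "weight K idx x i"] sum_weight[of x i]
    by (simp add: comp_def)
qed (rule assms)

text \<open>The renumbering determines the new coordinates, which removes the quantifier over
  \<open>x'\<close> from the definition of a regular equilibrium.\<close>

lemma eq_relabel_iff:
  assumes "\<And>i. \<sigma> i permutes {1..K i}"
  shows "(\<forall>i. \<forall>k\<in>{1..K i}. weight K idx x' i (\<sigma> i k) = weight K idx x i k) \<longleftrightarrow> x' = relabel \<sigma> x"
proof
  assume L: "\<forall>i. \<forall>k\<in>{1..K i}. weight K idx x' i (\<sigma> i k) = weight K idx x i k"
  show "x' = relabel \<sigma> x"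
  proof (rule strategy_eqI)
    fix i k assume k: "k \<in> {1..K i}"
    then have "inv (\<sigma> i) k \<in> {1..K i}" using permutes_in_image[OF permutes_inv[OF assms]] by blast
    with L have "weight K idx x' i (\<sigma> i (inv (\<sigma> i) k)) = weight K idx x i (inv (\<sigma> i) k)" by blast
    then show "weight K idx x' i k = weight K idx (relabel \<sigma> x) i k"
      by (simp add: weight_relabel[OF assms k] permutes_inverses[OF assms])
  qed
next
  assume "x' = relabel \<sigma> x"
  then show "\<forall>i. \<forall>k\<in>{1..K i}. weight K idx x' i (\<sigma> i k) = weight K idx x i k"
    using permutes_in_image[OF assms] by (simp only:) (simp add: weight_relabel[OF assms] permutes_inverses[OF assms])
qed

lemma pure_utility_relabel:
  assumes "\<And>i. \<sigma> i permutes {1..K i}"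
  shows "pure_utility K (\<lambda>y i. \<sigma> i (act y i)) idx g i (\<sigma> i k) (relabel \<sigma> x) = pure_utility K act idx g i k x"
proof -
  have "((weight K idx (relabel \<sigma> x))(i := (\<lambda>l. if l = \<sigma> i k then 1 else 0))) j (\<sigma> j (act y j)) =
    ((weight K idx x)(i := (\<lambda>l. if l = k then 1 else 0))) j (act y j)" for j y
  proof (cases "j = i")
    case True
    then show ?thesis using permutes_inj[OF assms] by (simp add: inj_eq)
  next
    case False
    have "\<sigma> j (act y j) \<in> {1..K j}" using permutes_in_image[OF assms] act_range by blast
    then show ?thesis using False by (simp add: weight_relabel[OF assms] permutes_inverses[OF assms])
  qed
  then show ?thesis unfolding pure_utility_def expected_payoff_def by simp
qed

lemma regular_equilibrium_iff:
  "regular_equilibrium K act idx g x \<longleftrightarrow> equilibrium K act idx g x \<and>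
     (\<exists>\<sigma>. (\<forall>i. \<sigma> i permutes {1..K i}) \<and> (\<forall>i. weight K idx (relabel \<sigma> x) i 1 > 0) \<and>
       invertible (jacobian (Ftilde K (\<lambda>y i. \<sigma> i (act y i)) idx g) (at (relabel \<sigma> x))))"
proof -
  have "1 \<in> carr K idx i x' \<longleftrightarrow> weight K idx x' i 1 > 0" for i x'
    using K[of i] by (auto simp: carr_def)
  then have carr: "(\<forall>i. 1 \<in> carr K idx i x') \<longleftrightarrow> (\<forall>i. weight K idx x' i 1 > 0)" for x' by simp
  show ?thesis unfolding regular_equilibrium_def carr
  proof (intro conj_cong refl ex_cong1)
    fix \<sigma>
    let ?R = "\<lambda>x'. (\<forall>i. weight K idx x' i 1 > 0) \<and>
       invertible (jacobian (Ftilde K (\<lambda>y i. \<sigma> i (act y i)) idx g) (at x'))"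
    show "(\<exists>x'. (\<forall>i. \<sigma> i permutes {1..K i}) \<and>
       (\<forall>i. \<forall>k\<in>{1..K i}. weight K idx x' i (\<sigma> i k) = weight K idx x i k) \<and> ?R x') \<longleftrightarrow>
       (\<forall>i. \<sigma> i permutes {1..K i}) \<and> ?R (relabel \<sigma> x)"
    proof (cases "\<forall>i. \<sigma> i permutes {1..K i}")
      case True
      then have "(\<forall>i. \<forall>k\<in>{1..K i}. weight K idx x' i (\<sigma> i k) = weight K idx x i k) \<longleftrightarrow> x' = relabel \<sigma> x" for x'
        by (intro eq_relabel_iff) simp
      then show ?thesis using True by (simp only: simp_thms)
    qed (simp only: simp_thms)
  qed
qed

text \<open>At an irregular equilibrium the Jacobian is singular for every admissible renumbering,
  in particular for transpositions that put a carrier action first. There \<open>Ftilde\<close>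
  vanishes, since each action has weight zero or is as good as the reference action.\<close>

lemma irregular_imp_singular_zero:
  assumes "\<not> regular_game K act idx g"
  shows "\<exists>r. singular_zero K (reference_act act r) idx g"
proof -
  obtain x where eq: "equilibrium K act idx g x" and nr: "\<not> regular_equilibrium K act idx g x"
    using assms by (auto simp: regular_game_def)
  have "\<exists>k\<in>{1..K i}. weight K idx x i k > 0" for i
  proof (rule ccontr)
    assume "\<not> ?thesis"
    then have "(\<Sum>k=1..K i. weight K idx x i k) \<le> 0" by (intro sum_nonpos) (auto simp: not_less)
    then show False by (simp add: sum_weight)
  qed
  then obtain a where a: "\<And>i. a i \<in> {1..K i}" "\<And>i. weight K idx x i (a i) > 0" by metis
  define r where "r = inv act a"
  have r: "act r = a" unfolding r_def using a(1) by (rule act_inv)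
  define \<sigma> where "\<sigma> = (\<lambda>i. Transposition.transpose 1 (act r i))"
  have \<sigma>: "\<And>i. \<sigma> i permutes {1..K i}" unfolding \<sigma>_def by (rule reference_permutes)
  have ref: "reference_act act r = (\<lambda>y i. \<sigma> i (act y i))"
    by (simp add: reference_act_def[abs_def] \<sigma>_def)
  have inv: "inv (\<sigma> i) = \<sigma> i" for i by (simp add: \<sigma>_def)
  have one: "1 \<in> {1..K i}" for i using K[of i] by simp
  have w1: "weight K idx (relabel \<sigma> x) i 1 > 0" for i
    using a by (simp add: weight_relabel[OF \<sigma> one] inv) (simp add: \<sigma>_def r)
  have "Ftilde K (\<lambda>y i. \<sigma> i (act y i)) idx g (relabel \<sigma> x) $ s = 0" for s
  proof -
    obtain i k where ik: "idx s = (i, k)" by force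
    have k: "k + 1 \<in> {1..K i}" using idx_range[OF ik] by auto
    define l where "l = \<sigma> i (k + 1)"
    have l: "l \<in> {1..K i}" "\<sigma> i l = k + 1"
      using permutes_in_image[OF \<sigma>] k by (auto simp: l_def \<sigma>_def)
    have xs: "relabel \<sigma> x $ s = weight K idx x i l"
      by (simp only: weight_idx[OF ik, symmetric] weight_relabel[OF \<sigma> k] inv l_def)
    have pl: "pure_utility K (\<lambda>y i. \<sigma> i (act y i)) idx g i (k + 1) (relabel \<sigma> x) = pure_utility K act idx g i l x"
      unfolding l(2)[symmetric] by (rule pure_utility_relabel[OF \<sigma>])
    have "\<sigma> i (a i) = 1" by (simp add: \<sigma>_def r)
    then have p1: "pure_utility K (\<lambda>y i. \<sigma> i (act y i)) idx g i 1 (relabel \<sigma> x) = pure_utility K act idx g i (a i) x"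
      using pure_utility_relabel[OF \<sigma>, of g i "a i" x] by simp
    have pa: "pure_utility K act idx g i (a i) x = utility K act idx g i x"
      using eq a by (intro carrier_indifferent) auto
    have "weight K idx x i l = 0 \<or> pure_utility K act idx g i l x = utility K act idx g i x"
    proof (cases "weight K idx x i l = 0")
      case False
      moreover have "weight K idx x i l \<ge> 0"
        using eq l(1) by (auto simp: equilibrium_iff mixed_strategies_iff)
      ultimately show ?thesis using carrier_indifferent[OF eq l(1)] by simp
    qed simp
    then show ?thesis unfolding Ftilde_def by (auto simp: ik xs pl p1 pa)
  qed
  then have "Ftilde K (reference_act act r) idx g (relabel \<sigma> x) = 0"
    unfolding ref by (simp add: vec_eq_iff)
  moreover have "\<not> invertible (jacobian (Ftilde K (reference_act act r) idx g) (at (relabel \<sigma> x)))"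
    using nr eq \<sigma> w1 unfolding regular_equilibrium_iff ref by blast
  moreover have "\<forall>i. weight K idx (relabel \<sigma> x) i 1 \<noteq> 0"
    using w1 by (auto simp: less_le)
  ultimately show ?thesis unfolding singular_zero_def by blast
qed

section \<open>Closedness of the set of irregular games\<close>

text \<open>The derivative in the strategy is that of the joint polynomial map in the directions
  \<open>(0, v)\<close>, and is therefore polynomial in the game as well.\<close>

lemma Ftilde_has_derivative:
  obtains L :: "'s \<Rightarrow> (real^'y^'n) \<times> (real^'s) \<Rightarrow> real^'s \<Rightarrow> real"
  where "\<And>g x. (Ftilde K act idx g has_derivative (\<lambda>v. \<chi> s. L s (g, x) v)) (at x)"
    and "\<And>s v. real_polynomial_function (\<lambda>z. L s z v)"
proof -
  let ?F = "\<lambda>s z. Ftilde K act idx (fst z) (snd z) $ s"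
  have lin: "bounded_linear (\<lambda>z::(real^'y^'n) \<times> (real^'s). fst z $ i $ y)"
     "bounded_linear (\<lambda>z::(real^'y^'n) \<times> (real^'s). snd z $ s)" for i y s
    by (intro bounded_linear_compose[OF bounded_linear_vec_nth] bounded_linear_fst bounded_linear_snd)+
  have "real_polynomial_function (?F s)" for s
    by (intro Ftilde_polynomial real_polynomial_function.intros(1) lin)
  then have "\<forall>s. \<exists>p'. \<forall>z. (?F s has_derivative p' z) (at z) \<and> (\<forall>v. real_polynomial_function (\<lambda>z. p' z v))"
    by (intro allI real_polynomial_function_has_derivative)
  from choice[OF this] obtain p' where
    p': "\<And>s z. (?F s has_derivative p' s z) (at z)" "\<And>s v. real_polynomial_function (\<lambda>z. p' s z v)" by blast
  show ?thesis
  proof (rule that[of "\<lambda>s z v. p' s z (0, v)"])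
    fix g x
    have "((\<lambda>x. Ftilde K act idx g x $ s) has_derivative (\<lambda>v. p' s (g, x) (0, v))) (at x)" for s
    proof -
      have "((\<lambda>x. (g, x)) has_derivative (\<lambda>v. (0, v))) (at x)"
        by (auto intro!: derivative_eq_intros)
      from has_derivative_compose[OF this p'(1)] show ?thesis by simp
    qed
    then show "(Ftilde K act idx g has_derivative (\<lambda>v. \<chi> s. p' s (g, x) (0, v))) (at x)"
      unfolding has_derivative_componentwise_within[of "Ftilde K act idx g"]
      by (auto simp: Basis_vec_def inner_axis)
  qed (rule p'(2))
qed

lemma closed_equilibria:
  "closed {z. equilibrium K act idx (fst z) (snd z)}"
proof -
  have lin: "bounded_linear (\<lambda>z::(real^'y^'n) \<times> (real^'s). fst z $ i $ y)"
     "bounded_linear (\<lambda>z::(real^'y^'n) \<times> (real^'s). snd z $ s)" for i y s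
    by (intro bounded_linear_compose[OF bounded_linear_vec_nth] bounded_linear_fst bounded_linear_snd)+
  note rp = real_polynomial_function.intros(1)[OF lin(1)] real_polynomial_function.intros(1)[OF lin(2)]
  show ?thesis
    unfolding equilibrium_iff mixed_strategies_iff Ball_def
    by (intro closed_Collect_conj closed_Collect_all closed_Collect_imp open_Collect_const closed_Collect_le
        real_polynomial_function_continuous_on weight_polynomial pure_utility_polynomial utility_polynomial rp
        real_polynomial_function.intros(2))
qed

lemma compact_mixed_strategies: "compact (mixed_strategies K idx)"
proof -
  have "closed {x. \<forall>i. \<forall>k\<in>{1..K i}. weight K idx x i k \<ge> 0}"
    unfolding Ball_def
    by (intro closed_Collect_all closed_Collect_imp open_Collect_const closed_Collect_le
        real_polynomial_function_continuous_on weight_polynomial real_polynomial_function.intros(2)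
        real_polynomial_function_vec_nth)
  moreover have "bounded (mixed_strategies K idx)"
  proof (rule bounded_subset)
    show "mixed_strategies K idx \<subseteq> cbox 0 (\<chi> s. 1)"
    proof
      fix x assume x: "x \<in> mixed_strategies K idx"
      have "0 \<le> x $ s \<and> x $ s \<le> 1" for s
      proof -
        obtain i k where ik: "idx s = (i, k)" by force
        have "0 \<le> x $ inv idx (i, k) \<and> x $ inv idx (i, k) \<le> 1"
          using x idx_range[OF ik] unfolding mixed_strategies_def by blast
        then show ?thesis by (simp add: ik[symmetric])
      qed
      then show "x \<in> cbox 0 (\<chi> s. 1)" by (simp add: mem_box_cart)
    qed
  qed simp
  moreover have "mixed_strategies K idx = {x. \<forall>i. \<forall>k\<in>{1..K i}. weight K idx x i k \<ge> 0}"
    using mixed_strategies_iff by blast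
  ultimately show ?thesis by (simp add: compact_eq_bounded_closed)
qed

lemma relabel_polynomial: "real_polynomial_function (\<lambda>x. relabel \<sigma> x $ s)"
  unfolding relabel_def of_weights_def
  by (cases "idx s") (auto intro!: weight_polynomial)

lemma open_invertible_jacobian:
  "open {z. invertible (jacobian (Ftilde K act idx (fst z)) (at (snd z)))}"
proof -
  obtain L :: "'s \<Rightarrow> (real^'y^'n) \<times> (real^'s) \<Rightarrow> real^'s \<Rightarrow> real" where
    L: "\<And>g x. (Ftilde K act idx g has_derivative (\<lambda>v. \<chi> s. L s (g, x) v)) (at x)"
    and Lp: "\<And>s v. real_polynomial_function (\<lambda>z. L s z v)"
    by (rule Ftilde_has_derivative, rule that)
  have "jacobian (Ftilde K act idx (fst z)) (at (snd z)) = (\<chi> s s'. L s z (axis s' 1))" for z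
  proof -
    have "frechet_derivative (Ftilde K act idx (fst z)) (at (snd z)) = (\<lambda>v. \<chi> s. L s z v)"
      using frechet_derivative_at[OF L[of "fst z" "snd z"]] by simp
    then show ?thesis unfolding jacobian_def matrix_def by simp
  qed
  then have "{z. invertible (jacobian (Ftilde K act idx (fst z)) (at (snd z)))} =
      {z. det (\<chi> s s'. L s z (axis s' 1)) \<noteq> 0}"
    by (simp add: invertible_det_nz)
  moreover have "open {z. det (\<chi> s s'. L s z (axis s' 1)) \<noteq> 0}"
    unfolding det_def
    by (intro open_Collect_neq continuous_intros) (simp_all add: real_polynomial_function_continuous_on Lp)
  ultimately show ?thesis by simp
qed

text \<open>Regularity asks for some renumbering under which strict inequalities and a nonzero
  determinant hold. It is thus a union of open conditions, and its failure is closed among the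
  equilibria.\<close>

lemma closed_irregular: "closed {g. \<not> regular_game K act idx g}"
proof -
  define P where "P = {\<sigma>. \<forall>i. \<sigma> i permutes {1..K i}}"
  define \<Omega> where "\<Omega> = (\<lambda>\<sigma>. {z :: (real^'y^'n) \<times> (real^'s). (\<forall>i. weight K idx (relabel \<sigma> (snd z)) i 1 > 0) \<and>
     invertible (jacobian (Ftilde K (\<lambda>y i. \<sigma> i (act y i)) idx (fst z)) (at (relabel \<sigma> (snd z))))})"
  have "open (\<Omega> \<sigma>)" if "\<sigma> \<in> P" for \<sigma>
  proof -
    interpret r: game_form K "\<lambda>y i. \<sigma> i (act y i)" idx
      using that by (intro game_form_relabel) (simp add: P_def)
    have c: "continuous_on UNIV (relabel \<sigma>)"
      by (subst continuous_on_componentwise)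
        (auto simp: Basis_vec_def inner_axis intro!: real_polynomial_function_continuous_on relabel_polynomial)
    have "continuous_on UNIV (\<lambda>z :: (real^'y^'n) \<times> (real^'s). (fst z, relabel \<sigma> (snd z)))"
      by (intro continuous_intros continuous_on_compose2[OF c]) auto
    from open_vimage[OF r.open_invertible_jacobian this]
    have "open {z :: (real^'y^'n) \<times> (real^'s).
       invertible (jacobian (Ftilde K (\<lambda>y i. \<sigma> i (act y i)) idx (fst z)) (at (relabel \<sigma> (snd z))))}"
      by (simp add: vimage_def)
    moreover have "open {z :: (real^'y^'n) \<times> (real^'s). \<forall>i. weight K idx (relabel \<sigma> (snd z)) i 1 > 0}"
    proof -
      have "continuous_on UNIV (\<lambda>x. weight K idx (relabel \<sigma> x) i 1)" for i
        by (intro real_polynomial_function_continuous_on weight_polynomial relabel_polynomial)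
      then have "continuous_on UNIV (\<lambda>z :: (real^'y^'n) \<times> (real^'s). weight K idx (relabel \<sigma> (snd z)) i 1)" for i
        by (rule continuous_on_compose2) (auto intro: continuous_intros)
      then have "open (\<Inter>i. {z :: (real^'y^'n) \<times> (real^'s). weight K idx (relabel \<sigma> (snd z)) i 1 > 0})"
        by (intro open_INT ballI open_Collect_less continuous_intros) auto
      moreover have "{z :: (real^'y^'n) \<times> (real^'s). \<forall>i. weight K idx (relabel \<sigma> (snd z)) i 1 > 0} =
          (\<Inter>i. {z. weight K idx (relabel \<sigma> (snd z)) i 1 > 0})" by auto
      ultimately show ?thesis by simp
    qed
    ultimately show ?thesis unfolding \<Omega>_def by (intro open_Collect_conj)
  qed
  then have "open (\<Union>\<sigma>\<in>P. \<Omega> \<sigma>)" by blast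
  then have cl: "closed ({z. equilibrium K act idx (fst z) (snd z)} - (\<Union>\<sigma>\<in>P. \<Omega> \<sigma>))" (is "closed ?E")
    by (intro closed_Diff closed_equilibria)
  have "?E \<subseteq> UNIV \<times> mixed_strategies K idx" by (auto simp: equilibrium_def)
  then have "closedin (top_of_set (UNIV \<times> mixed_strategies K idx)) ?E"
    using cl by (rule closed_subset)
  from Starlike.closed_map_fst[OF compact_mixed_strategies this]
  have cf: "closed (fst ` ?E)" by simp
  have E: "?E = {z. equilibrium K act idx (fst z) (snd z) \<and> \<not> regular_equilibrium K act idx (fst z) (snd z)}"
    unfolding regular_equilibrium_iff \<Omega>_def P_def by blast
  have "fst ` {z. equilibrium K act idx (fst z) (snd z) \<and> \<not> regular_equilibrium K act idx (fst z) (snd z)} =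
     {g. \<not> regular_game K act idx g}"
  proof (rule set_eqI)
    fix g
    show "g \<in> fst ` {z. equilibrium K act idx (fst z) (snd z) \<and> \<not> regular_equilibrium K act idx (fst z) (snd z)} \<longleftrightarrow>
        g \<in> {g. \<not> regular_game K act idx g}"
      by (simp add: regular_game_def image_iff)
  qed
  with cf show ?thesis unfolding E by simp
qed

end


section \<open>Sard's theorem and identical payoffs\<close>

text \<open>The library's Sard theorem needs a well-ordered index type; \<open>'a ordered\<close> is such a copy of \<open>'a\<close>.\<close>

datatype 'a ordered = Ordered (unordered: 'a)

lemma UNIV_ordered: "(UNIV :: 'a ordered set) = range Ordered"
  by (metis UNIV_I UNIV_eq_I ordered.exhaust rangeI)

instance ordered :: (finite) finite
  by standard (simp add: UNIV_ordered)

instantiation ordered :: (finite) wellorder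
begin

definition less_eq_ordered :: "'a ordered \<Rightarrow> 'a ordered \<Rightarrow> bool" where
  "x \<le> y \<longleftrightarrow> to_nat (unordered x) \<le> to_nat (unordered y)"

definition less_ordered :: "'a ordered \<Rightarrow> 'a ordered \<Rightarrow> bool" where
  "x < y \<longleftrightarrow> to_nat (unordered x) < to_nat (unordered y)"

instance
proof
  fix P :: "'a ordered \<Rightarrow> bool" and a
  assume *: "\<And>x. (\<And>y. y < x \<Longrightarrow> P y) \<Longrightarrow> P x"
  show "P a"
    by (induction a rule: measure_induct_rule[of "\<lambda>x. to_nat (unordered x)"])
      (rule *, simp add: less_ordered_def)
qed (auto simp: less_eq_ordered_def less_ordered_def ordered.expand)

end

lemma has_derivative_vecI:
  fixes f :: "'a::real_normed_vector \<Rightarrow> real^'n::finite"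
  assumes "\<And>i. ((\<lambda>x. f x $ i) has_derivative (\<lambda>v. f' v $ i)) (at x)"
  shows "(f has_derivative f') (at x)"
  unfolding has_derivative_componentwise_within[of f]
  using assms by (auto simp: Basis_vec_def inner_axis)

lemma polynomial_has_derivative_vec:
  fixes f :: "'a::real_normed_vector \<Rightarrow> real^'n::finite"
  assumes "\<And>i. real_polynomial_function (\<lambda>x. f x $ i)"
  shows "\<exists>f'. \<forall>x. (f has_derivative f' x) (at x)"
proof -
  have "\<forall>i. \<exists>p'. \<forall>x. ((\<lambda>x. f x $ i) has_derivative p' x) (at x)"
    using real_polynomial_function_has_derivative[OF assms] by blast
  from choice[OF this] obtain p' where "\<And>i x. ((\<lambda>x. f x $ i) has_derivative p' i x) (at x)" by blast
  then have "(f has_derivative (\<lambda>v. \<chi> i. p' i x v)) (at x)" for x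
    by (intro has_derivative_vecI) simp
  then show ?thesis by (intro exI[of _ "\<lambda>x v. \<chi> i. p' i x v"] allI)
qed

text \<open>A derivative with a nontrivial kernel has deficient rank. The linear bijections
  \<open>e\<close> and \<open>d\<close> move the map to the well-ordered index type and
  back.\<close>

lemma negligible_singular_image:
  fixes f :: "real^'n::finite \<Rightarrow> real^'n"
  assumes der: "\<And>x. x \<in> S \<Longrightarrow> (f has_derivative f' x) (at x)"
    and sing: "\<And>x. x \<in> S \<Longrightarrow> \<exists>v. v \<noteq> 0 \<and> f' x v = 0"
  shows "negligible (f ` S)"
proof -
  define e :: "real^'n \<Rightarrow> real^('n ordered)" where "e = (\<lambda>x. \<chi> i. x $ unordered i)"
  define d :: "real^('n ordered) \<Rightarrow> real^'n" where "d = (\<lambda>x. \<chi> i. x $ Ordered i)"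
  have de [simp]: "d (e x) = x" and ed [simp]: "e (d w) = w" for x w
    by (simp_all add: d_def e_def vec_eq_iff)
  have lin: "linear e" "linear d"
    by (auto simp: linear_iff d_def e_def vec_eq_iff)
  then have bl: "bounded_linear e" "bounded_linear d" by (simp_all add: linear_linear)
  define g' where "g' = (\<lambda>w v. e (f' (d w) (d v)))"
  have "negligible ((\<lambda>w. e (f (d w))) ` e ` S)"
  proof (rule baby_Sard[where f' = g'])
    fix w assume "w \<in> e ` S"
    then have w: "d w \<in> S" by auto
    have "((\<lambda>w. f (d w)) has_derivative (\<lambda>v. f' (d w) (d v))) (at w)"
      using bounded_linear_imp_has_derivative[OF bl(2)] der[OF w] by (rule has_derivative_compose)
    then have gd: "((\<lambda>w. e (f (d w))) has_derivative g' w) (at w)"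
      unfolding g'_def by (rule bounded_linear.has_derivative[OF bl(1)])
    then show "((\<lambda>w. e (f (d w))) has_derivative g' w) (at w within e ` S)"
      by (rule has_derivative_at_withinI)
    have "linear (g' w)" using gd by (rule has_derivative_linear)
    then have m: "matrix (g' w) *v v = g' w v" for v by simp
    obtain v where v: "v \<noteq> 0" "f' (d w) v = 0" using sing[OF w] by blast
    have "e v \<noteq> 0" using v(1) de[of v] lin(2) linear_0 by metis
    moreover have "g' w (e v) = 0" using v(2) lin(1) by (simp add: g'_def linear_0)
    moreover have "g' w 0 = 0" using \<open>linear (g' w)\<close> by (rule linear_0)
    ultimately have "\<not> inj ((*v) (matrix (g' w)))" unfolding inj_def m by metis
    then show "rank (matrix (g' w)) < CARD('n ordered)" by (simp add: less_rank_noninjective)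
  qed simp
  then have "negligible (d ` (\<lambda>w. e (f (d w))) ` e ` S)"
  proof (rule negligible_differentiable_image_negligible[rotated])
    have "bij_betw Ordered (UNIV :: 'n set) UNIV"
      unfolding UNIV_ordered by (intro inj_on_imp_bij_betw injI) simp
    from bij_betw_same_card[OF this] show "DIM(real^('n ordered)) \<le> DIM(real^'n)" by simp
    show "d differentiable_on (\<lambda>w. e (f (d w))) ` e ` S"
      using bl(2) by (intro bounded_linear_imp_differentiable_on)
  qed
  then show ?thesis by (simp add: image_image)
qed

text \<open>\<open>has_potential\<close> sees actions only through equalities, which an injective
  renumbering preserves.\<close>

lemma has_potential_reference:
  "has_potential act g w u \<Longrightarrow> has_potential (reference_act act r) g w u"
  by (simp add: has_potential_def reference_act_def inj_eq[OF inj_transpose])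

context game_form
begin

section \<open>Comparison of a game with its potential\<close>

text \<open>The remainder \<open>h\<close> does not depend on the action of \<open>i\<close>, so it
  contributes the same to \<open>k\<close> and to \<open>l\<close> and cancels.\<close>

lemma pure_utility_potential:
  assumes pot: "has_potential act g w u" and k: "k \<in> {1..K i}" and l: "l \<in> {1..K i}"
  shows "pure_utility K act idx g i k x - pure_utility K act idx g i l x =
     w i * (pure_utility K act idx (identical_payoffs_game (\<chi> y. u y)) i k x -
            pure_utility K act idx (identical_payoffs_game (\<chi> y. u y)) i l x)"
proof -
  define h where "h = (\<lambda>y. g $ i $ y - w i * u y)"
  define p where "p = (\<lambda>k y. \<Prod>j\<in>UNIV. ((weight K idx x)(i := (\<lambda>l. if l = k then 1 else 0))) j (act y j))"
  have h: "h y = h z" if "\<forall>j. j \<noteq> i \<longrightarrow> act y j = act z j" for y z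
    using pot that unfolding has_potential_def h_def by (force simp: algebra_simps)
  have pu_sum: "pure_utility K act idx g' i k x = (\<Sum>y\<in>UNIV. g' $ i $ y * p k y)" for g' k
    by (simp only: pure_utility_def expected_payoff_def p_def)
  have pu: "pure_utility K act idx g i k x =
      w i * pure_utility K act idx (identical_payoffs_game (\<chi> y. u y)) i k x + (\<Sum>y\<in>UNIV. h y * p k y)" for k
    by (simp add: pu_sum identical_payoffs_game_def h_def sum_distrib_left algebra_simps flip: sum.distrib)
  \<comment> \<open>\<open>\<tau>\<close> exchanges the actions \<open>k\<close> and
    \<open>l\<close> of player \<open>i\<close>. It preserves \<open>h\<close> and carries the
    profile weights \<open>p k\<close> to \<open>p l\<close>, so it reindexes one sum as the
    other.\<close>
  define \<tau> where "\<tau> = (\<lambda>y. inv act ((act y)(i := Transposition.transpose k l (act y i))))"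
  have a\<tau>: "act (\<tau> y) = (act y)(i := Transposition.transpose k l (act y i))" for y
    unfolding \<tau>_def
  proof (rule act_inv)
    fix j
    have "Transposition.transpose k l permutes {1..K i}" using k l by (rule permutes_swap_id)
    then show "((act y)(i := Transposition.transpose k l (act y i))) j \<in> {1..K j}"
      using act_range[of y j] permutes_in_image by fastforce
  qed
  have \<tau>\<tau>: "\<tau> (\<tau> y) = y" for y
    by (rule act_inject[THEN iffD1]) (simp add: a\<tau> fun_eq_iff)
  have "(\<Sum>y\<in>UNIV. h y * p k y) = (\<Sum>y\<in>UNIV. h y * p l y)"
  proof (rule sum.reindex_bij_witness[of _ \<tau> \<tau>])
    fix y
    have "h (\<tau> y) = h y" by (rule h) (simp add: a\<tau>)
    moreover have "p l (\<tau> y) = p k y"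
      unfolding p_def
    proof (intro prod.cong refl)
      fix j
      show "((weight K idx x)(i := (\<lambda>m. if m = l then 1 else 0))) j (act (\<tau> y) j) =
         ((weight K idx x)(i := (\<lambda>l. if l = k then 1 else 0))) j (act y j)"
        by (auto simp: a\<tau> Transposition.transpose_def)
    qed
    ultimately show "h (\<tau> y) * p l (\<tau> y) = h y * p k y" by simp
  qed (auto simp: \<tau>\<tau>)
  then show ?thesis by (simp add: pu right_diff_distrib)
qed

lemma Ftilde_potential:
  assumes "has_potential act g w u"
  shows "Ftilde K act idx g x $ s =
    w (fst (idx s)) * Ftilde K act idx (identical_payoffs_game (\<chi> y. u y)) x $ s"
proof -
  obtain i k where ik: "idx s = (i, k)" by force
  have k: "k + 1 \<in> {1..K i}" "1 \<in> {1..K i}" using idx_range[OF ik] by auto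
  show ?thesis unfolding Ftilde_def by (simp add: ik pure_utility_potential[OF assms k])
qed

text \<open>Scaling rows by nonzero factors changes neither the zeros of \<open>Ftilde\<close> nor
  the kernel of its derivative.\<close>

lemma singular_zero_potential:
  assumes pot: "has_potential act g w u" and w: "\<And>i. w i > 0"
  shows "singular_zero K act idx g \<longleftrightarrow> singular_zero K act idx (identical_payoffs_game (\<chi> y. u y))"
proof -
  let ?I = "identical_payoffs_game (\<chi> y. u y) :: real^'y^'n"
  obtain L :: "'s \<Rightarrow> (real^'y^'n) \<times> (real^'s) \<Rightarrow> real^'s \<Rightarrow> real" where
    L: "\<And>g x. (Ftilde K act idx g has_derivative (\<lambda>v. \<chi> s. L s (g, x) v)) (at x)"
    by (rule Ftilde_has_derivative, rule that)
  have w0: "w i \<noteq> 0" for i using w[of i] by simp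
  have "(Ftilde K act idx g has_derivative (\<lambda>v. \<chi> s. w (fst (idx s)) * L s (?I, x) v)) (at x)" for x
  proof (rule has_derivative_vecI)
    fix s
    have "((\<lambda>x. Ftilde K act idx ?I x $ s) has_derivative (\<lambda>v. (\<chi> s. L s (?I, x) v) $ s)) (at x)"
      by (rule bounded_linear.has_derivative[OF bounded_linear_vec_nth L])
    then show "((\<lambda>x. Ftilde K act idx g x $ s) has_derivative (\<lambda>v. (\<chi> s. w (fst (idx s)) * L s (?I, x) v) $ s)) (at x)"
      unfolding Ftilde_potential[OF pot] by (auto intro!: derivative_eq_intros)
  qed
  then have "invertible (jacobian (Ftilde K act idx g) (at x)) \<longleftrightarrow>
      invertible (jacobian (Ftilde K act idx ?I) (at x))" for x
    unfolding invertible_jacobian_iff[OF L[of ?I x]]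
    by (subst invertible_jacobian_iff) (auto simp: vec_eq_iff w0)
  moreover have "Ftilde K act idx g x = 0 \<longleftrightarrow> Ftilde K act idx ?I x = 0" for x
    by (auto simp: vec_eq_iff Ftilde_potential[OF pot] w0)
  ultimately show ?thesis unfolding singular_zero_def by simp
qed


section \<open>The gradient of the common expected payoff\<close>

text \<open>This is the partial derivative of the common expected payoff in the coordinate
  \<open>s\<close>: raising \<open>x $ s\<close> moves weight from action \<open>1\<close> to action
  \<open>k + 1\<close>.\<close>

definition payoff_gap :: "real^'y \<Rightarrow> real^'s \<Rightarrow> 's \<Rightarrow> real" where
  "payoff_gap u x s = (case idx s of (i, k) \<Rightarrow>
     pure_utility K act idx (identical_payoffs_game u) i (k + 1) x -
     pure_utility K act idx (identical_payoffs_game u) i 1 x)"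

lemma Ftilde_identical:
  "Ftilde K act idx (identical_payoffs_game u) x $ s =
     weight K idx x (fst (idx s)) 1 * x $ s * payoff_gap u x s"
  by (simp add: Ftilde_def payoff_gap_def split: prod.split)

lemma payoff_gap_diff: "payoff_gap (u - v) x s = payoff_gap u x s - payoff_gap v x s"
  by (simp add: payoff_gap_def pure_utility_def expected_payoff_def identical_payoffs_game_def
      left_diff_distrib sum_subtractf split: prod.split)

lemma payoff_gap_polynomial:
  assumes "\<And>s. real_polynomial_function (\<lambda>z. x z $ s)" "\<And>y. real_polynomial_function (\<lambda>z. u z $ y)"
  shows "real_polynomial_function (\<lambda>z. payoff_gap (u z) (x z) s)"
  unfolding payoff_gap_def
  by (cases "idx s") (auto simp: identical_payoffs_game_def intro!: pure_utility_polynomial assms)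

text \<open>
  The payoff gaps of these payoffs are constants, so that adding them to a game translates the
  gradient of the common payoff.
\<close>

definition separable :: "real^'s \<Rightarrow> real^'y" where
  "separable c = (\<chi> y. \<Sum>s\<in>UNIV. if act y (fst (idx s)) = snd (idx s) + 1 then c $ s else 0)"

text \<open>Evaluation at these profiles reads off the coefficients of a separable payoff, so the
  payoffs vanishing at all of them form a complement to the separable ones.\<close>

definition deviation_profile :: "'s \<Rightarrow> 'y" where
  "deviation_profile s = inv act (\<lambda>j. if j = fst (idx s) then snd (idx s) + 1 else 1)"

lemma snd_idx: "1 \<le> snd (idx s)" "snd (idx s) + 1 \<in> {1..K (fst (idx s))}"
  using idx_range[of s "fst (idx s)" "snd (idx s)"] by auto

lemma act_deviation_profile:
  "act (deviation_profile s) = (\<lambda>j. if j = fst (idx s) then snd (idx s) + 1 else 1)"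
  unfolding deviation_profile_def
proof (rule act_inv)
  show "(if i = fst (idx s) then snd (idx s) + 1 else 1) \<in> {1..K i}" for i
    using snd_idx[of s] K[of i] by auto
qed

lemma act_deviation_profile_iff:
  "act (deviation_profile s) (fst (idx s')) = snd (idx s') + 1 \<longleftrightarrow> s = s'"
  using snd_idx(1)[of s'] idx_inject[of s s'] by (auto simp: act_deviation_profile prod_eq_iff)

lemma separable_deviation_profile: "separable c $ deviation_profile s = c $ s"
  by (simp add: separable_def act_deviation_profile_iff)

lemma inj_deviation_profile: "inj deviation_profile"
  by (rule injI) (metis act_deviation_profile_iff)

lemma expected_payoff_separable:
  assumes "\<And>j. (\<Sum>k=1..K j. t j k) = 1"
  shows "expected_payoff act (identical_payoffs_game (separable c)) i t =
    (\<Sum>s\<in>UNIV. c $ s * t (fst (idx s)) (snd (idx s) + 1))"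
proof -
  have "expected_payoff act (identical_payoffs_game (separable c)) i t =
     (\<Sum>y\<in>UNIV. \<Sum>s\<in>UNIV. c $ s * ((if act y (fst (idx s)) = snd (idx s) + 1 then 1 else 0) * (\<Prod>j\<in>UNIV. t j (act y j))))"
    by (auto simp: expected_payoff_def identical_payoffs_game_def separable_def sum_distrib_right intro!: sum.cong)
  also have "\<dots> = (\<Sum>s\<in>UNIV. c $ s * (\<Sum>y\<in>UNIV. (if act y (fst (idx s)) = snd (idx s) + 1 then 1 else 0) * (\<Prod>j\<in>UNIV. t j (act y j))))"
    by (subst sum.swap) (simp only: sum_distrib_left)
  also have "\<dots> = (\<Sum>s\<in>UNIV. c $ s * t (fst (idx s)) (snd (idx s) + 1))"
    by (simp only: sum_prod_profiles_marginal[OF assms snd_idx(2)])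
  finally show ?thesis .
qed

text \<open>A pure deviation of player \<open>i\<close> alters only his own marginals, and action
  \<open>1\<close> carries no coefficient.\<close>

lemma payoff_gap_separable: "payoff_gap (separable c) x s = c $ s"
proof -
  obtain i k where ik: "idx s = (i, k)" by force
  define t where "t = (\<lambda>l. (weight K idx x)(i := (\<lambda>m. if m = l then 1 else 0)))"
  have t: "(\<Sum>k=1..K j. t l j k) = 1" if "l \<in> {1..K i}" for j l
    using that by (cases "j = i") (auto simp: t_def sum_weight)
  have k: "k + 1 \<in> {1..K i}" "1 \<in> {1..K i}" using idx_range[OF ik] by auto
  have pu: "pure_utility K act idx (identical_payoffs_game (separable c)) i l x =
      (\<Sum>s'\<in>UNIV. c $ s' * t l (fst (idx s')) (snd (idx s') + 1))" if "l \<in> {1..K i}" for l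
    using expected_payoff_separable[OF t[OF that], of c i] by (simp only: pure_utility_def t_def)
  have "payoff_gap (separable c) x s =
    (\<Sum>s'\<in>UNIV. c $ s' * (t (k + 1) (fst (idx s')) (snd (idx s') + 1) - t 1 (fst (idx s')) (snd (idx s') + 1)))"
    by (simp only: payoff_gap_def ik prod.case pu[OF k(1)] pu[OF k(2)] right_diff_distrib sum_subtractf)
  also have "\<dots> = (\<Sum>s'\<in>UNIV. if s' = s then c $ s' else 0)"
  proof (intro sum.cong refl)
    fix s'
    have "s' = s \<longleftrightarrow> fst (idx s') = i \<and> snd (idx s') = k"
      using idx_inject[of s' s] by (simp add: ik prod_eq_iff)
    then show "c $ s' * (t (k + 1) (fst (idx s')) (snd (idx s') + 1) - t 1 (fst (idx s')) (snd (idx s') + 1)) =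
        (if s' = s then c $ s' else 0)"
      using snd_idx(1)[of s'] by (auto simp: t_def)
  qed
  also have "\<dots> = c $ s" by simp
  finally show ?thesis .
qed

text \<open>
  The payoffs \<open>u\<close> with \<open>payoff_gap u x s = 0\<close> for \<open>s \<in> S\<close>, for some \<open>x\<close> that vanishes off \<open>S\<close>,
  parametrized by as many reals as \<open>u\<close> has: the coordinates at the deviation profiles of \<open>S\<close> hold
  \<open>x\<close>, the others determine \<open>u\<close> up to the separable part that the equations force.
\<close>

definition critical_base :: "real^'y \<Rightarrow> real^'y" where
  "critical_base z = (\<chi> y. if y \<in> range deviation_profile then 0 else z $ y)"

definition critical_point :: "'s set \<Rightarrow> real^'y \<Rightarrow> real^'s" where
  "critical_point S z = (\<chi> s. if s \<in> S then z $ deviation_profile s else 0)"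

definition critical_payoff :: "'s set \<Rightarrow> real^'y \<Rightarrow> real^'y" where
  "critical_payoff S z = critical_base z +
     separable (\<chi> s. if s \<in> S then - payoff_gap (critical_base z) (critical_point S z) s
                     else z $ deviation_profile s)"

lemma critical_payoff_polynomial: "real_polynomial_function (\<lambda>z. critical_payoff S z $ y)"
proof -
  have base: "real_polynomial_function (\<lambda>z. critical_base z $ y)" for y
    by (simp add: critical_base_def real_polynomial_function_if real_polynomial_function.intros(2) real_polynomial_function_vec_nth)
  have "real_polynomial_function (\<lambda>z. critical_point S z $ s)" for s
    by (simp add: critical_point_def real_polynomial_function_if real_polynomial_function.intros(2) real_polynomial_function_vec_nth)
  with base have gap: "real_polynomial_function (\<lambda>z. payoff_gap (critical_base z) (critical_point S z) s)" for s
    by (intro payoff_gap_polynomial)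
  show ?thesis
    unfolding critical_payoff_def separable_def
    by (auto intro!: base gap real_polynomial_function.intros(2,3) real_polynomial_function_sum
        real_polynomial_function_if real_polynomial_function_minus real_polynomial_function_vec_nth)
qed

text \<open>A singular zero \<open>x\<close> of \<open>u\<close> determines the set \<open>S\<close>
  of coordinates with vanishing gradient, one of finitely many, and \<open>x\<close> vanishes off
  \<open>S\<close>. Then \<open>u\<close> is the value of \<open>critical_payoff S\<close> at an
  argument that has a zero coordinate (\<open>Z1 S\<close>) or a singular derivative
  (\<open>Z2 S\<close>).\<close>

lemma negligible_singular_zero_identical:
  "negligible {u. singular_zero K act idx (identical_payoffs_game u)}"
proof -
  have "\<forall>S. \<exists>f'. \<forall>z. (critical_payoff S has_derivative f' z) (at z)"
    by (intro allI polynomial_has_derivative_vec critical_payoff_polynomial)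
  from choice[OF this] obtain \<Phi>' where \<Phi>': "\<And>S z. (critical_payoff S has_derivative \<Phi>' S z) (at z)" by blast
  define Z1 where "Z1 = (\<lambda>S. \<Union>s\<in>S. {z :: real^'y. z $ deviation_profile s = 0})"
  define Z2 where "Z2 = (\<lambda>S. {z :: real^'y. \<exists>v. v \<noteq> 0 \<and> \<Phi>' S z v = 0})"
  have "negligible (critical_payoff S ` Z1 S)" for S
  proof (rule negligible_differentiable_image_negligible)
    show "negligible (Z1 S)"
      unfolding Z1_def by (intro negligible_Union) (auto intro: negligible_standard_hyperplane_cart)
    show "critical_payoff S differentiable_on Z1 S"
      by (intro differentiable_at_imp_differentiable_on differentiableI[OF \<Phi>'])
  qed simp
  moreover have "negligible (critical_payoff S ` Z2 S)" for S
    by (rule negligible_singular_image[OF \<Phi>']) (simp add: Z2_def)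
  ultimately have "negligible (\<Union>S\<in>UNIV. critical_payoff S ` Z1 S \<union> critical_payoff S ` Z2 S)"
    by (intro negligible_Union) auto
  moreover have "u \<in> (\<Union>S\<in>UNIV. critical_payoff S ` Z1 S \<union> critical_payoff S ` Z2 S)"
    if u: "singular_zero K act idx (identical_payoffs_game u)" for u
  proof -
    let ?I = "identical_payoffs_game u :: real^'y^'n"
    obtain x where F0: "Ftilde K act idx ?I x = 0" and w: "\<And>i. weight K idx x i 1 \<noteq> 0"
      and J: "\<not> invertible (jacobian (Ftilde K act idx ?I) (at x))"
      using u unfolding singular_zero_def by blast
    define S where "S = {s. payoff_gap u x s = 0}"
    have xS: "x $ s = 0" if "s \<notin> S" for s
      using F0 that w[of "fst (idx s)"] Ftilde_identical[of u x s] by (simp add: S_def)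
    define c where "c = (\<chi> s. u $ deviation_profile s)"
    define b where "b = u - separable c"
    have b0: "b $ deviation_profile s = 0" for s by (simp add: b_def separable_deviation_profile c_def)
    have gb: "payoff_gap b x' s = payoff_gap u x' s - c $ s" for x' s
      unfolding b_def payoff_gap_diff payoff_gap_separable ..
    define emb where "emb = (\<lambda>(a :: real^'y) (r :: real^'s). \<chi> y. if y \<in> range deviation_profile
        then r $ (inv deviation_profile y) else a $ y)"
    have emb_dev: "emb a r $ deviation_profile s = r $ s" for a r s
      by (simp add: emb_def inv_f_f[OF inj_deviation_profile])
    \<comment> \<open>Off \<open>S\<close> the gradient is not prescribed, so \<open>z\<close>
      stores the separable coefficients \<open>c\<close> of \<open>u\<close> there; on
      \<open>S\<close> they are forced by the equations, and \<open>x\<close> takes their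
      place.\<close>
    define z where "z = emb b (\<chi> s. if s \<in> S then x $ s else c $ s)"
    \<comment> \<open>Moving \<open>z\<close> along \<open>emb 0 v\<close> moves the strategy along
      \<open>v\<close> and keeps the base payoff. Only the coefficients on \<open>S\<close> react,
      by the negated change of the gradient of \<open>u\<close>.\<close>
    have line: "critical_payoff S (z + t *\<^sub>R emb 0 v) =
        b + separable (\<chi> s. if s \<in> S then c $ s - payoff_gap u (x + t *\<^sub>R v) s else c $ s)"
      if v: "\<And>s. s \<notin> S \<Longrightarrow> v $ s = 0" for t v
    proof -
      have base: "critical_base (z + t *\<^sub>R emb 0 v) = b"
        unfolding critical_base_def vec_eq_iff by (auto simp: z_def emb_def b0)
      have point: "critical_point S (z + t *\<^sub>R emb 0 v) = x + t *\<^sub>R v"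
        unfolding critical_point_def vec_eq_iff by (auto simp: z_def emb_dev xS v)
      show ?thesis
        unfolding critical_payoff_def base point gb
        by (intro arg_cong2[of _ _ _ _ "(+)"] arg_cong[of _ _ separable] refl)
          (auto simp: vec_eq_iff z_def emb_dev v)
    qed
    have "critical_payoff S z = u"
    proof -
      have "critical_payoff S z = b + separable (\<chi> s. if s \<in> S then c $ s - payoff_gap u x s else c $ s)"
        using line[of 0 0] by (simp cong: if_cong)
      also have "(\<chi> s. if s \<in> S then c $ s - payoff_gap u x s else c $ s) = c"
        by (auto simp: vec_eq_iff S_def)
      finally show ?thesis by (simp add: b_def)
    qed
    moreover have "z \<in> Z1 S \<union> Z2 S"
    proof (cases "\<exists>s\<in>S. x $ s = 0")
      case True
      then show ?thesis by (auto simp: Z1_def z_def emb_dev)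
    next
      case False
      obtain L :: "'s \<Rightarrow> (real^'y^'n) \<times> (real^'s) \<Rightarrow> real^'s \<Rightarrow> real" where
        L: "\<And>g x. (Ftilde K act idx g has_derivative (\<lambda>v. \<chi> s. L s (g, x) v)) (at x)"
        by (rule Ftilde_has_derivative, rule that)
      obtain v where v0: "v \<noteq> 0" and Lv: "\<And>s. L s (?I, x) v = 0"
        using J unfolding invertible_jacobian_iff[OF L] by (auto simp: vec_eq_iff)
      have "\<forall>s. \<exists>D. ((\<lambda>x. payoff_gap u x s) has_derivative D) (at x)"
        using real_polynomial_function_has_derivative[OF payoff_gap_polynomial[of "\<lambda>x. x" "\<lambda>_. u",
            OF real_polynomial_function_vec_nth real_polynomial_function.intros(2)]] by blast
      from choice[OF this] obtain D where D: "\<And>s. ((\<lambda>x. payoff_gap u x s) has_derivative D s) (at x)" by blast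
      have "\<forall>i. \<exists>W. ((\<lambda>x. weight K idx x i 1) has_derivative W) (at x)"
        using real_polynomial_function_has_derivative[OF weight_polynomial[of "\<lambda>x. x",
            OF real_polynomial_function_vec_nth]] by blast
      from choice[OF this] obtain W where W: "\<And>i. ((\<lambda>x. weight K idx x i 1) has_derivative W i) (at x)" by blast
      have LD: "L s (?I, x) v = weight K idx x (fst (idx s)) 1 * x $ s * D s v +
         (weight K idx x (fst (idx s)) 1 * v $ s + W (fst (idx s)) v * x $ s) * payoff_gap u x s" for s
      proof -
        have "((\<lambda>x. Ftilde K act idx ?I x $ s) has_derivative (\<lambda>v. (\<chi> s. L s (?I, x) v) $ s)) (at x)"
          by (rule bounded_linear.has_derivative[OF bounded_linear_vec_nth L])
        moreover have "((\<lambda>x. x $ s) has_derivative (\<lambda>v. v $ s)) (at x)"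
          by (intro bounded_linear_imp_has_derivative bounded_linear_vec_nth)
        then have "((\<lambda>x. Ftilde K act idx ?I x $ s) has_derivative
           (\<lambda>v. weight K idx x (fst (idx s)) 1 * x $ s * D s v +
         (weight K idx x (fst (idx s)) 1 * v $ s + W (fst (idx s)) v * x $ s) * payoff_gap u x s)) (at x)"
          unfolding Ftilde_identical by (intro has_derivative_mult D W)
        ultimately have "(\<lambda>v. (\<chi> s. L s (?I, x) v) $ s) = (\<lambda>v. weight K idx x (fst (idx s)) 1 * x $ s * D s v +
         (weight K idx x (fst (idx s)) 1 * v $ s + W (fst (idx s)) v * x $ s) * payoff_gap u x s)"
          by (rule has_derivative_unique)
        from fun_cong[OF this, of v] show ?thesis by simp
      qed
      \<comment> \<open>The product rule decouples. Off \<open>S\<close> the entry of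
        \<open>x\<close> is zero and only the term with \<open>v $ s\<close> survives; on
        \<open>S\<close> the gap is zero and only the term with \<open>D s v\<close> survives. The
        remaining factors are nonzero.\<close>
      have vS: "v $ s = 0" if "s \<notin> S" for s
        using LD[of s] Lv[of s] xS[OF that] that w by (simp add: S_def)
      have Dv: "D s v = 0" if "s \<in> S" for s
        using LD[of s] Lv[of s] that w False by (auto simp: S_def)
      \<comment> \<open>The derivative along the line is computed twice, by the chain rule and
        directly; comparing the two exhibits \<open>emb 0 v\<close> as a kernel vector.\<close>
      have "((\<lambda>t. critical_payoff S (z + t *\<^sub>R emb 0 v)) has_derivative (\<lambda>t. \<Phi>' S z (t *\<^sub>R emb 0 v))) (at 0)"
      proof -
        have "((\<lambda>t::real. z + t *\<^sub>R emb 0 v) has_derivative (\<lambda>t. t *\<^sub>R emb 0 v)) (at 0)"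
          by (auto intro!: derivative_eq_intros)
        from has_derivative_compose[OF this, of "critical_payoff S" "\<Phi>' S z"] show ?thesis using \<Phi>' by simp
      qed
      moreover have "((\<lambda>t::real. critical_payoff S (z + t *\<^sub>R emb 0 v)) has_derivative (\<lambda>t. 0)) (at 0)"
      proof -
        have "((\<lambda>t::real. payoff_gap u (x + t *\<^sub>R v) s) has_derivative (\<lambda>t. 0)) (at 0)" if "s \<in> S" for s
        proof -
          have "((\<lambda>t::real. x + t *\<^sub>R v) has_derivative (\<lambda>t. t *\<^sub>R v)) (at 0)"
            by (auto intro!: derivative_eq_intros)
          from has_derivative_compose[OF this, of "\<lambda>x. payoff_gap u x s" "D s"]
          have "((\<lambda>t::real. payoff_gap u (x + t *\<^sub>R v) s) has_derivative (\<lambda>t. D s (t *\<^sub>R v))) (at 0)" using D by simp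
          moreover have "D s (t *\<^sub>R v) = 0" for t
            using Dv[OF that] linear_scale[OF has_derivative_linear[OF D]] by simp
          ultimately show ?thesis by simp
        qed
        then have "((\<lambda>t::real. if s \<in> S then c $ s - payoff_gap u (x + t *\<^sub>R v) s else c $ s) has_derivative (\<lambda>t. 0)) (at 0)" for s
          by (cases "s \<in> S") (auto intro!: derivative_eq_intros)
        then have summand: "((\<lambda>t::real. if act y (fst (idx s)) = snd (idx s) + 1
            then (if s \<in> S then c $ s - payoff_gap u (x + t *\<^sub>R v) s else c $ s) else 0) has_derivative (\<lambda>t. 0)) (at 0)" for y s
          by (cases "act y (fst (idx s)) = snd (idx s) + 1") simp_all
        have "((\<lambda>t::real. \<Sum>s\<in>UNIV. if act y (fst (idx s)) = snd (idx s) + 1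
            then (if s \<in> S then c $ s - payoff_gap u (x + t *\<^sub>R v) s else c $ s) else 0) has_derivative
            (\<lambda>t. \<Sum>s\<in>(UNIV::'s set). 0)) (at 0)" for y
          by (intro has_derivative_sum summand)
        then have "((\<lambda>t::real. b $ y + (\<Sum>s\<in>UNIV. if act y (fst (idx s)) = snd (idx s) + 1
            then (if s \<in> S then c $ s - payoff_gap u (x + t *\<^sub>R v) s else c $ s) else 0)) has_derivative
            (\<lambda>t. 0)) (at 0)" for y
          using has_derivative_add[OF has_derivative_const] by fastforce
        moreover have "critical_payoff S (z + t *\<^sub>R emb 0 v) =
            b + separable (\<chi> s. if s \<in> S then c $ s - payoff_gap u (x + t *\<^sub>R v) s else c $ s)" for t
          by (rule line) (rule vS)
        ultimately show ?thesis by (intro has_derivative_vecI) (simp add: separable_def cong: if_cong)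
      qed
      ultimately have "(\<lambda>t. \<Phi>' S z (t *\<^sub>R emb 0 v)) = (\<lambda>t. 0)" by (rule has_derivative_unique)
      then have "\<Phi>' S z (emb 0 v) = 0" by (metis scaleR_one)
      moreover have "emb 0 v \<noteq> 0"
      proof
        assume "emb 0 v = 0"
        then have "v $ s = 0" for s using emb_dev[of 0 v s] by simp
        then show False using v0 by (simp add: vec_eq_iff)
      qed
      ultimately show ?thesis by (auto simp: Z2_def)
    qed
    ultimately show ?thesis by blast
  qed
  then have "{u. singular_zero K act idx (identical_payoffs_game u)} \<subseteq>
     (\<Union>S\<in>UNIV. critical_payoff S ` Z1 S \<union> critical_payoff S ` Z2 S)" by blast
  ultimately show ?thesis by (rule negligible_subset)
qed

text \<open>Contains the payoffs of all irregular identical-payoffs games. This larger set is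
  invariant under shifts and contains the potential of every irregular potential game.\<close>

definition irregular_payoffs :: "(real^'y) set" where
  "irregular_payoffs = {u. \<exists>r. singular_zero K (reference_act act r) idx (identical_payoffs_game u)}"

lemma negligible_irregular_payoffs: "negligible irregular_payoffs"
proof -
  have "irregular_payoffs = (\<Union>r\<in>UNIV. {u. singular_zero K (reference_act act r) idx (identical_payoffs_game u)})"
    by (auto simp: irregular_payoffs_def)
  moreover have "negligible \<dots>"
  proof (intro negligible_Union)
    fix A assume "A \<in> (\<lambda>r. {u. singular_zero K (reference_act act r) idx (identical_payoffs_game u)}) ` UNIV"
    then obtain r where A: "A = {u. singular_zero K (reference_act act r) idx (identical_payoffs_game u)}" by blast
    interpret ref: game_form K "reference_act act r" idx by (rule game_form_reference)
    show "negligible A" unfolding A by (rule ref.negligible_singular_zero_identical)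
  qed simp
  ultimately show ?thesis by simp
qed

lemma irregular_potential_game:
  assumes "has_potential act g w u" "\<And>i. w i > 0" "\<not> regular_game K act idx g"
  shows "(\<chi> y. u y) \<in> irregular_payoffs"
proof -
  obtain r where r: "singular_zero K (reference_act act r) idx g"
    using irregular_imp_singular_zero[OF assms(3)] by blast
  interpret ref: game_form K "reference_act act r" idx by (rule game_form_reference)
  show ?thesis
    using r ref.singular_zero_potential[OF has_potential_reference[OF assms(1)] assms(2)]
    unfolding irregular_payoffs_def by blast
qed

text \<open>The identical-payoffs game of \<open>u\<close> has \<open>v\<close> as an exact
  potential.\<close>

lemma irregular_payoffs_shift:
  assumes "u \<in> irregular_payoffs" "\<And>y. v $ y = u $ y + c"
  shows "v \<in> irregular_payoffs"
proof -
  obtain r where r: "singular_zero K (reference_act act r) idx (identical_payoffs_game u)"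
    using assms(1) by (auto simp: irregular_payoffs_def)
  interpret ref: game_form K "reference_act act r" idx by (rule game_form_reference)
  have "has_potential (reference_act act r) (identical_payoffs_game u) (\<lambda>_. 1) (\<lambda>y. v $ y)"
    by (auto simp: has_potential_def identical_payoffs_game_def assms(2))
  from ref.singular_zero_potential[OF this] show ?thesis
    using r unfolding irregular_payoffs_def by auto
qed

end


section \<open>Parametrization of potential games\<close>

text \<open>A cylinder over a Borel null superset is null for the product measure, and a linear map
  between spaces of equal dimension glues the two blocks of coordinates.\<close>

lemma negligible_vimage_Inl:
  fixes A :: "(real^'a::finite) set"
  assumes "negligible A"
  shows "negligible {z :: real^('a + 'b::finite). (\<chi> i. z $ Inl i) \<in> A}"
proof -
  obtain N where N: "N \<in> null_sets lborel" "A \<subseteq> N"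
    using assms unfolding negligible_iff_null_sets null_sets_completion_iff2 by blast
  have "N \<times> (UNIV :: (real^'b) set) \<in> null_sets (lborel \<Otimes>\<^sub>M lborel)"
    using N(1) by (auto simp: null_sets_def lborel.emeasure_pair_measure_Times)
  then have "N \<times> (UNIV :: (real^'b) set) \<in> null_sets lborel" by (simp add: lborel_prod)
  then have neg: "negligible (N \<times> (UNIV :: (real^'b) set))"
    by (simp add: negligible_iff_null_sets null_sets_completionI)
  define f :: "(real^'a) \<times> (real^'b) \<Rightarrow> real^('a + 'b)"
    where "f = (\<lambda>p. \<chi> i. case i of Inl a \<Rightarrow> fst p $ a | Inr b \<Rightarrow> snd p $ b)"
  have "linear f"
    by (auto simp: linear_iff f_def vec_eq_iff split: sum.split)
  then have "bounded_linear f" by (simp add: linear_linear)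
  have "negligible (f ` (N \<times> UNIV))"
  proof (rule negligible_differentiable_image_negligible)
    show "f differentiable_on N \<times> UNIV"
      using \<open>bounded_linear f\<close> by (rule bounded_linear_imp_differentiable_on)
  qed (auto simp: neg)
  moreover have "z \<in> f ` (N \<times> UNIV)" if "(\<chi> i. z $ Inl i) \<in> A" for z
  proof (rule image_eqI)
    show "z = f (\<chi> i. z $ Inl i, \<chi> i. z $ Inr i)"
      by (simp add: f_def vec_eq_iff split: sum.split)
    show "(\<chi> i. z $ Inl i, \<chi> i. z $ Inr i) \<in> N \<times> UNIV" using that N(2) by auto
  qed
  then have "{z. (\<chi> i. z $ Inl i) \<in> A} \<subseteq> f ` (N \<times> UNIV)" by blast
  ultimately show ?thesis by (rule negligible_subset)
qed

context game_form
begin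

text \<open>With \<open>k = 1\<close> it selects one representative of the profiles that differ only
  in the action of \<open>i\<close>; payoffs independent of that action are stored at these
  representatives.\<close>

definition switch :: "'y \<Rightarrow> 'n \<Rightarrow> nat \<Rightarrow> 'y" where
  "switch y i k = inv act ((act y)(i := k))"

definition const_profile :: "nat \<Rightarrow> 'y" where
  "const_profile k = inv act (\<lambda>_. k)"

lemma act_switch: "k \<in> {1..K i} \<Longrightarrow> act (switch y i k) = (act y)(i := k)"
  unfolding switch_def using act_range by (intro act_inv) (auto simp del: atLeastAtMost_iff)

lemma one_action: "1 \<in> {1..K i}" and two_action: "2 \<in> {1..K i}"
  using K[of i] by auto

lemmas act_switch1 = act_switch[OF one_action]

lemma act_const_profile1: "act (const_profile 1) = (\<lambda>_. 1)"
  unfolding const_profile_def by (rule act_inv) (rule one_action)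

lemma act_const_profile2: "act (const_profile 2) = (\<lambda>_. 2)"
  unfolding const_profile_def by (rule act_inv) (rule two_action)

lemma switch_cong: "\<forall>j. j \<noteq> i \<longrightarrow> act y j = act y' j \<Longrightarrow> switch y i k = switch y' i k"
  unfolding switch_def by (rule arg_cong[of _ _ "inv act"]) auto

lemma switch_same: "act y i = k \<Longrightarrow> switch y i k = y"
  unfolding switch_def by (simp add: fun_upd_idem inv_f_f inj_def act_inject)

text \<open>
  A vector \<open>z\<close> holds a potential, normalized to \<open>0\<close> at the profile of first actions, the weights of
  the players in \<open>J\<close> (the other weights are \<open>1\<close>) and for each player a payoff that does not depend
  on his own action. The entries outside \<open>params J\<close> are ignored.
\<close>

definition potential_of :: "real^('y + 'n + 'n \<times> 'y) \<Rightarrow> real^'y" where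
  "potential_of z = (\<chi> y. if y = const_profile 1 then 0 else z $ Inl y)"

definition weight_of :: "'n set \<Rightarrow> real^('y + 'n + 'n \<times> 'y) \<Rightarrow> 'n \<Rightarrow> real" where
  "weight_of J z i = (if i \<in> J then z $ Inr (Inl i) else 1)"

definition game_of :: "'n set \<Rightarrow> real^('y + 'n + 'n \<times> 'y) \<Rightarrow> real^'y^'n" where
  "game_of J z = (\<chi> i y. weight_of J z i * potential_of z $ y + z $ Inr (Inr (i, switch y i 1)))"

definition params :: "'n set \<Rightarrow> ('y + 'n + 'n \<times> 'y) set" where
  "params J = Inl ` (- {const_profile 1}) \<union> (Inr \<circ> Inl) ` J \<union> (Inr \<circ> Inr) ` {(i, y). act y i = 1}"

lemma params_iff [simp]:
  "Inl y \<in> params J \<longleftrightarrow> y \<noteq> const_profile 1"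
  "Inr (Inl i) \<in> params J \<longleftrightarrow> i \<in> J"
  "Inr (Inr (i, y)) \<in> params J \<longleftrightarrow> act y i = 1"
  by (auto simp: params_def)

lemma has_potential_game_of:
  "has_potential act (game_of J z) (weight_of J z) (\<lambda>y. potential_of z $ y)"
  unfolding has_potential_def
proof (intro allI impI)
  fix i y y' assume "\<forall>j. j \<noteq> i \<longrightarrow> act y j = act y' j"
  then have "switch y i 1 = switch y' i 1" by (rule switch_cong)
  then show "game_of J z $ i $ y - game_of J z $ i $ y' = weight_of J z i * (potential_of z $ y - potential_of z $ y')"
    by (simp add: game_of_def right_diff_distrib)
qed

lemma game_of_surj:
  assumes pot: "has_potential act g w u" and w: "\<And>i. i \<notin> J \<Longrightarrow> w i = 1"
  obtains z where "game_of J z = g" "potential_of z = (\<chi> y. u y - u (const_profile 1))"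
proof -
  define z :: "real^('y + 'n + 'n \<times> 'y)" where "z = (\<chi> p. case p of Inl y \<Rightarrow> u y - u (const_profile 1)
     | Inr (Inl i) \<Rightarrow> w i | Inr (Inr (i, y)) \<Rightarrow> g $ i $ y - w i * (u y - u (const_profile 1)))"
  have pz: "potential_of z = (\<chi> y. u y - u (const_profile 1))"
    by (simp add: potential_of_def z_def vec_eq_iff)
  have wz: "weight_of J z i = w i" for i using w by (simp add: weight_of_def z_def)
  have "game_of J z $ i $ y = g $ i $ y" for i y
  proof -
    have "\<forall>j. j \<noteq> i \<longrightarrow> act y j = act (switch y i 1) j" by (simp add: act_switch1)
    then have "g $ i $ y - g $ i $ switch y i 1 = w i * (u y - u (switch y i 1))"
      using pot unfolding has_potential_def by blast
    then show ?thesis by (simp add: game_of_def wz pz) (simp add: z_def algebra_simps)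
  qed
  then have "game_of J z = g" by (simp add: vec_eq_iff)
  then show ?thesis using pz that by blast
qed

text \<open>Any two profiles are joined by changing one player at a time, whence the induction on a
  set of players outside which they agree.\<close>

lemma switch_invariant_const:
  assumes inv: "\<And>i y. v (switch y i 1) = v y"
  shows "v y = v z"
proof -
  have "\<forall>y z. (\<forall>j. j \<notin> I \<longrightarrow> act y j = act z j) \<longrightarrow> v y = v z" if "finite I" for I
    using that
  proof (induction I)
    case empty
    then show ?case using act_inject by (auto simp: fun_eq_iff[symmetric])
  next
    case (insert i I)
    show ?case
    proof (intro allI impI)
      fix y z assume yz: "\<forall>j. j \<notin> insert i I \<longrightarrow> act y j = act z j"
      have "\<forall>j. j \<notin> I \<longrightarrow> act (switch y i 1) j = act (switch z i 1) j"
        using yz by (simp add: act_switch1)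
      then have "v (switch y i 1) = v (switch z i 1)" using insert.IH by blast
      then show "v y = v z" by (simp add: inv)
    qed
  qed
  from this[of UNIV] show ?thesis by simp
qed

text \<open>For equal positive weights the two potentials have the same unilateral differences, so
  they differ by a constant, which the normalization makes zero. The weights are assumed equal
  because a separable potential would leave them undetermined.\<close>

lemma game_of_eq_imp:
  assumes eq: "game_of J z = game_of J z'" and w: "weight_of J z = weight_of J z'"
    and pos: "\<And>i. weight_of J z i > 0" and p: "p \<in> params J"
  shows "z $ p = z' $ p"
proof -
  define v where "v = (\<lambda>y. potential_of z $ y - potential_of z' $ y)"
  have "v (switch y i 1) = v y" for i y
  proof -
    have "\<forall>j. j \<noteq> i \<longrightarrow> act y j = act (switch y i 1) j" by (simp add: act_switch1)
    then have "weight_of J z i * (potential_of z $ y - potential_of z $ switch y i 1) =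
       weight_of J z i * (potential_of z' $ y - potential_of z' $ switch y i 1)"
      using has_potential_game_of[of J z] has_potential_game_of[of J z'] unfolding has_potential_def
      by (metis eq w)
    then have "potential_of z $ y - potential_of z $ switch y i 1 =
       potential_of z' $ y - potential_of z' $ switch y i 1" using pos[of i] by simp
    then show ?thesis by (simp add: v_def)
  qed
  then have "v y = v (const_profile 1)" for y by (rule switch_invariant_const)
  then have u: "potential_of z = potential_of z'"
    by (simp add: v_def vec_eq_iff potential_of_def)
  show ?thesis
  proof (cases p)
    case (Inl y)
    then show ?thesis using p u by (auto simp: potential_of_def vec_eq_iff split: if_splits)
  next
    case (Inr q)
    show ?thesis
    proof (cases q)
      case (Inl i)
      then show ?thesis using p Inr fun_cong[OF w, of i] by (simp add: weight_of_def)
    next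
      case (Inr r)
      obtain i y where r: "r = (i, y)" by force
      have "act y i = 1" using p \<open>p = Inr q\<close> \<open>q = Inr r\<close> r by simp
      then have "switch y i 1 = y" by (rule switch_same)
      then show ?thesis using arg_cong[OF eq, of "\<lambda>g. g $ i $ y"] u w \<open>p = Inr q\<close> \<open>q = Inr r\<close> r
        by (simp add: game_of_def)
    qed
  qed
qed

lemma game_of_lipschitz:
  "\<exists>L. \<forall>z z' r. (\<forall>p\<in>params J. \<bar>z $ p\<bar> \<le> R) \<longrightarrow> (\<forall>p\<in>params J. \<bar>z' $ p\<bar> \<le> R) \<longrightarrow>
     (\<forall>p\<in>params J. \<bar>z $ p - z' $ p\<bar> \<le> r) \<longrightarrow> dist (game_of J z) (game_of J z') \<le> L * r"
proof (intro exI allI impI)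
  fix z z' r
  assume z: "\<forall>p\<in>params J. \<bar>z $ p\<bar> \<le> R" and z': "\<forall>p\<in>params J. \<bar>z' $ p\<bar> \<le> R"
    and d: "\<forall>p\<in>params J. \<bar>z $ p - z' $ p\<bar> \<le> r"
  \<comment> \<open>The summand 1 covers the constant weight 1 of the players outside
    \<open>J\<close>.\<close>
  define M where "M = \<bar>R\<bar> + 1"
  \<comment> \<open>Exhibits a coordinate in \<open>params J\<close>, from which
    \<open>r \<ge> 0\<close> follows.\<close>
  obtain i0 :: 'n where True by blast
  have "Inr (Inr (i0, const_profile 1)) \<in> params J" by (simp add: act_const_profile1)
  from order_trans[OF abs_ge_zero bspec[OF d this]] have r: "r \<ge> 0" .
  have w: "\<bar>weight_of J z i\<bar> \<le> M" for i
    using z[rule_format, of "Inr (Inl i)"] by (auto simp: weight_of_def M_def)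
  have wd: "\<bar>weight_of J z i - weight_of J z' i\<bar> \<le> r" for i
    using d r by (simp add: weight_of_def)
  have u: "\<bar>potential_of z' $ y\<bar> \<le> M" for y
    using z'[rule_format, of "Inl y"] by (auto simp: potential_of_def M_def)
  have ud: "\<bar>potential_of z $ y - potential_of z' $ y\<bar> \<le> r" for y
    using d r by (simp add: potential_of_def)
  have hd: "\<bar>z $ Inr (Inr (i, switch y i 1)) - z' $ Inr (Inr (i, switch y i 1))\<bar> \<le> r" for i y
    using d by (simp add: act_switch1)
  have c: "\<bar>game_of J z $ i $ y - game_of J z' $ i $ y\<bar> \<le> (2 * M + 1) * r" for i y
  proof -
    have "game_of J z $ i $ y - game_of J z' $ i $ y =
       weight_of J z i * (potential_of z $ y - potential_of z' $ y) +
       (weight_of J z i - weight_of J z' i) * potential_of z' $ y +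
       (z $ Inr (Inr (i, switch y i 1)) - z' $ Inr (Inr (i, switch y i 1)))"
      by (simp add: game_of_def algebra_simps)
    also have "\<bar>\<dots>\<bar> \<le> \<bar>weight_of J z i\<bar> * \<bar>potential_of z $ y - potential_of z' $ y\<bar> +
       \<bar>weight_of J z i - weight_of J z' i\<bar> * \<bar>potential_of z' $ y\<bar> +
       \<bar>z $ Inr (Inr (i, switch y i 1)) - z' $ Inr (Inr (i, switch y i 1))\<bar>"
      unfolding abs_mult[symmetric] by linarith
    also have "\<dots> \<le> M * r + r * M + r"
      by (intro add_mono mult_mono w wd u ud hd) (auto simp: M_def r)
    finally show ?thesis by (simp add: algebra_simps)
  qed
  have "dist (game_of J z) (game_of J z') \<le> (\<Sum>i\<in>UNIV. dist (game_of J z $ i) (game_of J z' $ i))"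
    unfolding dist_vec_def by (rule L2_set_le_sum) simp
  also have "\<dots> \<le> (\<Sum>i\<in>(UNIV::'n set). \<Sum>y\<in>(UNIV::'y set). (2 * M + 1) * r)"
  proof (rule sum_mono)
    fix i
    have "dist (game_of J z $ i) (game_of J z' $ i) \<le> (\<Sum>y\<in>UNIV. dist (game_of J z $ i $ y) (game_of J z' $ i $ y))"
      unfolding dist_vec_def by (rule L2_set_le_sum) simp
    also have "\<dots> \<le> (\<Sum>y\<in>(UNIV::'y set). (2 * M + 1) * r)"
      using c by (intro sum_mono) (simp add: dist_real_def)
    finally show "dist (game_of J z $ i) (game_of J z' $ i) \<le> (\<Sum>y\<in>(UNIV::'y set). (2 * M + 1) * r)" .
  qed
  also have "\<dots> = (real CARD('n) * real CARD('y) * (2 * (\<bar>R\<bar> + 1) + 1)) * r" by (simp add: M_def)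
  finally show "dist (game_of J z) (game_of J z') \<le> (real CARD('n) * real CARD('y) * (2 * (\<bar>R\<bar> + 1) + 1)) * r" .
qed

text \<open>Irregularity is invariant under shifts of the payoffs, so the normalization costs no measure.\<close>

lemma negligible_potential_irregular:
  "negligible {z. potential_of z \<in> irregular_payoffs}"
proof -
  let ?a = "const_profile 1"
  define A where "A = {v :: real^'y. (\<chi> y. if y = ?a then 0 else v $ y) \<in> irregular_payoffs}"
  \<comment> \<open>\<open>potential_of\<close> ignores the entry at \<open>?a\<close>. That entry
    is used to record the size of the shift, so that \<open>A\<close> lies in a linear image of
    \<open>irregular_payoffs\<close> within the same space.\<close>
  define L :: "real^'y \<Rightarrow> real^'y" where "L = (\<lambda>v. \<chi> y. if y = ?a then v $ y else v $ y - v $ ?a)"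
  have "linear L" by (auto simp: linear_iff L_def vec_eq_iff algebra_simps)
  then have "negligible (L ` irregular_payoffs)"
    by (intro negligible_differentiable_image_negligible negligible_irregular_payoffs
        bounded_linear_imp_differentiable_on) (simp_all add: linear_linear)
  moreover have "A \<subseteq> L ` irregular_payoffs"
  proof
    fix v assume v: "v \<in> A"
    define m where "m = (\<chi> y. if y = ?a then v $ ?a else v $ y + v $ ?a)"
    have "m \<in> irregular_payoffs"
      using v unfolding A_def mem_Collect_eq
      by (rule irregular_payoffs_shift[where c = "v $ ?a"]) (simp add: m_def)
    moreover have "v = L m" by (simp add: L_def m_def vec_eq_iff)
    ultimately show "v \<in> L ` irregular_payoffs" by blast
  qed
  ultimately have "negligible A" by (rule negligible_subset)
  then have "negligible {z :: real^('y + 'n + 'n \<times> 'y). (\<chi> y. z $ Inl y) \<in> A}"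
    by (rule negligible_vimage_Inl)
  then show ?thesis by (simp add: A_def potential_of_def cong: if_cong)
qed

text \<open>Every \<open>m\<close> from the number of effective parameters upwards is allowed, so a
  lower bound for the dimension of the class is enough to apply this.\<close>

lemma hausdorff_irregular_potential_games:
  assumes m: "card (params J) \<le> m"
  shows "hausdorff_measure m {g. \<exists>w u. has_potential act g w u \<and> (\<forall>i. w i > 0) \<and> (\<forall>i. i \<notin> J \<longrightarrow> w i = 1) \<and>
     \<not> regular_game K act idx g} = 0"
proof (rule hausdorff_measure_subset_0)
  show "hausdorff_measure m (game_of J ` {z. potential_of z \<in> irregular_payoffs}) = 0"
  proof (rule hausdorff_measure_image_negligible_cylinder[where D = "params J"])
    fix z z' assume z: "z \<in> {z. potential_of z \<in> irregular_payoffs}" "\<forall>p\<in>params J. z' $ p = z $ p"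
    then have "potential_of z' = potential_of z" by (simp add: potential_of_def vec_eq_iff)
    then show "z' \<in> {z. potential_of z \<in> irregular_payoffs}" using z by simp
  next
    have "Inr (Inr (i, const_profile 1)) \<in> params J" for i by (simp add: act_const_profile1)
    then show "params J \<noteq> {}" by blast
  qed (rule negligible_potential_irregular m game_of_lipschitz)+
  show "{g. \<exists>w u. has_potential act g w u \<and> (\<forall>i. w i > 0) \<and> (\<forall>i. i \<notin> J \<longrightarrow> w i = 1) \<and> \<not> regular_game K act idx g}
     \<subseteq> game_of J ` {z. potential_of z \<in> irregular_payoffs}"
  proof clarify
    fix g w u assume g: "has_potential act g w u" "\<forall>i. w i > 0" "\<forall>i. i \<notin> J \<longrightarrow> w i = 1"
      "\<not> regular_game K act idx g"
    obtain z where z: "game_of J z = g" "potential_of z = (\<chi> y. u y - u (const_profile 1))"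
      using game_of_surj[OF g(1), of J] g(3) by blast
    have "has_potential act g w (\<lambda>y. u y - u (const_profile 1))"
      using g(1) by (simp add: has_potential_def)
    from irregular_potential_game[OF this] have "potential_of z \<in> irregular_payoffs"
      using g z by simp
    then show "g \<in> game_of J ` {z. potential_of z \<in> irregular_payoffs}" using z(1) by blast
  qed
qed

text \<open>With all weights equal to 1 the parametrization is linear, and it is injective on the
  coordinate subspace of \<open>params {}\<close>.\<close>

lemma card_params_le_dim_exact: "card (params {}) \<le> dim (exact_potential_games act)"
proof -
  define V where "V = {z :: real^('y + 'n + 'n \<times> 'y). \<forall>p. p \<notin> params {} \<longrightarrow> z $ p = 0}"
  have lin: "linear (game_of {})"
    by (auto simp: linear_iff game_of_def weight_of_def potential_of_def vec_eq_iff algebra_simps)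
  have "subspace V" by (auto simp: V_def subspace_def)
  then have span: "span V = V" by (simp add: span_eq_iff)
  have "inj_on (game_of {}) V"
  proof (rule inj_onI)
    fix z z' assume z: "z \<in> V" "z' \<in> V" "game_of {} z = game_of {} z'"
    have "z $ p = z' $ p" for p
    proof (cases "p \<in> params {}")
      case True
      with z(3) show ?thesis by (intro game_of_eq_imp) (auto simp: weight_of_def)
    next
      case False
      then show ?thesis using z by (simp add: V_def)
    qed
    then show "z = z'" by (simp add: vec_eq_iff)
  qed
  then have "dim (game_of {} ` V) = dim V" by (intro dim_image_eq[OF lin]) (simp only: span)
  also have "dim V = card (params {})"
    unfolding V_def dim_vec_eq[symmetric] by (rule dim_substandard_cart)
  finally have "card (params {}) = dim (game_of {} ` V)" ..
  also have "\<dots> \<le> dim (exact_potential_games act)"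
  proof (rule dim_subset)
    have "weight_of {} z = (\<lambda>_. 1)" for z by (simp add: weight_of_def fun_eq_iff)
    then show "game_of {} ` V \<subseteq> exact_potential_games act"
      using has_potential_game_of[of "{}"] by (auto simp: exact_potential_games_def)
  qed
  finally show ?thesis .
qed

end


section \<open>The dimension of the set of weighted potential games\<close>

lemma semialgebraic_Int:
  assumes "semialgebraic A" "semialgebraic B" shows "semialgebraic (A \<inter> B)"
proof -
  have "semialgebraic (- (- A \<union> - B))" by (intro semialgebraic.Compl semialgebraic.Un assms)
  then show ?thesis by simp
qed

lemma semialgebraic_UNIV: "semialgebraic UNIV"
  using semialgebraic.pos[of "\<lambda>_. 1"] real_polynomial_function.intros(2)[of 1] by simp

lemma semialgebraic_INT:
  "finite I \<Longrightarrow> (\<And>i. i \<in> I \<Longrightarrow> semialgebraic (A i)) \<Longrightarrow> semialgebraic (\<Inter>i\<in>I. A i)"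
  by (induction I rule: finite_induct) (auto intro: semialgebraic_UNIV semialgebraic_Int)

lemma semialgebraic_zero:
  assumes "real_polynomial_function p" shows "semialgebraic {x. p x = 0}"
proof -
  have "semialgebraic (- {x. p x > 0} \<inter> - {x. - p x > 0})"
    by (intro semialgebraic_Int semialgebraic.Compl semialgebraic.pos assms real_polynomial_function_minus)
  moreover have "- {x. p x > 0} \<inter> - {x. - p x > 0} = {x. p x = 0}" by auto
  ultimately show ?thesis by simp
qed

lemma semialgebraic_polynomial_graph:
  fixes f :: "'a::euclidean_space \<Rightarrow> 'a"
  assumes D: "D \<subseteq> Basis" and f: "\<And>b. b \<in> Basis \<Longrightarrow> real_polynomial_function (\<lambda>x. f x \<bullet> b)"
  shows "semialgebraic ((\<lambda>x. (x, f x)) ` open_cube D)"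
proof -
  have fstp: "real_polynomial_function (\<lambda>z :: 'a \<times> 'a. fst z \<bullet> b)" for b
    by (intro real_polynomial_function.intros(1) bounded_linear_inner_left_comp bounded_linear_fst)
  have sndp: "real_polynomial_function (\<lambda>z :: 'a \<times> 'a. snd z \<bullet> b)" for b
    by (intro real_polynomial_function.intros(1) bounded_linear_inner_left_comp bounded_linear_snd)
  have "polynomial_function (fst :: 'a \<times> 'a \<Rightarrow> 'a)"
    unfolding polynomial_function_iff_Basis_inner using fstp by blast
  from real_polynomial_function_compose[OF this f]
  have ffp: "real_polynomial_function (\<lambda>z :: 'a \<times> 'a. f (fst z) \<bullet> b)" if "b \<in> Basis" for b
    using that by (simp add: comp_def)
  have "(\<lambda>x. (x, f x)) ` open_cube D =
      (\<Inter>b\<in>D. {z. fst z \<bullet> b > 0} \<inter> {z. 1 - fst z \<bullet> b > 0}) \<inter> (\<Inter>b\<in>Basis - D. {z. fst z \<bullet> b = 0}) \<inter>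
      (\<Inter>b\<in>Basis. {z. snd z \<bullet> b - f (fst z) \<bullet> b = 0})" (is "?l = ?r")
  proof (rule set_eqI)
    fix z
    have "z \<in> ?l \<longleftrightarrow> fst z \<in> open_cube D \<and> snd z = f (fst z)" by (cases z) auto
    also have "\<dots> \<longleftrightarrow> z \<in> ?r"
      by (subst euclidean_eq_iff) (auto simp: open_cube_def)
    finally show "z \<in> ?l \<longleftrightarrow> z \<in> ?r" .
  qed
  moreover have "semialgebraic ?r"
    using finite_subset[OF D finite_Basis]
    by (intro semialgebraic_Int semialgebraic_INT semialgebraic.pos semialgebraic_zero
        real_polynomial_function_diff real_polynomial_function.intros(2) fstp sndp ffp) auto
  ultimately show ?thesis by simp
qed

text \<open>Injectivity is asked on the closed cube, because compactness then makes the inverse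
  continuous; on the open cube alone this could fail.\<close>

lemma card_le_semialgebraic_dim:
  fixes f :: "'a::euclidean_space \<Rightarrow> 'a"
  defines "cube \<equiv> \<lambda>D. {x. (\<forall>b\<in>D. 0 \<le> x \<bullet> b \<and> x \<bullet> b \<le> 1) \<and> (\<forall>b\<in>Basis - D. x \<bullet> b = 0)}"
  assumes D: "D \<subseteq> Basis" and f: "\<And>b. b \<in> Basis \<Longrightarrow> real_polynomial_function (\<lambda>x. f x \<bullet> b)"
    and inj: "inj_on f (cube D)" and A: "f ` open_cube D \<subseteq> A"
  shows "card D \<le> semialgebraic_dim A"
proof -
  have "compact (cube D)"
  proof -
    have "cube D = cbox 0 (\<Sum>b\<in>D. b)"
    proof (rule set_eqI)
      fix x
      have "(\<Sum>b\<in>D. b) \<bullet> b = (if b \<in> D then 1 else 0)" if "b \<in> Basis" for b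
        using D that finite_subset[OF D finite_Basis]
        by (auto simp: inner_sum_left inner_Basis subset_iff if_distrib cong: if_cong intro!: sum.neutral)
      then have "x \<in> cbox 0 (\<Sum>b\<in>D. b) \<longleftrightarrow> (\<forall>b\<in>Basis. 0 \<le> x \<bullet> b \<and> x \<bullet> b \<le> (if b \<in> D then 1 else 0))"
        by (simp add: mem_box)
      also have "\<dots> \<longleftrightarrow> (\<forall>b\<in>D \<union> (Basis - D). 0 \<le> x \<bullet> b \<and> x \<bullet> b \<le> (if b \<in> D then 1 else 0))"
        using D by (simp add: Un_absorb1)
      also have "\<dots> \<longleftrightarrow> x \<in> cube D"
        unfolding cube_def ball_Un by (simp add: order_eq_iff conj_commute)
      finally show "x \<in> cube D \<longleftrightarrow> x \<in> cbox 0 (\<Sum>b\<in>D. b)" by simp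
    qed
    then show ?thesis by simp
  qed
  moreover have "continuous_on (cube D) f"
    using f by (subst continuous_on_componentwise) (auto intro: real_polynomial_function_continuous_on)
  ultimately obtain h where h: "homeomorphism (cube D) (f ` cube D) f h"
    using homeomorphism_compact inj by blast
  have "open_cube D \<subseteq> cube D" by (auto simp: open_cube_def cube_def less_imp_le)
  then have "homeomorphism (open_cube D) (f ` open_cube D) f h"
    by (intro homeomorphism_of_subsets[OF h]) auto
  then have "card D \<in> {card D |D :: 'a set. D \<subseteq> Basis \<and>
       (\<exists>C f h. C \<subseteq> A \<and> homeomorphism (open_cube D) C f h \<and>
                semialgebraic ((\<lambda>x. (x, f x)) ` open_cube D))}"
    using D A semialgebraic_polynomial_graph[OF D f] by blast
  moreover have "finite {card D |D :: 'a set. D \<subseteq> Basis \<and>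
       (\<exists>C f h. C \<subseteq> A \<and> homeomorphism (open_cube D) C f h \<and>
                semialgebraic ((\<lambda>x. (x, f x)) ` open_cube D))}"
    by (rule finite_subset[of _ "card ` Pow Basis"]) auto
  ultimately show ?thesis unfolding semialgebraic_dim_def by (rule Max_ge[rotated])
qed

context game_form
begin

lemma game_of_in_weighted_potential_games:
  assumes "\<And>i. weight_of J z i > 0" shows "game_of J z \<in> weighted_potential_games act"
  unfolding weighted_potential_games_def mem_Collect_eq
  by (intro exI[of _ "weight_of J z"] exI[of _ "\<lambda>y. potential_of z $ y"] conjI allI assms has_potential_game_of)

text \<open>The cubes in \<open>semialgebraic_dim\<close> live in the ambient space of games, so the
  parameters have to be matched injectively with its coordinates
  \<open>'n \<times> 'y\<close>.\<close>

lemma params_embedding: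
  "\<exists>\<phi> :: 'y + 'n + 'n \<times> 'y \<Rightarrow> 'n \<times> 'y. inj_on \<phi> (params (- {i0}))"
proof -
  \<comment> \<open>A profile other than that of first actions is paired with a player who does not
    play \<open>1\<close>, which avoids the pairs \<open>(i, y)\<close> with
    \<open>act y i = 1\<close>. Preferring \<open>i0\<close> leaves
    \<open>(i, const_profile 2)\<close> free for the weight of each
    \<open>i \<noteq> i0\<close>.\<close>
  define e where "e = (\<lambda>y. if act y i0 \<noteq> 1 then i0 else (SOME i. act y i \<noteq> 1))"
  define \<phi> where "\<phi> = (\<lambda>p. case p of Inl y \<Rightarrow> (e y, y) | Inr (Inl i) \<Rightarrow> (i, const_profile 2) | Inr (Inr q) \<Rightarrow> q)"
  have e: "act y (e y) = 1 \<longleftrightarrow> y = const_profile 1" for y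
  proof (cases "y = const_profile 1")
    case False
    have "\<exists>i. act y i \<noteq> 1"
    proof (rule ccontr)
      assume "\<not> ?thesis"
      then have "act y = act (const_profile 1)" by (simp add: act_const_profile1 fun_eq_iff)
      then show False using False by (simp add: act_inject)
    qed
    from someI_ex[OF this] show ?thesis using False by (simp add: e_def)
  qed (simp add: act_const_profile1)
  have e2: "e (const_profile 2) = i0" by (simp add: e_def act_const_profile2)
  define \<psi> where "\<psi> = (\<lambda>(i, y). if act y i = 1 then Inr (Inr (i, y))
     else if y = const_profile 2 \<and> i \<noteq> i0 then Inr (Inl i) else Inl y)"
  have "inj_on \<phi> (params (- {i0}))"
  proof (rule inj_on_inverseI[of _ \<psi>])
    fix p assume p: "p \<in> params (- {i0})"
    consider y where "p = Inl y" | i where "p = Inr (Inl i)" | i y where "p = Inr (Inr (i, y))"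
      by (metis sum.exhaust surj_pair)
    then show "\<psi> (\<phi> p) = p"
    proof cases
      case (1 y)
      then have "act y (e y) \<noteq> 1" using p e by simp
      then show ?thesis using 1 e2 by (auto simp: \<phi>_def \<psi>_def)
    next
      case (2 i)
      then have "i \<noteq> i0" using p by simp
      then show ?thesis using 2 by (simp add: \<phi>_def \<psi>_def act_const_profile2)
    next
      case (3 i y)
      then show ?thesis using p by (simp add: \<phi>_def \<psi>_def)
    qed
  qed
  then show ?thesis by blast
qed

lemma card_params_le_semialgebraic_dim:
  "card (params (- {i0})) \<le> semialgebraic_dim (weighted_potential_games act)"
proof -
  let ?J = "- {i0}" and ?one = "const_profile 1" and ?two = "const_profile 2"
  obtain \<phi> :: "'y + 'n + 'n \<times> 'y \<Rightarrow> 'n \<times> 'y" where \<phi>: "inj_on \<phi> (params ?J)"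
    using params_embedding by blast
  define ax :: "'n \<times> 'y \<Rightarrow> real^'y^'n" where "ax = (\<lambda>(i, y). axis i (axis y 1))"
  have ax: "x \<bullet> ax q = x $ fst q $ snd q" for x q
    by (simp add: ax_def inner_axis split: prod.split)
  have "inj ax"
    by (auto simp: inj_def ax_def axis_eq_axis split: prod.splits)
  have axB: "ax q \<in> Basis" for q
    by (auto simp: ax_def Basis_vec_def split: prod.split)
  define D where "D = ax ` \<phi> ` params ?J"
  have card: "card D = card (params ?J)"
    unfolding D_def using \<phi> \<open>inj ax\<close> by (simp add: card_image inj_on_subset[OF _ subset_UNIV])
  \<comment> \<open>Each parameter ranges over a unit interval. The offset 1 keeps the weights
    positive on the closed cube. The offset 10 lets the entry at \<open>?two\<close> outweigh two
    others of at most 1, so that \<open>\<Delta> \<ge> 8\<close> below; any offset above 2 would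
    do.\<close>
  define z where "z = (\<lambda>x :: real^'y^'n. \<chi> p. (if p = Inl ?two then 10 else if p \<in> range (Inr \<circ> Inl) then 1 else 0) +
     (if p \<in> params ?J then x \<bullet> ax (\<phi> p) else 0))"
  define cube where "cube = {x. (\<forall>b\<in>D. 0 \<le> x \<bullet> b \<and> x \<bullet> b \<le> 1) \<and> (\<forall>b\<in>Basis - D. x \<bullet> b = 0)}"
  have two: "?two \<noteq> ?one"
  proof
    assume "?two = ?one"
    then have "act ?two i0 = act ?one i0" by simp
    then show False by (simp add: act_const_profile1 act_const_profile2)
  qed
  have cube: "0 \<le> x \<bullet> ax (\<phi> p) \<and> x \<bullet> ax (\<phi> p) \<le> 1" if "x \<in> cube" "p \<in> params ?J" for x p
    using that by (auto simp: cube_def D_def)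
  have wp: "weight_of ?J (z x) i > 0" if "x \<in> cube" for x i
    using cube[OF that, of "Inr (Inl i)"] by (auto simp: weight_of_def z_def)
  have small: "0 \<le> potential_of (z x) $ y \<and> potential_of (z x) $ y \<le> 1" if "x \<in> cube" "y \<noteq> ?two" for x y
    using cube[OF that(1), of "Inl y"] that(2) by (auto simp: potential_of_def z_def)
  have big: "potential_of (z x) $ ?two \<ge> 10" if "x \<in> cube" for x
    using cube[OF that, of "Inl ?two"] two by (auto simp: potential_of_def z_def)
  have "card D \<le> semialgebraic_dim (weighted_potential_games act)"
  proof (rule card_le_semialgebraic_dim[where f = "\<lambda>x. game_of ?J (z x)"])
    show "D \<subseteq> Basis" using axB by (auto simp: D_def)
    show "real_polynomial_function (\<lambda>x. game_of ?J (z x) \<bullet> b)" if bB: "b \<in> Basis" for b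
    proof -
      have zp: "real_polynomial_function (\<lambda>x. z x $ p)" for p
        unfolding z_def vec_lambda_beta
        by (intro real_polynomial_function.intros(2,3) real_polynomial_function_if
          real_polynomial_function.intros(1) bounded_linear_inner_left)
      obtain i y where b: "b = ax (i, y)" using bB by (auto simp: Basis_vec_def ax_def)
      have "real_polynomial_function (\<lambda>x. game_of ?J (z x) $ i $ y)"
        unfolding game_of_def weight_of_def potential_of_def vec_lambda_beta
        by (intro real_polynomial_function.intros(2-4) real_polynomial_function_if zp)
      then show ?thesis by (simp add: b ax)
    qed
    have "open_cube D \<subseteq> cube" by (auto simp: open_cube_def cube_def less_imp_le)
    then show "(\<lambda>x. game_of ?J (z x)) ` open_cube D \<subseteq> weighted_potential_games act"
      using wp by (auto intro!: game_of_in_weighted_potential_games)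
    show "inj_on (\<lambda>x. game_of ?J (z x)) {x. (\<forall>b\<in>D. 0 \<le> x \<bullet> b \<and> x \<bullet> b \<le> 1) \<and> (\<forall>b\<in>Basis - D. x \<bullet> b = 0)}"
      unfolding cube_def[symmetric]
    proof (rule inj_onI)
      fix x x' assume x: "x \<in> cube" "x' \<in> cube" and eq: "game_of ?J (z x) = game_of ?J (z x')"
      let ?u = "\<lambda>y. potential_of (z x) $ y" and ?u' = "\<lambda>y. potential_of (z x') $ y"
      have pot: "weight_of ?J (z x) i * (?u y - ?u y') = weight_of ?J (z x') i * (?u' y - ?u' y')"
        if "\<forall>j. j \<noteq> i \<longrightarrow> act y j = act y' j" for i y y'
        using that has_potential_game_of[of ?J "z x"] has_potential_game_of[of ?J "z x'"]
        unfolding has_potential_def eq by metis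
      text \<open>
        Player \<open>i0\<close> has weight \<open>1\<close>, so the cross difference of the potential in the directions of
        \<open>i\<close> and \<open>i0\<close> is determined by his payoffs; the payoffs of \<open>i\<close> multiply it by his weight.
      \<close>
      have weq: "weight_of ?J (z x) i = weight_of ?J (z x') i" for i
      proof (cases "i = i0")
        case True
        then show ?thesis by (simp add: weight_of_def)
      next
        case False
        define b where "b = switch ?two i 1"
        define c where "c = switch ?two i0 1"
        define d where "d = switch b i0 1"
        have acts: "act b = (\<lambda>_. 2)(i := 1)" "act c = (\<lambda>_. 2)(i0 := 1)" "act d = (\<lambda>_. 2)(i := 1, i0 := 1)"
          by (simp_all add: b_def c_def d_def act_switch1 act_const_profile2)
        have "act b i \<noteq> act ?two i" "act c i0 \<noteq> act ?two i0" "act d i0 \<noteq> act ?two i0"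
          by (simp_all add: acts act_const_profile2)
        then have ne: "b \<noteq> ?two" "c \<noteq> ?two" "d \<noteq> ?two" by auto
        have w0: "weight_of ?J (z x) i0 = 1" "weight_of ?J (z x') i0 = 1" by (simp_all add: weight_of_def)
        have 1: "?u ?two - ?u c = ?u' ?two - ?u' c" "?u b - ?u d = ?u' b - ?u' d"
          using pot[of i0 ?two c] pot[of i0 b d] by (simp_all add: w0 acts act_const_profile2)
        have 2: "weight_of ?J (z x) i * (?u ?two - ?u b) = weight_of ?J (z x') i * (?u' ?two - ?u' b)"
          "weight_of ?J (z x) i * (?u c - ?u d) = weight_of ?J (z x') i * (?u' c - ?u' d)"
          by (rule pot; use False in \<open>simp add: acts act_const_profile2\<close>)+
        define \<Delta> where "\<Delta> = (?u ?two - ?u b) - (?u c - ?u d)"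
        have \<Delta>': "\<Delta> = (?u' ?two - ?u' b) - (?u' c - ?u' d)" using 1 by (simp add: \<Delta>_def)
        have "weight_of ?J (z x) i * \<Delta> =
            weight_of ?J (z x) i * (?u ?two - ?u b) - weight_of ?J (z x) i * (?u c - ?u d)"
          by (simp add: \<Delta>_def right_diff_distrib)
        also have "\<dots> = weight_of ?J (z x') i * (?u' ?two - ?u' b) - weight_of ?J (z x') i * (?u' c - ?u' d)"
          by (simp only: 2)
        also have "\<dots> = weight_of ?J (z x') i * \<Delta>"
          unfolding \<Delta>' by (simp add: right_diff_distrib)
        finally have "weight_of ?J (z x) i * \<Delta> = weight_of ?J (z x') i * \<Delta>" .
        moreover have "\<Delta> > 0"
          using big[OF x(1)] small[OF x(1) ne(1)] small[OF x(1) ne(2)] small[OF x(1) ne(3)]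
          unfolding \<Delta>_def by linarith
        ultimately show ?thesis by simp
      qed
      have zeq: "z x $ p = z x' $ p" if "p \<in> params ?J" for p
        using eq _ wp[OF x(1)] that by (rule game_of_eq_imp) (simp add: weq fun_eq_iff)
      show "x = x'"
      proof (rule euclidean_eqI)
        fix b :: "real^'y^'n" assume b: "b \<in> Basis"
        show "x \<bullet> b = x' \<bullet> b"
        proof (cases "b \<in> D")
          case True
          then obtain p where "p \<in> params ?J" "b = ax (\<phi> p)" by (auto simp: D_def)
          then show ?thesis using zeq[of p] by (simp add: z_def)
        next
          case False
          then show ?thesis using x b by (simp add: cube_def)
        qed
      qed
    qed
  qed
  then show ?thesis by (simp add: card)
qed

end

theorem theorem1:
  fixes K :: "'n::finite \<Rightarrow> nat"
    and act :: "'y::finite \<Rightarrow> 'n \<Rightarrow> nat"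
    and idx :: "'s::finite \<Rightarrow> 'n \<times> nat"
  assumes "\<forall>i. K i \<ge> 2"
    and "profile_labelling K act"
    and "coordinate_labelling K idx"
  shows
    "(let W = weighted_potential_games act; irregular = {g \<in> W. \<not> regular_game K act idx g} in
        closedin (top_of_set W) irregular \<and>
        hausdorff_measure (semialgebraic_dim W) irregular = 0) \<and>
     (let P = exact_potential_games act; irregular = {g \<in> P. \<not> regular_game K act idx g} in
        closedin (top_of_set P) irregular \<and>
        irregular \<in> null_sets (subspace_lebesgue P)) \<and>
     (let irregular = {u :: real^'y. \<not> regular_game K act idx (identical_payoffs_game u)} in
        closed irregular \<and>
        irregular \<in> null_sets lebesgue)"
proof -
  interpret game_form K act idx using assms by unfold_locales auto
  let ?W = "weighted_potential_games act" and ?P = "exact_potential_games act"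
  let ?I = "{g. \<not> regular_game K act idx g}"
  have Int: "{g \<in> A. \<not> regular_game K act idx g} = A \<inter> ?I" for A by auto
  have closedin: "closedin (top_of_set A) {g \<in> A. \<not> regular_game K act idx g}" for A
    unfolding Int by (rule closedin_closed_Int[OF closed_irregular])

  obtain i0 :: 'n where True by blast
  have W: "hausdorff_measure (semialgebraic_dim ?W) {g \<in> ?W. \<not> regular_game K act idx g} = 0"
  proof (rule hausdorff_measure_subset_0)
    show "hausdorff_measure (semialgebraic_dim ?W) {g. \<exists>w u. has_potential act g w u \<and> (\<forall>i. w i > 0) \<and>
        (\<forall>i. i \<notin> - {i0} \<longrightarrow> w i = 1) \<and> \<not> regular_game K act idx g} = 0"
      by (intro hausdorff_irregular_potential_games card_params_le_semialgebraic_dim)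
    show "{g \<in> ?W. \<not> regular_game K act idx g} \<subseteq> {g. \<exists>w u. has_potential act g w u \<and> (\<forall>i. w i > 0) \<and>
        (\<forall>i. i \<notin> - {i0} \<longrightarrow> w i = 1) \<and> \<not> regular_game K act idx g}"
    proof
      fix g assume g: "g \<in> {g \<in> ?W. \<not> regular_game K act idx g}"
      then obtain w u where w: "\<And>i. w i > 0" and pot: "has_potential act g w u"
        by (auto simp: weighted_potential_games_def)
      have w0: "w i0 \<noteq> 0" using w[of i0] by simp
      \<comment> \<open>Dividing the weights and multiplying the potential by the same factor leaves
        the game unchanged. This freedom gives \<open>i0\<close> weight 1; otherwise one parameter
        too many would be counted.\<close>
      have "w i / w i0 * (w i0 * a - w i0 * b) = w i * (a - b)" for i a b
        using w0 by (simp add: field_simps)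
      then have "has_potential act g (\<lambda>i. w i / w i0) (\<lambda>y. w i0 * u y)"
        using pot unfolding has_potential_def by simp
      moreover have "\<forall>i. w i / w i0 > 0" "\<forall>i. i \<notin> - {i0} \<longrightarrow> w i / w i0 = 1" using w w0 by auto
      ultimately show "g \<in> {g. \<exists>w u. has_potential act g w u \<and> (\<forall>i. w i > 0) \<and>
        (\<forall>i. i \<notin> - {i0} \<longrightarrow> w i = 1) \<and> \<not> regular_game K act idx g}"
        using g unfolding mem_Collect_eq by (intro exI[of _ "\<lambda>i. w i / w i0"] exI[of _ "\<lambda>y. w i0 * u y"] conjI) auto
    qed
  qed

  \<comment> \<open>All weights are 1 here, so \<open>J\<close> is empty, and the Hausdorff estimate
    in dimension \<open>dim ?P\<close> is converted to Lebesgue measure.\<close>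
  have "{g \<in> ?P. \<not> regular_game K act idx g} \<in> null_sets (subspace_lborel ?P)"
  proof (rule hausdorff_measure_0_imp_subspace_lborel_0[OF subspace_exact_potential_games])
    have "closed ({g \<in> ?P. \<not> regular_game K act idx g})"
      unfolding Int by (intro closed_Int closed_irregular closed_subspace subspace_exact_potential_games)
    then show "{g \<in> ?P. \<not> regular_game K act idx g} \<in> sets borel" by (rule borel_closed)
    show "hausdorff_measure (dim ?P) {g \<in> ?P. \<not> regular_game K act idx g} = 0"
    proof (rule hausdorff_measure_subset_0)
      show "hausdorff_measure (dim ?P) {g. \<exists>w u. has_potential act g w u \<and> (\<forall>i. w i > 0) \<and>
          (\<forall>i. i \<notin> {} \<longrightarrow> w i = 1) \<and> \<not> regular_game K act idx g} = 0"
        by (intro hausdorff_irregular_potential_games card_params_le_dim_exact)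
      show "{g \<in> ?P. \<not> regular_game K act idx g} \<subseteq> {g. \<exists>w u. has_potential act g w u \<and> (\<forall>i. w i > 0) \<and>
          (\<forall>i. i \<notin> {} \<longrightarrow> w i = 1) \<and> \<not> regular_game K act idx g}"
      proof
        fix g assume g: "g \<in> {g \<in> ?P. \<not> regular_game K act idx g}"
        then obtain u where "has_potential act g (\<lambda>_. 1) u" by (auto simp: exact_potential_games_def)
        with g show "g \<in> {g. \<exists>w u. has_potential act g w u \<and> (\<forall>i. w i > 0) \<and>
          (\<forall>i. i \<notin> {} \<longrightarrow> w i = 1) \<and> \<not> regular_game K act idx g}"
          unfolding mem_Collect_eq by (intro exI[of _ "\<lambda>_. 1"] exI[of _ u] conjI) auto
      qed
    qed
  qed auto
  then have P: "{g \<in> ?P. \<not> regular_game K act idx g} \<in> null_sets (subspace_lebesgue ?P)"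
    by (rule null_sets_completionI)

  have pot: "has_potential act (identical_payoffs_game u) (\<lambda>_. 1) (\<lambda>y. u $ y)" for u :: "real^'y"
    by (simp add: has_potential_def identical_payoffs_game_def)
  have "{u :: real^'y. \<not> regular_game K act idx (identical_payoffs_game u)} \<subseteq> irregular_payoffs"
    using irregular_potential_game[OF pot] by auto
  then have I: "{u :: real^'y. \<not> regular_game K act idx (identical_payoffs_game u)} \<in> null_sets lebesgue"
    unfolding negligible_iff_null_sets[symmetric] by (rule negligible_subset[OF negligible_irregular_payoffs])
  have "continuous_on UNIV (identical_payoffs_game :: real^'y \<Rightarrow> real^'y^'n)"
    unfolding identical_payoffs_game_def by (intro continuous_intros)
  from closed_vimage[OF closed_irregular this]
  have "closed (identical_payoffs_game -` ?I)" .
  then have C: "closed {u :: real^'y. \<not> regular_game K act idx (identical_payoffs_game u)}"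
    by (simp add: vimage_def)
  show ?thesis unfolding Let_def by (intro conjI closedin W P C I)
qed

end
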